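(* Let $A$ generate a strongly continuous semigroup on the Hilbert space $\mathbb{H}$, let $B\in\mathcal{L}(\mathbb{U},\mathcal{D}(A^* )')$ be an admissible control operator, and let $C\in\mathcal{L}(\mathbb{H})$. Assume that the pairs $(A,C)$ and $(A^*,B^* )$ are finite-time observable in some time $T_0>0$, and that $\ker A\cap\ker C=\{0\}$ and $\ker A^*\cap\ker B^*=\{0\}$. Let $z\in\mathbb{H}$, $T>T_0$ and $x_0\in\mathbb{H}$. Set $$h(t)=y_{T,\mathrm{opt}}(t)-\bar y-P(x_{T,\mathrm{opt}}(t)-\bar x)\quad\text{and}\quad g(t)=h(T-t)\qquad\forall t\in[0,T].$$ Then $$g(t)=S_{\infty,\mathrm{opt}}^*(t)\,g(0)\qquad\forall t\in[0,T],$$ where $S_{\infty,\mathrm{opt}}^*(t)$ is the adjoint of $S_{\infty,\mathrm{opt}}(t)$.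
   Context: $\mathbb{H}$ and $\mathbb{U}$ are Hilbert spaces, identified with their duals. $A:\mathcal{D}(A)\to\mathbb{H}$ generates a strongly continuous semigroup $(e^{tA})_{t\ge0}$; $A^*$ generates the adjoint semigroup. $\mathcal{D}(A^* )$ carries the graph inner product and $\mathcal{D}(A^* )'$ is its dual with respect to the pivot space $\mathbb{H}$; $e^{tA}$ extends to $\mathcal{D}(A^* )'$. For $B\in\mathcal{L}(\mathbb{U},\mathcal{D}(A^* )')$, $B^*\in\mathcal{L}(\mathcal{D}(A^* ),\mathbb{U})$. $B$ is admissible if for all $T>0$ and $u\in L^2((0,T);\mathbb{U})$ the function $t\mapsto\int_0^te^{(t-s)A}Bu(s)\,ds$ belongs to $C([0,T];\mathbb{H})$. Solutions of $x'=Ax+Bu$, $x(0)=x_0$ are given by $x(t)=e^{tA}x_0+\int_0^te^{(t-s)A}Bu(s)\,ds$; backward adjoint equations are understood in the mild sense. $(A,C)$ is finite-time observable in time $T_0$ if there is $c>0$ with $\int_0^{T_0}\|Ce^{tA}\xi\|_{\mathbb{H}}^2dt\ge c\|e^{T_0A}\xi\|_{\mathbb{H}}^2$ for all $\xi\in\mathbb{H}$; $(A^*,B^* )$ is finite-time observable in time $T_0$ if there is $c>0$ with $\int_0^{T_0}\|B^*e^{tA^*}\xi\|_{\mathbb{U}}^2dt\ge c\|e^{T_0A^*}\xi\|_{\mathbb{H}}^2$ for all $\xi\in\mathbb{H}$, where for $\xi\in\mathbb{H}$ the function $t\mapsto B^*e^{tA^*}\xi\in L^2((0,T_0);\mathbb{U})$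 is defined by continuous extension from $\mathcal{D}(A^* )$. Finite-horizon problem: $u_{T,\mathrm{opt}}$ is the unique minimizer over $u\in L^2((0,T);\mathbb{U})$ of $\int_0^T(\|Cx(t)-z\|_{\mathbb{H}}^2+\|u(t)\|_{\mathbb{U}}^2)\,dt$, where $x'=Ax+Bu$, $x(0)=x_0$; $x_{T,\mathrm{opt}}$ is the corresponding solution; the adjoint state $y_{T,\mathrm{opt}}\in C([0,T];\mathbb{H})$ solves $y'=-A^*y-C^*(Cx_{T,\mathrm{opt}}-z)$ on $(0,T)$, $y(T)=0$. Stationary problem: $(\bar x,\bar u,\bar y)\in\mathbb{H}\times\mathbb{U}\times\mathcal{D}(A^* )$ is the unique triple (it exists under the assumptions) such that $(\bar x,\bar u)$ minimizes $\|Cx-z\|_{\mathbb{H}}^2+\|u\|_{\mathbb{U}}^2$ over $(x,u)\in\mathbb{H}\times\mathbb{U}$ with $Ax+Bu=0$ (i.e. $\langle x,A^*\varphi\rangle+\langle u,B^*\varphi\rangle=0$ for all $\varphi\in\mathcal{D}(A^* )$), and $-A^*\bar y-C^*(C\bar x-z)=0$, $\bar u=-B^*\bar y$. Infinite-horizon problem: for $\xi\in\mathbb{H}$ minimize $\int_0^\infty(\|Cx(t)\|_{\mathbb{H}}^2+\|u(t)\|_{\mathbb{U}}^2)\,dt$ over $u\in L^2((0,+\infty);\mathbb{U})$, where $x'=Ax+Bu$, $x(0)=\xi$. Under the assumptions the infimum is finite for every $\xi$ (finite cost condition), and is attained by a unique control with trajectory $\hat x_{\infty,\mathrm{opt},\xi}$.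 $P\in\mathcal{L}(\mathbb{H})$ is the unique symmetric operator such that $\langle P\xi,\xi\rangle_{\mathbb{H}}$ equals this infimum for all $\xi$. $S_{\infty,\mathrm{opt}}(t)\xi:=\hat x_{\infty,\mathrm{opt},\xi}(t)$ for $t\ge0$; it is a strongly continuous semigroup on $\mathbb{H}$. *)

theory Defs
  imports "HOL-Analysis.Analysis"
begin

text \<open>
  An unbounded operator is given by its domain \<open>D\<close> and a function \<open>A\<close> whose values outside
  \<open>D\<close> are irrelevant. Hilbert spaces are types of sort \<open>{real_inner, banach}\<close>; they are not
  assumed to be separable.
\<close>

definition C0_semigroup :: "(real \<Rightarrow> 'h::{real_inner,banach} \<Rightarrow>\<^sub>L 'h) \<Rightarrow> bool" where
  "C0_semigroup S \<longleftrightarrow> S 0 = id_blinfun \<and>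
     (\<forall>s\<ge>0. \<forall>t\<ge>0. S (s + t) = S s o\<^sub>L S t) \<and>
     (\<forall>x. ((\<lambda>t. S t x) \<longlongrightarrow> x) (at_right 0))"

definition generates ::
  "'h set \<Rightarrow> ('h \<Rightarrow> 'h) \<Rightarrow> (real \<Rightarrow> 'h::{real_inner,banach} \<Rightarrow>\<^sub>L 'h) \<Rightarrow> bool" where
  "generates D A S \<longleftrightarrow> C0_semigroup S \<and>
     D = {x. \<exists>y. ((\<lambda>t. (1 / t) *\<^sub>R (S t x - x)) \<longlongrightarrow> y) (at_right 0)} \<and>
     (\<forall>x\<in>D. ((\<lambda>t. (1 / t) *\<^sub>R (S t x - x)) \<longlongrightarrow> A x) (at_right 0))"

text \<open>The description in \<open>adj_op\<close> is meaningful for \<open>\<phi>\<close> in \<open>adj_dom D A\<close> if \<open>D\<close> is dense.\<close>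

definition adj_dom :: "'h::real_inner set \<Rightarrow> ('h \<Rightarrow> 'h) \<Rightarrow> 'h set" where
  "adj_dom D A = {\<phi>. \<exists>\<psi>. \<forall>x\<in>D. A x \<bullet> \<phi> = x \<bullet> \<psi>}"

definition adj_op :: "'h::real_inner set \<Rightarrow> ('h \<Rightarrow> 'h) \<Rightarrow> 'h \<Rightarrow> 'h" where
  "adj_op D A \<phi> = (THE \<psi>. \<forall>x\<in>D. A x \<bullet> \<phi> = x \<bullet> \<psi>)"

definition adj_graph_norm :: "'h::real_inner set \<Rightarrow> ('h \<Rightarrow> 'h) \<Rightarrow> 'h \<Rightarrow> real" where
  "adj_graph_norm D A \<phi> = sqrt (\<phi> \<bullet> \<phi> + adj_op D A \<phi> \<bullet> adj_op D A \<phi>)"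

text \<open>
  An element of \<open>D(A*)'\<close> is a functional \<open>'h \<Rightarrow> real\<close> of which only the values on \<open>adj_dom D A\<close>
  matter; \<open>x\<close> in the pivot space is identified with \<open>\<lambda>\<phi>. x \<bullet> \<phi>\<close>. The following predicate says that
  \<open>B\<close> is a bounded linear map from \<open>'u\<close> into \<open>D(A*)'\<close>.
\<close>

definition control_operator ::
  "'h::real_inner set \<Rightarrow> ('h \<Rightarrow> 'h) \<Rightarrow> ('u::real_inner \<Rightarrow> 'h \<Rightarrow> real) \<Rightarrow> bool" where
  "control_operator D A B \<longleftrightarrow>
     (\<forall>v. \<forall>\<phi>\<in>adj_dom D A. \<forall>\<psi>\<in>adj_dom D A. B v (\<phi> + \<psi>) = B v \<phi> + B v \<psi>) \<and>
     (\<forall>v c. \<forall>\<phi>\<in>adj_dom D A. B v (c *\<^sub>R \<phi>) = c * B v \<phi>) \<and>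
     (\<forall>\<phi>\<in>adj_dom D A. linear (\<lambda>v. B v \<phi>)) \<and>
     (\<exists>K. \<forall>v. \<forall>\<phi>\<in>adj_dom D A. \<bar>B v \<phi>\<bar> \<le> K * norm v * adj_graph_norm D A \<phi>)"

text \<open>\<open>B* \<phi>\<close> for \<open>\<phi>\<close> in \<open>D(A*)\<close>; the Hilbert space \<open>'u\<close> is identified with its dual.\<close>

definition control_adj :: "('u::real_inner \<Rightarrow> 'h \<Rightarrow> real) \<Rightarrow> 'h \<Rightarrow> 'u" where
  "control_adj B \<phi> = (THE w. \<forall>v. v \<bullet> w = B v \<phi>)"

text \<open>The extension of the semigroup \<open>S\<close> to \<open>D(A*)'\<close>, by duality with the adjoint semigroup.\<close>

definition semigroup_ext ::
  "(real \<Rightarrow> 'h::{real_inner,banach} \<Rightarrow>\<^sub>L 'h) \<Rightarrow> real \<Rightarrow> ('h \<Rightarrow> real) \<Rightarrow> 'h \<Rightarrow> real" where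
  "semigroup_ext S t F = (\<lambda>\<phi>. F (adjoint (S t) \<phi>))"

text \<open>
  Strong (Bochner) measurability. The library's Bochner integral is restricted to second countable
  spaces; for arbitrary Hilbert spaces \<open>L\<^sup>2\<close> is set up here directly. Its elements are
  represented by functions, not by classes modulo equality almost everywhere.
\<close>

definition strongly_measurable :: "'a measure \<Rightarrow> ('a \<Rightarrow> 'b::topological_space) \<Rightarrow> bool" where
  "strongly_measurable M f \<longleftrightarrow>
     (\<exists>s. (\<forall>n::nat. simple_function M (s n)) \<and> (AE x in M. (\<lambda>n. s n x) \<longlonglongrightarrow> f x))"

definition L2 :: "real set \<Rightarrow> (real \<Rightarrow> 'u::real_normed_vector) set" where
  "L2 I = {u. strongly_measurable (lebesgue_on I) u \<and>
              integrable (lebesgue_on I) (\<lambda>t. (norm (u t))\<^sup>2)}"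

text \<open>
  The integral over \<open>(0,t)\<close> of \<open>e\<^bsup>(t-s)A\<^esup> B u(s)\<close>, an element of \<open>D(A*)'\<close>; its value at
  \<open>\<phi>\<close> in \<open>D(A*)\<close> is the integral of the values at \<open>\<phi>\<close>.
\<close>

definition input_integral ::
  "(real \<Rightarrow> 'h::{real_inner,banach} \<Rightarrow>\<^sub>L 'h) \<Rightarrow> ('u \<Rightarrow> 'h \<Rightarrow> real) \<Rightarrow> (real \<Rightarrow> 'u) \<Rightarrow> real
     \<Rightarrow> 'h \<Rightarrow> real" where
  "input_integral S B u t =
     (\<lambda>\<phi>. LINT s:{0<..<t}|lebesgue. semigroup_ext S (t - s) (B (u s)) \<phi>)"

definition admissible ::
  "'h set \<Rightarrow> ('h \<Rightarrow> 'h) \<Rightarrow> (real \<Rightarrow> 'h::{real_inner,banach} \<Rightarrow>\<^sub>L 'h)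
     \<Rightarrow> ('u::{real_inner,banach} \<Rightarrow> 'h \<Rightarrow> real) \<Rightarrow> bool" where
  "admissible D A S B \<longleftrightarrow>
     (\<forall>T>0. \<forall>u\<in>L2 {0<..<T}. \<exists>x. continuous_on {0..T} x \<and>
        (\<forall>t\<in>{0..T}. \<forall>\<phi>\<in>adj_dom D A. x t \<bullet> \<phi> = input_integral S B u t \<phi>))"

text \<open>
  The solution of \<open>x' = A x + B u\<close>, \<open>x(0) = x0\<close>: the variation of constants formula is an equality
  in \<open>D(A*)'\<close>, and the solution is the element of \<open>'h\<close> that represents its right-hand side (unique,
  since \<open>D(A*)\<close> is dense; existing, if \<open>B\<close> is admissible and \<open>u\<close> is in \<open>L\<^sup>2\<close>).
\<close>

definition trajectory ::
  "'h set \<Rightarrow> ('h \<Rightarrow> 'h) \<Rightarrow> (real \<Rightarrow> 'h::{real_inner,banach} \<Rightarrow>\<^sub>L 'h)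
     \<Rightarrow> ('u \<Rightarrow> 'h \<Rightarrow> real) \<Rightarrow> 'h \<Rightarrow> (real \<Rightarrow> 'u) \<Rightarrow> real \<Rightarrow> 'h" where
  "trajectory D A S B x0 u t =
     (THE x. \<forall>\<phi>\<in>adj_dom D A. x \<bullet> \<phi> = S t x0 \<bullet> \<phi> + input_integral S B u t \<phi>)"

definition observable ::
  "(real \<Rightarrow> 'h::{real_inner,banach} \<Rightarrow>\<^sub>L 'h) \<Rightarrow> ('h \<Rightarrow>\<^sub>L 'h) \<Rightarrow> real \<Rightarrow> bool" where
  "observable S C T0 \<longleftrightarrow>
     (\<exists>c>0. \<forall>\<xi>. (\<integral>\<^sup>+ t\<in>{0<..<T0}. ennreal ((norm (C (S t \<xi>)))\<^sup>2) \<partial>lebesgue)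
                  \<ge> ennreal (c * (norm (S T0 \<xi>))\<^sup>2))"

text \<open>
  \<open>w\<close> is the value at \<open>\<xi>\<close> of the continuous extension, to all of \<open>'h\<close>, of the map from \<open>D(A*)\<close> to
  \<open>L\<^sup>2((0,T0);'u)\<close> that sends \<open>\<phi>\<close> to \<open>t \<mapsto> B* e\<^bsup>tA*\<^esup> \<phi>\<close>.
\<close>

definition adj_output ::
  "'h set \<Rightarrow> ('h \<Rightarrow> 'h) \<Rightarrow> (real \<Rightarrow> 'h::{real_inner,banach} \<Rightarrow>\<^sub>L 'h)
     \<Rightarrow> ('u::{real_inner,banach} \<Rightarrow> 'h \<Rightarrow> real) \<Rightarrow> real \<Rightarrow> 'h \<Rightarrow> (real \<Rightarrow> 'u) \<Rightarrow> bool" where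
  "adj_output D A S B T0 \<xi> w \<longleftrightarrow> w \<in> L2 {0<..<T0} \<and>
     ((\<lambda>\<phi>. \<integral>\<^sup>+ t\<in>{0<..<T0}.
              ennreal ((norm (control_adj B (adjoint (S t) \<phi>) - w t))\<^sup>2) \<partial>lebesgue) \<longlongrightarrow> 0)
       (inf (nhds \<xi>) (principal (adj_dom D A)))"

definition adj_observable ::
  "'h set \<Rightarrow> ('h \<Rightarrow> 'h) \<Rightarrow> (real \<Rightarrow> 'h::{real_inner,banach} \<Rightarrow>\<^sub>L 'h)
     \<Rightarrow> ('u::{real_inner,banach} \<Rightarrow> 'h \<Rightarrow> real) \<Rightarrow> real \<Rightarrow> bool" where
  "adj_observable D A S B T0 \<longleftrightarrow>
     (\<exists>c>0. \<forall>\<xi>. \<exists>w. adj_output D A S B T0 \<xi> w \<and>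
        (\<integral>\<^sup>+ t\<in>{0<..<T0}. ennreal ((norm (w t))\<^sup>2) \<partial>lebesgue)
          \<ge> ennreal (c * (norm (adjoint (S T0) \<xi>))\<^sup>2))"

text \<open>
  The quadratic cost on the time interval \<open>I\<close>: \<open>I = {0<..<T}\<close> for the finite horizon, and
  \<open>I = {0<..}\<close> with \<open>z = 0\<close> for the infinite horizon, where the cost may be infinite.
\<close>

definition cost ::
  "'h set \<Rightarrow> ('h \<Rightarrow> 'h) \<Rightarrow> (real \<Rightarrow> 'h::{real_inner,banach} \<Rightarrow>\<^sub>L 'h)
     \<Rightarrow> ('u::{real_inner,banach} \<Rightarrow> 'h \<Rightarrow> real) \<Rightarrow> ('h \<Rightarrow>\<^sub>L 'h) \<Rightarrow> 'h \<Rightarrow> real set \<Rightarrow> 'h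
     \<Rightarrow> (real \<Rightarrow> 'u) \<Rightarrow> ennreal" where
  "cost D A S B C z I x0 u =
     (\<integral>\<^sup>+ t\<in>I. ennreal ((norm (C (trajectory D A S B x0 u t) - z))\<^sup>2 + (norm (u t))\<^sup>2) \<partial>lebesgue)"

definition optimal_control ::
  "'h set \<Rightarrow> ('h \<Rightarrow> 'h) \<Rightarrow> (real \<Rightarrow> 'h::{real_inner,banach} \<Rightarrow>\<^sub>L 'h)
     \<Rightarrow> ('u::{real_inner,banach} \<Rightarrow> 'h \<Rightarrow> real) \<Rightarrow> ('h \<Rightarrow>\<^sub>L 'h) \<Rightarrow> 'h \<Rightarrow> real set \<Rightarrow> 'h
     \<Rightarrow> (real \<Rightarrow> 'u) \<Rightarrow> bool" where
  "optimal_control D A S B C z I x0 u \<longleftrightarrow>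
     u \<in> L2 I \<and> (\<forall>v\<in>L2 I. cost D A S B C z I x0 u \<le> cost D A S B C z I x0 v)"

text \<open>
  \<open>y\<close> is the mild solution on \<open>[0,T]\<close> of \<open>y' = -A* y - C* (C x - z)\<close>, \<open>y(T) = 0\<close>. The integrand is
  continuous, so that the Henstock--Kurzweil integral is just the Riemann integral.
\<close>

definition adjoint_state ::
  "(real \<Rightarrow> 'h::{real_inner,banach} \<Rightarrow>\<^sub>L 'h) \<Rightarrow> ('h \<Rightarrow>\<^sub>L 'h) \<Rightarrow> 'h \<Rightarrow> real \<Rightarrow> (real \<Rightarrow> 'h)
     \<Rightarrow> (real \<Rightarrow> 'h) \<Rightarrow> bool" where
  "adjoint_state S C z T x y \<longleftrightarrow> continuous_on {0..T} y \<and>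
     (\<forall>t\<in>{0..T}. ((\<lambda>s. adjoint (S (s - t)) (adjoint C (C (x s) - z))) has_integral y t) {t..T})"

definition stationary_pair ::
  "'h::real_inner set \<Rightarrow> ('h \<Rightarrow> 'h) \<Rightarrow> ('u::real_inner \<Rightarrow> 'h \<Rightarrow> real) \<Rightarrow> 'h \<Rightarrow> 'u \<Rightarrow> bool" where
  "stationary_pair D A B x u \<longleftrightarrow>
     (\<forall>\<phi>\<in>adj_dom D A. x \<bullet> adj_op D A \<phi> + u \<bullet> control_adj B \<phi> = 0)"

definition stationary_optimal ::
  "'h set \<Rightarrow> ('h \<Rightarrow> 'h) \<Rightarrow> ('u::{real_inner,banach} \<Rightarrow> 'h \<Rightarrow> real)
     \<Rightarrow> ('h::{real_inner,banach} \<Rightarrow>\<^sub>L 'h) \<Rightarrow> 'h \<Rightarrow> 'h \<Rightarrow> 'u \<Rightarrow> 'h \<Rightarrow> bool" where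
  "stationary_optimal D A B C z x u y \<longleftrightarrow>
     stationary_pair D A B x u \<and>
     (\<forall>x' u'. stationary_pair D A B x' u' \<longrightarrow>
        (norm (C x - z))\<^sup>2 + (norm u)\<^sup>2 \<le> (norm (C x' - z))\<^sup>2 + (norm u')\<^sup>2) \<and>
     y \<in> adj_dom D A \<and>
     - adj_op D A y - adjoint C (C x - z) = 0 \<and>
     u = - control_adj B y"

text \<open>
  The equality with the infimum is stated in \<open>ereal\<close>: it forces the infimum to be finite, and it is
  not blurred by the truncation of negative reals in \<open>ennreal\<close>.
\<close>

definition riccati_operator ::
  "'h set \<Rightarrow> ('h \<Rightarrow> 'h) \<Rightarrow> (real \<Rightarrow> 'h::{real_inner,banach} \<Rightarrow>\<^sub>L 'h)
     \<Rightarrow> ('u::{real_inner,banach} \<Rightarrow> 'h \<Rightarrow> real) \<Rightarrow> ('h \<Rightarrow>\<^sub>L 'h) \<Rightarrow> ('h \<Rightarrow>\<^sub>L 'h) \<Rightarrow> bool" where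
  "riccati_operator D A S B C P \<longleftrightarrow>
     (\<forall>\<xi> \<eta>. P \<xi> \<bullet> \<eta> = \<xi> \<bullet> P \<eta>) \<and>
     (\<forall>\<xi>. ereal (P \<xi> \<bullet> \<xi>) = enn2ereal (INF u\<in>L2 {0<..}. cost D A S B C 0 {0<..} \<xi> u))"

definition optimal_semigroup ::
  "'h set \<Rightarrow> ('h \<Rightarrow> 'h) \<Rightarrow> (real \<Rightarrow> 'h::{real_inner,banach} \<Rightarrow>\<^sub>L 'h)
     \<Rightarrow> ('u::{real_inner,banach} \<Rightarrow> 'h \<Rightarrow> real) \<Rightarrow> ('h \<Rightarrow>\<^sub>L 'h) \<Rightarrow> (real \<Rightarrow> 'h \<Rightarrow> 'h) \<Rightarrow> bool" where
  "optimal_semigroup D A S B C Sopt \<longleftrightarrow>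
     (\<forall>\<xi>. \<exists>u. optimal_control D A S B C 0 {0<..} \<xi> u \<and>
            (\<forall>t\<ge>0. Sopt t \<xi> = trajectory D A S B \<xi> u t))"

end

theory Submission
  imports Defs
begin

text \<open>
  By duality it suffices to show \<open>\<langle>h(a), \<zeta>\<rangle> = \<langle>h(T), x(T - a)\<rangle>\<close>, where \<open>x\<close> is the infinite-horizon optimal
  trajectory from \<open>\<zeta>\<close>, with control \<open>u\<close>. Pair the signal \<open>(C(x\<^sub>T - xbar), u\<^sub>T - ubar)\<close> on \<open>(a,T)\<close> with the
  signal \<open>(C x, u)\<close> in \<open>L\<^sup>2\<close>. On the one hand \<open>\<langle>P \<xi>, \<zeta>\<rangle>\<close> is the pairing over \<open>(0,\<infinity>)\<close> of the optimal
  signal from \<open>\<zeta>\<close> with the signal of any finite-cost control from \<open>\<xi>\<close>; continuing \<open>u\<^sub>T - ubar\<close>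
  optimally after time \<open>T\<close> shows that the pairing over \<open>(a,T)\<close> is the increment of
  \<open>\<langle>P(x\<^sub>T - xbar), x\<rangle>\<close>. On the other hand the first-order optimality of \<open>u\<^sub>T\<close> in the direction of
  \<open>u\<close>, switched on at time \<open>a\<close>, and the weak form of the state equation tested against \<open>ybar\<close> show
  that it is the increment of \<open>\<langle>y\<^sub>T - ybar, x\<rangle>\<close>.

  The operator \<open>Sopt t\<close> is bounded, hence has an adjoint, because the continuous extension demanded
  by \<open>adj_output\<close> bounds the map from \<open>D(A*)\<close> to \<open>L\<^sup>2\<close> in the norm of \<open>'h\<close>.
\<close>

section \<open>Hilbert spaces\<close>

text \<open>\<open>control_adj B\<close> is meaningful only on the domain of the adjoint generator,
  where neither h nor P x is known to lie, so h is not differentiated along the flow. Every identity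
  is instead an equality of L2 pairings, and minimality supplies it: a nonnegative quadratic in a
  real parameter that vanishes at 0 has no linear coefficient. Output error and control form one
  function with values in the product space; the cost is then a single squared norm, and first-order
  optimality is orthogonality. The state equation holds only against test vectors from the domain of
  the adjoint. Testing turns the input term into a real integral of the control against a continuous
  kernel. Vector-valued integrals thus occur for continuous integrands alone, and measurability in
  possibly non-separable spaces is handled through simple functions.\<close>

lemma quadratic_nonneg_imp_linear_coeff_0:
  fixes a b :: real
  assumes "\<And>l. 0 \<le> a * l\<^sup>2 + 2 * b * l"
  shows "b = 0"
proof (rule ccontr)
  assume b: "b \<noteq> 0"
  \<comment> \<open>For \<open>c > 0\<close> with \<open>a < 2 * c\<close> the quadratic at
    \<open>- b / c\<close> equals b^2 (a - 2 c) / c^2, which is negative;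
    \<open>\<bar>a\<bar> + 1\<close> is such a \<open>c\<close> whatever the sign of
    \<open>a\<close>.\<close>
  define c where "c = \<bar>a\<bar> + 1"
  have c: "c > 0" "a < 2 * c" by (auto simp: c_def)
  have "0 \<le> (a * (- b / c)\<^sup>2 + 2 * b * (- b / c)) * c\<^sup>2"
    using assms[of "- b / c"] by (intro mult_nonneg_nonneg) auto
  also have "\<dots> = b\<^sup>2 * (a - 2 * c)"
    using c by (simp add: field_simps power2_eq_square)
  also have "\<dots> < 0"
    using b c by (intro mult_pos_neg) auto
  finally show False by simp
qed

lemma norm_diff_squared_parallelogram:
  fixes x v w :: "'a::real_inner"
  shows "(norm (v - w))\<^sup>2
    = 2 * (norm (x - v))\<^sup>2 + 2 * (norm (x - w))\<^sup>2 - 4 * (norm (x - (1/2) *\<^sub>R (v + w)))\<^sup>2"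
  by (simp add: power2_norm_eq_inner algebra_simps inner_commute)

text \<open>A minimizing sequence in \<open>W\<close> is Cauchy by the parallelogram identity,
  because midpoints stay in \<open>W\<close> and so at squared distance at least \<open>d\<close>.
  Completeness gives a minimizer, and minimality along each line through it gives
  orthogonality.\<close>

lemma closed_subspace_orthogonal_projection:
  fixes W :: "'a::{real_inner,banach} set"
  assumes W: "subspace W" "closed W"
  obtains w where "w \<in> W" "\<And>v. v \<in> W \<Longrightarrow> (x - w) \<bullet> v = 0"
proof -
  define d where "d = Inf ((\<lambda>v. (norm (x - v))\<^sup>2) ` W)"
  have W0: "W \<noteq> {}" using subspace_0[OF W(1)] by auto
  have bdd: "bdd_below ((\<lambda>v. (norm (x - v))\<^sup>2) ` W)"
    by (intro bdd_belowI[of _ 0]) auto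
  have d: "d \<le> (norm (x - v))\<^sup>2" if "v \<in> W" for v
    unfolding d_def using that bdd by (intro cInf_lower) auto
  have "\<exists>v\<in>W. (norm (x - v))\<^sup>2 < d + 1 / real (Suc n)" for n
  proof -
    have "d < d + 1 / real (Suc n)" by simp
    from cInf_lessD[OF _ this[unfolded d_def]] W0 show ?thesis
      by (auto simp: d_def)
  qed
  then obtain w where w: "\<And>n. w n \<in> W" "\<And>n. (norm (x - w n))\<^sup>2 < d + 1 / real (Suc n)"
    by metis
  have diff: "(norm (w m - w n))\<^sup>2 \<le> 2 / real (Suc m) + 2 / real (Suc n)" for m n
  proof -
    have "(1/2) *\<^sub>R (w m + w n) \<in> W"
      using w W(1) by (simp add: subspace_add subspace_scale)
    from d[OF this] w(2)[of m] w(2)[of n]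
    show ?thesis unfolding norm_diff_squared_parallelogram[of "w m" "w n" x] by simp
  qed
  have "Cauchy w"
  proof (rule metric_CauchyI)
    fix e :: real assume e: "e > 0"
    then obtain N where N: "4 / real (Suc N) < e\<^sup>2"
      using reals_Archimedean[of "e\<^sup>2 / 4"] by (auto simp: field_simps)
    show "\<exists>M. \<forall>m\<ge>M. \<forall>n\<ge>M. dist (w m) (w n) < e"
    proof (intro exI allI impI)
      fix m n assume "N \<le> m" "N \<le> n"
      then have "2 / real (Suc m) \<le> 2 / real (Suc N)" "2 / real (Suc n) \<le> 2 / real (Suc N)"
        by (auto simp: field_simps)
      with diff[of m n] N have "(norm (w m - w n))\<^sup>2 < e\<^sup>2" by simp
      then show "dist (w m) (w n) < e"
        using e by (simp add: dist_norm power2_less_imp_less)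
    qed
  qed
  then obtain v where v: "w \<longlonglongrightarrow> v"
    using Cauchy_convergent_iff convergent_def by blast
  have vW: "v \<in> W" using closed_sequentially[OF W(2) w(1) v] .
  have "(\<lambda>n. (norm (x - w n))\<^sup>2) \<longlonglongrightarrow> (norm (x - v))\<^sup>2"
    by (intro tendsto_intros v)
  moreover have "(\<lambda>n. d + 1 / real (Suc n)) \<longlonglongrightarrow> d + 0"
    by (intro tendsto_intros LIMSEQ_Suc[OF lim_1_over_n])
  ultimately have vd: "(norm (x - v))\<^sup>2 \<le> d"
    using w(2) by (intro LIMSEQ_le[where X="\<lambda>n. (norm (x - w n))\<^sup>2" and Y="\<lambda>n. d + 1 / real (Suc n)"])
      (auto intro: less_imp_le)
  have "(x - v) \<bullet> u = 0" if u: "u \<in> W" for u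
  proof -
    have "0 \<le> (u \<bullet> u) * l\<^sup>2 + 2 * (- ((x - v) \<bullet> u)) * l" for l
    proof -
      have "v + l *\<^sub>R u \<in> W" using u vW W(1) by (simp add: subspace_add subspace_scale)
      from d[OF this] vd have "(norm (x - v))\<^sup>2 \<le> (norm (x - v - l *\<^sub>R u))\<^sup>2"
        by (simp only: diff_diff_eq)
      then show ?thesis
        unfolding power2_norm_eq_inner by (simp add: algebra_simps inner_commute power2_eq_square)
    qed
    from quadratic_nonneg_imp_linear_coeff_0[OF this] show ?thesis by simp
  qed
  with vW show ?thesis by (rule that)
qed

lemma subspace_closure:
  fixes W :: "'a::real_normed_vector set"
  assumes "subspace W"
  shows "subspace (closure W)"
proof -
  have add: "x + y \<in> closure W" if "x \<in> closure W" "y \<in> closure W" for x y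
  proof -
    from that obtain f g where "\<And>n. f n \<in> W" "f \<longlonglongrightarrow> x" "\<And>n. g n \<in> W" "g \<longlonglongrightarrow> y"
      unfolding closure_sequential by metis
    then show ?thesis unfolding closure_sequential
      by (intro exI[of _ "\<lambda>n. f n + g n"]) (auto intro: subspace_add[OF assms] tendsto_add)
  qed
  have sc: "c *\<^sub>R x \<in> closure W" if "x \<in> closure W" for x c
  proof -
    from that obtain f where "\<And>n. f n \<in> W" "f \<longlonglongrightarrow> x"
      unfolding closure_sequential by metis
    then show ?thesis unfolding closure_sequential
      by (intro exI[of _ "\<lambda>n. c *\<^sub>R f n"])
        (auto intro: subspace_scale[OF assms] tendsto_scaleR)
  qed
  have "0 \<in> closure W" using subspace_0[OF assms] closure_subset by auto
  with add sc show ?thesis unfolding subspace_def by auto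
qed

text \<open>What the projection onto the closure leaves over of \<open>x\<close> is orthogonal to
  \<open>W\<close>, hence 0.\<close>

lemma subspace_dense_if_orthogonal_complement_trivial:
  fixes W :: "'a::{real_inner,banach} set"
  assumes "subspace W" "\<And>x. (\<And>w. w \<in> W \<Longrightarrow> x \<bullet> w = 0) \<Longrightarrow> x = 0"
  shows "closure W = UNIV"
proof -
  have "x \<in> closure W" for x
  proof -
    obtain w where w: "w \<in> closure W" "\<And>v. v \<in> closure W \<Longrightarrow> (x - w) \<bullet> v = 0"
      using closed_subspace_orthogonal_projection[OF subspace_closure[OF assms(1)] closed_closure]
      by blast
    have "x - w = 0"
      using closure_subset by (intro assms(2) w(2)) auto
    with w(1) show ?thesis by simp
  qed
  then show ?thesis by auto
qed

text \<open>The orthogonal complement of the kernel is spanned by a single vector \<open>e\<close>,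
  the remainder of any \<open>x\<close> with \<open>f x \<noteq> 0\<close> after projection onto the
  kernel; evaluation at \<open>e\<close> fixes the scalar.\<close>

lemma Riesz_representation:
  fixes f :: "'a::{real_inner,banach} \<Rightarrow> real"
  assumes "bounded_linear f"
  obtains y where "\<And>x. f x = x \<bullet> y"
proof (cases "\<forall>x. f x = 0")
  case True
  then show ?thesis by (intro that[of 0]) auto
next
  case False
  interpret bounded_linear f by fact
  from False obtain x where x: "f x \<noteq> 0" by auto
  define W where "W = f -` {0}"
  have "subspace W"
    unfolding W_def subspace_def by (auto simp: add scale zero)
  moreover have "closed W"
    unfolding W_def by (intro closed_vimage_Int[of _ UNIV, simplified] continuous_closed_vimage)
      (auto intro: continuous_intros isCont)
  ultimately obtain w where w: "w \<in> W" "\<And>v. v \<in> W \<Longrightarrow> (x - w) \<bullet> v = 0"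
    using closed_subspace_orthogonal_projection by blast
  define e where "e = x - w"
  have fe: "f e = f x" using w(1) by (simp add: e_def W_def diff)
  then have "e \<noteq> 0" using x zero by auto
  have "f v = v \<bullet> ((f e / (e \<bullet> e)) *\<^sub>R e)" for v
  proof -
    have "f (v - (f v / f e) *\<^sub>R e) = 0" using fe x by (simp add: diff scale)
    then have "e \<bullet> (v - (f v / f e) *\<^sub>R e) = 0" unfolding e_def by (intro w(2)) (simp add: W_def)
    then show ?thesis using \<open>e \<noteq> 0\<close> fe x
      by (simp add: algebra_simps inner_commute field_simps)
  qed
  then show ?thesis by (rule that)
qed

text \<open>\<open>adjoint\<close> is a choice among all functions that satisfy the duality
  identity; Riesz vectors show that there is one to choose.\<close>

lemma adjoint_inner:
  fixes f :: "'a::{real_inner,banach} \<Rightarrow> 'b::real_inner"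
  assumes "bounded_linear f"
  shows "f x \<bullet> y = x \<bullet> adjoint f y"
proof -
  have "\<forall>y. \<exists>z. \<forall>x. f x \<bullet> y = x \<bullet> z"
  proof
    fix y
    have "bounded_linear (\<lambda>x. f x \<bullet> y)"
      by (rule bounded_linear_compose[OF bounded_linear_inner_left assms])
    then obtain z where "\<And>x. f x \<bullet> y = x \<bullet> z" by (rule Riesz_representation) blast
    then show "\<exists>z. \<forall>x. f x \<bullet> y = x \<bullet> z" by blast
  qed
  then have "\<exists>f'. \<forall>x y. f x \<bullet> y = x \<bullet> f' y" by metis
  then show ?thesis unfolding adjoint_def by (rule someI2_ex) blast
qed

lemma inner_eq_imp_eq:
  fixes y z :: "'a::real_inner"
  assumes "\<And>x. x \<bullet> y = x \<bullet> z"
  shows "y = z"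
  using assms[of "y - z"] by (metis inner_diff_right inner_eq_zero_iff right_minus_eq cancel_comm_monoid_add_class.diff_cancel)

lemma norm_le_if_inner_le:
  fixes y :: "'a::real_inner"
  assumes "\<bar>y \<bullet> y\<bar> \<le> M * norm y" "0 \<le> M"
  shows "norm y \<le> M"
proof (cases "y = 0")
  case False
  then show ?thesis using assms(1)
    by (simp add: power2_norm_eq_inner[symmetric] power2_eq_square)
qed (use assms in simp)

text \<open>\<open>adjoint\<close> returns a bare function; the bundled form is what
  \<open>C0_semigroup\<close> expects of the adjoint family.\<close>

definition adj_blinfun :: "('a::{real_inner,banach} \<Rightarrow>\<^sub>L 'b::real_inner) \<Rightarrow> 'b \<Rightarrow>\<^sub>L 'a" where
  "adj_blinfun F = Blinfun (adjoint F)"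

lemma
  fixes F :: "'a::{real_inner,banach} \<Rightarrow>\<^sub>L 'b::real_inner"
  shows adjoint_eq_adj_blinfun: "adjoint (blinfun_apply F) = blinfun_apply (adj_blinfun F)"
    and norm_adj_blinfun_le: "norm (adj_blinfun F) \<le> norm F"
    and inner_adj_blinfun: "x \<bullet> blinfun_apply (adj_blinfun F) y = F x \<bullet> y"
proof -
  have adj: "F x \<bullet> y = x \<bullet> adjoint F y" for x y
    by (rule adjoint_inner) (rule blinfun.bounded_linear_right)
  have bnd: "norm (adjoint F y) \<le> norm F * norm y" for y
  proof (rule norm_le_if_inner_le)
    let ?x = "adjoint F y"
    have "\<bar>F ?x \<bullet> y\<bar> \<le> norm (F ?x) * norm y" by (rule Cauchy_Schwarz_ineq2)
    also have "\<dots> \<le> (norm F * norm ?x) * norm y" by (intro mult_right_mono norm_blinfun) auto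
    finally show "\<bar>?x \<bullet> ?x\<bar> \<le> norm F * norm y * norm ?x" by (simp add: adj mult_ac)
    show "0 \<le> norm F * norm y" by simp
  qed
  have bl: "bounded_linear (adjoint F)"
  proof (rule bounded_linear_intro)
    show "adjoint F (y + z) = adjoint F y + adjoint F z" for y z
      by (rule inner_eq_imp_eq) (simp add: adj[symmetric] inner_add_right)
    show "adjoint F (c *\<^sub>R y) = c *\<^sub>R adjoint F y" for c y
      by (rule inner_eq_imp_eq) (simp add: adj[symmetric])
    show "norm (adjoint F y) \<le> norm y * norm F" for y using bnd[of y] by (simp add: mult_ac)
  qed
  show eq: "adjoint F = adj_blinfun F" unfolding adj_blinfun_def
    using bounded_linear_Blinfun_apply[OF bl] by simp
  show "norm (adj_blinfun F) \<le> norm F"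
    by (rule norm_blinfun_bound) (use bnd eq in auto)
  show "x \<bullet> adj_blinfun F y = F x \<bullet> y" using adj eq by simp
qed

text \<open>By Baire's theorem one of the closed sets \<open>E n\<close> contains a ball;
  differences of points of that ball carry its bound over to all directions.\<close>

lemma uniform_boundedness:
  fixes T :: "'i \<Rightarrow> 'a::banach \<Rightarrow>\<^sub>L 'b::real_normed_vector"
  assumes "\<And>x. \<exists>k. \<forall>i. norm (T i x) \<le> k"
  shows "\<exists>K. \<forall>i. norm (T i) \<le> K"
proof -
  define E where "E n = {x. \<forall>i. norm (T i x) \<le> real n}" for n
  have cl: "closed (E n)" for n
  proof -
    have "E n = (\<Inter>i. {x. norm (T i x) \<le> real n})" by (auto simp: E_def)
    moreover have "closed {x. norm (T i x) \<le> real n}" for i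
      by (intro closed_Collect_le continuous_intros)
    ultimately show ?thesis by auto
  qed
  have "(\<Union>n. E n) = UNIV"
  proof -
    have "x \<in> (\<Union>n. E n)" for x
    proof -
      obtain k where k: "\<forall>i. norm (T i x) \<le> k" using assms by blast
      obtain n where "k \<le> real n" using real_arch_simple by blast
      with k have "x \<in> E n" unfolding E_def by (auto intro: order.trans)
      then show ?thesis by blast
    qed
    then show ?thesis by auto
  qed
  moreover have "interior (\<Union>n. E n) = {}" if "\<And>n. interior (E n) = {}"
  proof -
    have "completely_metrizable_space (euclidean :: 'a topology)"
      by (rule completely_metrizable_space_euclidean)
    then have "euclidean interior_of (\<Union>(range E)) = {}"
      using that cl by (intro Baire_category_alt) auto
    then show ?thesis by simp
  qed
  ultimately obtain n where "interior (E n) \<noteq> {}" by auto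
  then obtain x e where e: "e > 0" "ball x e \<subseteq> E n"
    by (metis all_not_in_conv mem_interior)
  have "norm (T i) \<le> 4 * real n / e" for i
  proof (rule norm_blinfun_bound)
    show "0 \<le> 4 * real n / e" using e by simp
    fix y :: 'a
    show "norm (T i y) \<le> 4 * real n / e * norm y"
    proof (cases "y = 0")
      case False
      \<comment> \<open>Scales \<open>y\<close> to norm \<open>e / 2\<close>, so that
        \<open>x + c *\<^sub>R y\<close> stays in the open ball; the bound \<open>2 * n\<close> for
        the difference then becomes \<open>4 * n / e\<close>.\<close>
      define c where "c = e / (2 * norm y)"
      have c: "c > 0" using False e by (simp add: c_def)
      have "x + c *\<^sub>R y \<in> E n" "x \<in> E n"
        using e False by (auto intro!: subsetD[OF e(2)] simp: dist_norm c_def)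
      then have "norm (T i (x + c *\<^sub>R y)) \<le> n" "norm (T i x) \<le> n" by (auto simp: E_def)
      moreover have "c *\<^sub>R T i y = T i (x + c *\<^sub>R y) - T i x"
        by (simp add: blinfun.add_right blinfun.scaleR_right)
      ultimately have "norm (c *\<^sub>R T i y) \<le> 2 * n"
        using norm_triangle_ineq4[of "T i (x + c *\<^sub>R y)" "T i x"] by simp
      then have "c * norm (T i y) \<le> 2 * n" using c by simp
      then show ?thesis using False e by (simp add: c_def field_simps)
    qed (simp add: blinfun.zero_right)
  qed
  then show ?thesis by blast
qed

section \<open>Strongly continuous semigroups and their adjoints\<close>

lemma average_tendsto_right:
  fixes f :: "real \<Rightarrow> 'a::banach"
  assumes "continuous_on {a..} f"
  shows "((\<lambda>h. (1 / h) *\<^sub>R integral {a..a + h} f) \<longlongrightarrow> f a) (at_right 0)"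
proof (rule tendstoI)
  fix e :: real assume e: "e > 0"
  from assms have "continuous (at a within {a..}) f"
    by (auto simp: continuous_on_eq_continuous_within)
  then obtain d where d: "d > 0" "\<And>x. x \<ge> a \<Longrightarrow> dist x a < d \<Longrightarrow> dist (f x) (f a) < e / 2"
    using e unfolding continuous_within_eps_delta by (metis atLeast_iff half_gt_zero)
  have "dist ((1 / h) *\<^sub>R integral {a..a + h} f) (f a) < e" if h: "0 < h" "h < d" for h
  proof -
    have int: "f integrable_on {a..a + h}"
      by (intro integrable_continuous_interval continuous_on_subset[OF assms]) auto
    have cont: "continuous_on {a..a + h} f" by (rule continuous_on_subset[OF assms]) auto
    have "norm (integral {a..a + h} (\<lambda>x. f x - f a)) \<le> (e / 2) * (a + h - a)"
      using d h by (intro integral_bound)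
        (auto intro!: continuous_on_diff cont less_imp_le simp: dist_norm)
    also have "integral {a..a + h} (\<lambda>x. f x - f a) = integral {a..a + h} f - h *\<^sub>R f a"
      using h by (subst integral_diff[OF int integrable_const_ivl]) simp
    finally have "norm (integral {a..a + h} f - h *\<^sub>R f a) \<le> e / 2 * h" by simp
    moreover have eq: "(1 / h) *\<^sub>R integral {a..a + h} f - f a
        = (1 / h) *\<^sub>R (integral {a..a + h} f - h *\<^sub>R f a)"
      using h by (simp add: algebra_simps)
    ultimately have "norm ((1 / h) *\<^sub>R integral {a..a + h} f - f a) \<le> e / 2"
      unfolding eq norm_scaleR using h by (simp add: field_simps)
    then show ?thesis using e by (simp add: dist_norm)
  qed
  then show "\<forall>\<^sub>F h in at_right 0. dist ((1 / h) *\<^sub>R integral {a..a + h} f) (f a) < e"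
    unfolding eventually_at_right_field using d(1) by auto
qed

locale strongly_continuous_semigroup =
  fixes S :: "real \<Rightarrow> 'h::{real_inner,banach} \<Rightarrow>\<^sub>L 'h"
  assumes C0: "C0_semigroup S"
begin

lemma S_0 [simp]: "S 0 x = x"
  using C0 by (simp add: C0_semigroup_def)

lemma S_add: "0 \<le> s \<Longrightarrow> 0 \<le> t \<Longrightarrow> S (s + t) x = S s (S t x)"
  using C0 by (simp add: C0_semigroup_def)

lemma S_tendsto_0: "((\<lambda>t. S t x) \<longlongrightarrow> x) (at 0 within {0..})"
proof -
  have "((\<lambda>t. S t x) \<longlongrightarrow> x) (at_right 0)" using C0 by (simp add: C0_semigroup_def)
  moreover have "at (0::real) within {0..} = at_right 0"
    by (rule at_within_nhd[of _ UNIV]) auto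
  ultimately show ?thesis by simp
qed

text \<open>Otherwise there are times \<open>t n\<close> tending to 0 with
  \<open>norm (S (t n)) > n\<close>, while every orbit converges, hence stays bounded, along these
  times; this contradicts uniform boundedness.\<close>

lemma bounded_near_0: "\<exists>d>0. \<exists>M. \<forall>t\<in>{0..d}. norm (S t) \<le> M"
proof (rule ccontr)
  assume "\<not> ?thesis"
  then have "\<exists>t\<in>{0..inverse (real (Suc n))}. norm (S t) > real n" for n
    by (metis inverse_positive_iff_positive not_le of_nat_0_less_iff zero_less_Suc)
  then have "\<exists>t. 0 \<le> t \<and> t \<le> inverse (real (Suc n)) \<and> norm (S t) > real n" for n
    by (meson atLeastAtMost_iff)
  then obtain t where t: "\<And>n. 0 \<le> t n" "\<And>n. t n \<le> inverse (real (Suc n))"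
      "\<And>n. norm (S (t n)) > real n"
    by metis
  have "\<exists>k. \<forall>n. norm (S (t n) x) \<le> k" for x
  proof -
    have "t \<longlonglongrightarrow> 0"
      using t by (intro tendsto_sandwich[OF _ _ tendsto_const LIMSEQ_inverse_real_of_nat]) auto
    moreover have "continuous (at 0 within {0..}) (\<lambda>t. S t x)"
      using S_tendsto_0[of x] by (simp add: continuous_within)
    ultimately have "(\<lambda>n. S (t n) x) \<longlonglongrightarrow> S 0 x"
      using t(1) by (auto simp: continuous_within_sequentially o_def)
    then have "Bseq (\<lambda>n. S (t n) x)" using Bseq_eq_bounded convergent_imp_Bseq convergentI by blast
    then show ?thesis by (auto simp: Bseq_def)
  qed
  from uniform_boundedness[OF this] obtain K where K: "\<And>n. norm (S (t n)) \<le> K" by blast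
  obtain n where "K \<le> real n" using real_arch_simple by blast
  with K[of n] t(3)[of n] show False by simp
qed

text \<open>Steps of length at most \<open>d\<close> give a product of bounds; since
  \<open>M \<ge> 1\<close>, the powers increase and one exponent serves all shorter times.\<close>

lemma bounded_on_interval:
  obtains M where "M \<ge> 1" "\<And>t. 0 \<le> t \<Longrightarrow> t \<le> T \<Longrightarrow> norm (S t) \<le> M"
proof -
  obtain d M0 where d: "d > 0" and M0: "\<And>t. 0 \<le> t \<Longrightarrow> t \<le> d \<Longrightarrow> norm (S t) \<le> M0"
    using bounded_near_0 by (metis atLeastAtMost_iff)
  define M where "M = max 1 M0"
  have M: "M \<ge> 1" "\<And>t. 0 \<le> t \<Longrightarrow> t \<le> d \<Longrightarrow> norm (S t) \<le> M"
    using M0 by (force simp: M_def)+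
  have *: "norm (S t) \<le> M ^ Suc n" if "0 \<le> t" "t \<le> real n * d" for n t
    using that
  proof (induction n arbitrary: t)
    case 0
    then show ?case using M(2)[of t] d by simp
  next
    case (Suc n)
    show ?case
    proof (cases "t \<le> real n * d")
      case True
      then have "norm (S t) \<le> M ^ Suc n" using Suc by simp
      also have "\<dots> \<le> M ^ Suc (Suc n)" using M(1) by (intro power_increasing) auto
      finally show ?thesis .
    next
      case False
      show ?thesis
      proof (cases "t \<le> d")
        case True
        then have "norm (S t) \<le> M ^ 1" using M(2) Suc by simp
        also have "\<dots> \<le> M ^ Suc (Suc n)" using M(1) by (intro power_increasing) auto
        finally show ?thesis .
      next
        case F: False
        have "S t = S d o\<^sub>L S (t - d)"
          using S_add[of d "t - d"] F d by (intro blinfun_eqI) simp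
        then have "norm (S t) \<le> norm (S d) * norm (S (t - d))" by (simp add: norm_blinfun_compose)
        also have "\<dots> \<le> M * M ^ Suc n"
          using M d F Suc by (intro mult_mono) (auto simp: algebra_simps)
        finally show ?thesis by simp
      qed
    qed
  qed
  obtain n where "T / d \<le> real n" using real_arch_simple by blast
  then have "T \<le> real n * d" using d by (simp add: field_simps)
  show ?thesis
  proof (rule that[of "M ^ Suc n"])
    show "1 \<le> M ^ Suc n" using M(1) by (rule one_le_power)
    show "norm (S t) \<le> M ^ Suc n" if "0 \<le> t" "t \<le> T" for t
      using that \<open>T \<le> real n * d\<close> by (intro *) auto
  qed
qed

text \<open>For \<open>a \<le> b\<close> the difference of two orbit values is \<open>S a\<close>
  applied to \<open>S (b - a) x - x\<close>. With the local bound on \<open>S a\<close>, continuity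
  at 0 from the right yields continuity from both sides everywhere.\<close>

lemma continuous_on_orbit: "continuous_on {0..} (\<lambda>t. S t x)"
proof -
  have "continuous_on {0..T} (\<lambda>t. S t x)" for T
  proof (unfold continuous_on_iff, intro ballI allI impI)
    fix s and e :: real assume s: "s \<in> {0..T}" and e: "e > 0"
    obtain M where M: "M \<ge> 1" "\<And>t. 0 \<le> t \<Longrightarrow> t \<le> T \<Longrightarrow> norm (S t) \<le> M"
      by (rule bounded_on_interval) blast
    have "\<forall>\<^sub>F t in at 0 within {0..}. dist (S t x) x < e / M"
      using S_tendsto_0[of x] M(1) e by (intro tendstoD) auto
    then obtain d where d: "d > 0" and
      d': "\<And>t. 0 \<le> t \<Longrightarrow> t \<noteq> 0 \<Longrightarrow> t < d \<Longrightarrow> dist (S t x) x < e / M"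
      unfolding eventually_at by (auto simp: dist_real_def)
    have d2: "dist (S t x) x < e / M" if "0 \<le> t" "t < d" for t
      using d'[of t] that e M(1) by (cases "t = 0") auto
    have *: "dist (S b x) (S a x) < e" if "0 \<le> a" "a \<le> b" "b \<le> T" "b - a < d" for a b
    proof -
      have "S b x = S a (S (b - a) x)" using S_add[of a "b - a" x] that by simp
      then have "dist (S b x) (S a x) = norm (S a (S (b - a) x - x))"
        by (simp add: dist_norm blinfun.diff_right)
      also have "\<dots> \<le> M * norm (S (b - a) x - x)"
        using M(2)[of a] that
        by (intro order.trans[OF norm_blinfun] mult_right_mono) auto
      also have "\<dots> < M * (e / M)"
        using M(1) d2[of "b - a"] that by (intro mult_strict_left_mono) (auto simp: dist_norm)
      finally show ?thesis using M(1) by simp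
    qed
    show "\<exists>d>0. \<forall>t\<in>{0..T}. dist t s < d \<longrightarrow> dist (S t x) (S s x) < e"
    proof (intro exI conjI ballI impI)
      fix t assume "t \<in> {0..T}" "dist t s < d"
      then show "dist (S t x) (S s x) < e"
        using *[of t s] *[of s t] s by (cases "s \<le> t") (auto simp: dist_real_def dist_commute)
    qed fact
  qed
  then have *: "continuous_on {0..<T} (\<lambda>t. S t x)" for T
    by (rule continuous_on_subset[of "{0..T}"]) auto
  show ?thesis
  proof (unfold continuous_on_eq_continuous_within, intro ballI)
    fix t :: real assume t: "t \<in> {0..}"
    have "at t within {0..} = at t within {0..<t + 1}"
      using t by (intro at_within_nhd[of _ "{..<t + 1}"]) auto
    then show "continuous (at t within {0..}) (\<lambda>t. S t x)"
      using *[of "t + 1"] t by (auto simp: continuous_on_eq_continuous_within continuous_within)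
  qed
qed

lemma continuous_on_orbit_subset: "X \<subseteq> {0..} \<Longrightarrow> continuous_on X (\<lambda>t. S t x)"
  using continuous_on_orbit continuous_on_subset by blast

lemma integrable_orbit: "0 \<le> a \<Longrightarrow> (\<lambda>t. S t x) integrable_on {a..b}"
  by (intro integrable_continuous_interval continuous_on_orbit_subset) auto

text \<open>The integrated semigroup. It maps every vector into the domain of the generator, and
  divided by \<open>t\<close> it tends strongly to the identity at 0; both density statements below
  rest on these two properties.\<close>

definition V :: "real \<Rightarrow> 'h \<Rightarrow> 'h" where
  "V t x = integral {0..t} (\<lambda>r. S r x)"

lemma V_inner: "V t x \<bullet> y = integral {0..t} (\<lambda>r. S r x \<bullet> y)"
  using integral_linear[OF integrable_orbit[of 0 x t] bounded_linear_inner_left[of y]]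
  by (simp add: V_def o_def)

lemma bounded_linear_V: "bounded_linear (V t)"
proof -
  obtain M where M: "M \<ge> 1" "\<And>s. 0 \<le> s \<Longrightarrow> s \<le> t \<Longrightarrow> norm (S s) \<le> M"
    by (rule bounded_on_interval) blast
  show ?thesis
  proof (rule bounded_linear_intro)
    show "V t (x + y) = V t x + V t y" for x y
      by (simp add: V_def blinfun.add_right integral_add integrable_orbit)
    show "V t (c *\<^sub>R x) = c *\<^sub>R V t x" for c x
      by (simp add: V_def blinfun.scaleR_right)
    show "norm (V t x) \<le> norm x * (M * max 0 t)" for x
    proof (cases "0 \<le> t")
      case True
      have "norm (integral {0..t} (\<lambda>r. S r x)) \<le> (M * norm x) * (t - 0)"
        using M True
        by (intro integral_bound continuous_on_orbit_subset)
          (auto intro!: order.trans[OF norm_blinfun] mult_right_mono)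
      with True show ?thesis by (simp add: V_def mult_ac)
    qed (simp add: V_def)
  qed
qed

lemma norm_V_le:
  assumes "0 \<le> t" "\<And>s. 0 \<le> s \<Longrightarrow> s \<le> t \<Longrightarrow> norm (S s) \<le> M"
  shows "norm (V t x) \<le> M * norm x * t"
proof -
  have "norm (integral {0..t} (\<lambda>r. S r x)) \<le> (M * norm x) * (t - 0)"
    using assms
    by (intro integral_bound continuous_on_orbit_subset)
      (auto intro!: order.trans[OF norm_blinfun] mult_right_mono)
  then show ?thesis by (simp add: V_def)
qed

lemma V_average: "((\<lambda>h. (1 / h) *\<^sub>R V h x) \<longlongrightarrow> x) (at_right 0)"
  using average_tendsto_right[OF continuous_on_orbit, of x] by (simp add: V_def)

lemma S_V: 
  assumes "0 \<le> h" "0 \<le> t"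
  shows "S h (V t x) = V (t + h) x - V h x" and "S h (V t x) = V t (S h x)"
proof -
  have "S h (V t x) = integral {0..t} (\<lambda>r. S h (S r x))"
    using integral_linear[OF integrable_orbit[of 0 x t] blinfun.bounded_linear_right[of "S h"]]
    by (simp add: V_def o_def)
  also have *: "\<dots> = integral {0..t} (\<lambda>r. S (r + h) x)"
    using assms by (intro integral_cong) (simp add: S_add[symmetric] add.commute)
  also have "\<dots> = integral {h..t + h} (\<lambda>r. S r x)"
    using integral_shift_real_ivl[of h h "t + h" "\<lambda>r. S r x"] by simp
  also have "\<dots> = V (t + h) x - V h x"
    using Henstock_Kurzweil_Integration.integral_combine[where a=0 and c=h and b="t + h" and f="\<lambda>r. S r x"] assms integrable_orbit
    by (simp add: V_def algebra_simps)
  finally show "S h (V t x) = V (t + h) x - V h x" .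
  have "V t (S h x) = integral {0..t} (\<lambda>r. S (r + h) x)"
    unfolding V_def using assms by (intro integral_cong) (simp add: S_add)
  with \<open>S h (V t x) = integral {0..t} (\<lambda>r. S h (S r x))\<close> * 
  show "S h (V t x) = V t (S h x)" by simp
qed

text \<open>The integrals over [h, t + h] and [0, t] differ by the integral over [t, t + h] minus
  that over [0, h]: two averages, one at \<open>t\<close> and one at 0.\<close>

lemma V_difference_quotient:
  assumes "0 \<le> t"
  shows "((\<lambda>h. (1 / h) *\<^sub>R (S h (V t x) - V t x)) \<longlongrightarrow> S t x - x) (at_right 0)"
proof -
  have "((\<lambda>h. (1 / h) *\<^sub>R integral {t..t + h} (\<lambda>r. S r x) - (1 / h) *\<^sub>R V h x) \<longlongrightarrow> S t x - x)
      (at_right 0)"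
    using assms
    by (intro tendsto_diff V_average average_tendsto_right continuous_on_orbit_subset) auto
  moreover have "\<forall>\<^sub>F h in at_right 0. (1 / h) *\<^sub>R integral {t..t + h} (\<lambda>r. S r x) - (1 / h) *\<^sub>R V h x
      = (1 / h) *\<^sub>R (S h (V t x) - V t x)"
    unfolding eventually_at_right_field
  proof (intro exI[of _ 1] conjI allI impI)
    fix h :: real assume h: "0 < h"
    have "integral {t..t + h} (\<lambda>r. S r x) = V (t + h) x - V t x"
      using Henstock_Kurzweil_Integration.integral_combine[where a=0 and c=t and b="t + h" and f="\<lambda>r. S r x"] assms h integrable_orbit
      by (simp add: V_def algebra_simps)
    then show "(1 / h) *\<^sub>R integral {t..t + h} (\<lambda>r. S r x) - (1 / h) *\<^sub>R V h x
      = (1 / h) *\<^sub>R (S h (V t x) - V t x)"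
      using S_V(1)[of h t x] assms h
      by (simp add: scaleR_diff_right[symmetric] algebra_simps del: scaleR_diff_right)
  qed simp
  ultimately show ?thesis by (rule Lim_transform_eventually)
qed

end

section \<open>Generators, their adjoints and the adjoint semigroup\<close>

locale generator =
  fixes D :: "'h::{real_inner,banach} set" and A :: "'h \<Rightarrow> 'h"
    and S :: "real \<Rightarrow> 'h \<Rightarrow>\<^sub>L 'h"
  assumes gen: "generates D A S"
begin

sublocale strongly_continuous_semigroup S
  by unfold_locales (use gen in \<open>simp add: generates_def\<close>)

lemma generator_eqI:
  assumes "((\<lambda>t. (1 / t) *\<^sub>R (S t x - x)) \<longlongrightarrow> y) (at_right 0)"
  shows "x \<in> D" and "A x = y"
proof -
  show x: "x \<in> D" using gen assms unfolding generates_def by blast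
  then have "((\<lambda>t. (1 / t) *\<^sub>R (S t x - x)) \<longlongrightarrow> A x) (at_right 0)"
    using gen unfolding generates_def by blast
  then show "A x = y" using assms tendsto_unique trivial_limit_at_right_real by blast
qed

lemma generator_tendsto: "x \<in> D \<Longrightarrow> ((\<lambda>t. (1 / t) *\<^sub>R (S t x - x)) \<longlongrightarrow> A x) (at_right 0)"
  using gen unfolding generates_def by blast

lemma V_in_domain: "0 \<le> t \<Longrightarrow> V t x \<in> D" and A_V: "0 \<le> t \<Longrightarrow> A (V t x) = S t x - x"
  using generator_eqI[OF V_difference_quotient] by auto

text \<open>\<open>S t\<close> and \<open>V t\<close> are bounded and commute with every
  \<open>S h\<close>, so they pass through the difference quotient that defines \<open>A x\<close>.
  For \<open>V t\<close> its limit is also given by \<open>V_difference_quotient\<close>; comparing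
  both values yields the last identity.\<close>

lemma
  assumes "x \<in> D" "0 \<le> t"
  shows S_in_domain: "S t x \<in> D" and A_S: "A (S t x) = S t (A x)"
    and V_A: "V t (A x) = S t x - x"
proof -
  have "((\<lambda>h. S t ((1 / h) *\<^sub>R (S h x - x))) \<longlongrightarrow> S t (A x)) (at_right 0)"
    by (intro bounded_linear.tendsto[OF blinfun.bounded_linear_right] generator_tendsto assms)
  moreover have "\<forall>\<^sub>F h in at_right 0. S t ((1 / h) *\<^sub>R (S h x - x)) = (1 / h) *\<^sub>R (S h (S t x) - S t x)"
    unfolding eventually_at_right_field
    using assms(2) S_add[of _ t x] S_add[of t _ x]
    by (intro exI[of _ 1]) (auto simp: blinfun.scaleR_right blinfun.diff_right add.commute)
  ultimately have "((\<lambda>h. (1 / h) *\<^sub>R (S h (S t x) - S t x)) \<longlongrightarrow> S t (A x)) (at_right 0)"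
    by (rule Lim_transform_eventually)
  then show "S t x \<in> D" "A (S t x) = S t (A x)" by (rule generator_eqI)+
  interpret V: bounded_linear "V t" by (rule bounded_linear_V)
  have "((\<lambda>h. V t ((1 / h) *\<^sub>R (S h x - x))) \<longlongrightarrow> V t (A x)) (at_right 0)"
    by (intro V.tendsto generator_tendsto assms)
  moreover have "\<forall>\<^sub>F h in at_right 0. V t ((1 / h) *\<^sub>R (S h x - x)) = (1 / h) *\<^sub>R (S h (V t x) - V t x)"
    unfolding eventually_at_right_field
    using assms(2) by (intro exI[of _ 1]) (auto simp: V.scaleR V.diff S_V(2))
  ultimately have "((\<lambda>h. (1 / h) *\<^sub>R (S h (V t x) - V t x)) \<longlongrightarrow> V t (A x)) (at_right 0)"
    by (rule Lim_transform_eventually)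
  then show "V t (A x) = S t x - x"
    using V_difference_quotient[OF assms(2), of x] tendsto_unique trivial_limit_at_right_real by blast
qed

lemma eq_0_if_V_orthogonal:
  assumes "\<And>t. 0 < t \<Longrightarrow> V t x \<bullet> y = 0"
  shows "x \<bullet> y = 0"
proof -
  have "((\<lambda>h. ((1 / h) *\<^sub>R V h x) \<bullet> y) \<longlongrightarrow> x \<bullet> y) (at_right 0)"
    by (intro tendsto_inner V_average tendsto_const)
  moreover have "\<forall>\<^sub>F h in at_right 0. ((1 / h) *\<^sub>R V h x) \<bullet> y = 0"
    unfolding eventually_at_right_field using assms by (intro exI[of _ 1]) auto
  ultimately have "((\<lambda>h::real. 0) \<longlongrightarrow> x \<bullet> y) (at_right 0)"
    by (rule Lim_transform_eventually)
  then show ?thesis by (metis tendsto_const tendsto_unique trivial_limit_at_right_real)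
qed

text \<open>Density of \<open>D\<close> in the form that makes \<open>adj_op\<close> well defined:
  two candidates for its value differ by a vector orthogonal to \<open>D\<close>.\<close>

lemma domain_orthogonal_imp_0:
  assumes "\<And>x. x \<in> D \<Longrightarrow> x \<bullet> y = 0"
  shows "y = 0"
  using assms V_in_domain eq_0_if_V_orthogonal[of y y] by (metis inner_eq_zero_iff less_imp_le)

abbreviation "Dstar \<equiv> adj_dom D A"
abbreviation "Astar \<equiv> adj_op D A"
definition Sa :: "real \<Rightarrow> 'h \<Rightarrow>\<^sub>L 'h" where "Sa t = adj_blinfun (S t)"

lemma adjoint_S: "adjoint (blinfun_apply (S t)) = blinfun_apply (Sa t)"
  by (simp add: Sa_def adjoint_eq_adj_blinfun)

lemma inner_Sa: "x \<bullet> Sa t y = S t x \<bullet> y"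
  by (simp add: Sa_def inner_adj_blinfun)

lemma adj_op_eqI:
  assumes "\<And>x. x \<in> D \<Longrightarrow> A x \<bullet> \<phi> = x \<bullet> \<psi>"
  shows "\<phi> \<in> Dstar" and "Astar \<phi> = \<psi>"
proof -
  show "\<phi> \<in> Dstar" using assms by (auto simp: adj_dom_def)
  show "Astar \<phi> = \<psi>" unfolding adj_op_def
  proof (rule the_equality)
    fix \<psi>' assume "\<forall>x\<in>D. A x \<bullet> \<phi> = x \<bullet> \<psi>'"
    then have "\<psi>' - \<psi> = 0" using assms by (intro domain_orthogonal_imp_0) (simp add: inner_diff_right)
    then show "\<psi>' = \<psi>" by simp
  qed (use assms in blast)
qed

lemma adj_op_inner:
  assumes "\<phi> \<in> Dstar" "x \<in> D"
  shows "A x \<bullet> \<phi> = x \<bullet> Astar \<phi>"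
proof -
  obtain \<psi> where \<psi>: "\<And>x. x \<in> D \<Longrightarrow> A x \<bullet> \<phi> = x \<bullet> \<psi>" using assms by (auto simp: adj_dom_def)
  with adj_op_eqI(2)[OF \<psi>] assms show ?thesis by simp
qed

lemma adj_op_add:
  assumes "\<phi> \<in> Dstar" "\<psi> \<in> Dstar"
  shows "\<phi> + \<psi> \<in> Dstar" "Astar (\<phi> + \<psi>) = Astar \<phi> + Astar \<psi>"
  using adj_op_eqI[of "\<phi> + \<psi>" "Astar \<phi> + Astar \<psi>"] assms
  by (auto simp: inner_add_right adj_op_inner)

lemma adj_op_scaleR:
  assumes "\<phi> \<in> Dstar"
  shows "c *\<^sub>R \<phi> \<in> Dstar" "Astar (c *\<^sub>R \<phi>) = c *\<^sub>R Astar \<phi>"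
  using adj_op_eqI[of "c *\<^sub>R \<phi>" "c *\<^sub>R Astar \<phi>"] assms by (auto simp: adj_op_inner)

lemma adj_op_0: "0 \<in> Dstar" "Astar 0 = 0"
  using adj_op_eqI[of 0 0] by auto

lemma adj_op_diff:
  assumes "\<phi> \<in> Dstar" "\<psi> \<in> Dstar"
  shows "\<phi> - \<psi> \<in> Dstar" "Astar (\<phi> - \<psi>) = Astar \<phi> - Astar \<psi>"
  using adj_op_eqI[of "\<phi> - \<psi>" "Astar \<phi> - Astar \<psi>"] assms
  by (auto simp: inner_diff_right adj_op_inner)

lemma subspace_Dstar: "subspace Dstar"
  by (simp add: subspace_def adj_op_0 adj_op_add adj_op_scaleR)

lemma Sa_adj_op:
  assumes "\<phi> \<in> Dstar" "0 \<le> t"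
  shows "Sa t \<phi> \<in> Dstar" "Astar (Sa t \<phi>) = Sa t (Astar \<phi>)"
  using adj_op_eqI[of "Sa t \<phi>" "Sa t (Astar \<phi>)"] assms
  by (auto simp: inner_Sa adj_op_inner A_S[symmetric] S_in_domain)

text \<open>The weak form of "\<open>Sa t \<phi> - \<phi>\<close> is the integral of the orbit of
  \<open>Astar \<phi>\<close>". The integral stays on the side of \<open>S\<close>, because strong
  continuity of \<open>Sa\<close> is not yet available and is itself derived from this
  identity.\<close>

lemma inner_Sa_diff:
  assumes "\<phi> \<in> Dstar" "0 \<le> t"
  shows "x \<bullet> (Sa t \<phi> - \<phi>) = V t x \<bullet> Astar \<phi>"
proof -
  have "V t x \<bullet> Astar \<phi> = A (V t x) \<bullet> \<phi>" using assms by (simp add: adj_op_inner V_in_domain)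
  also have "\<dots> = x \<bullet> (Sa t \<phi> - \<phi>)"
    using assms by (simp add: A_V inner_diff_left inner_diff_right inner_Sa)
  finally show ?thesis by simp
qed

text \<open>Since \<open>V t (A x) = S t x - x\<close> on \<open>D\<close>, the adjoint of
  \<open>V t\<close> takes its values in \<open>Dstar\<close>. A vector \<open>x\<close> orthogonal
  to \<open>Dstar\<close> is therefore orthogonal to \<open>V t x\<close> for all
  \<open>t > 0\<close>, and hence to itself by averaging.\<close>

lemma Dstar_dense: "closure Dstar = UNIV"
proof (rule subspace_dense_if_orthogonal_complement_trivial[OF subspace_Dstar])
  fix x assume x: "\<And>\<phi>. \<phi> \<in> Dstar \<Longrightarrow> x \<bullet> \<phi> = 0"
  have "V t x \<bullet> x = 0" if "0 < t" for t
  proof -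
    have "adjoint (V t) x \<in> Dstar"
      using that by (intro adj_op_eqI(1)[of _ "Sa t x - x"])
        (simp add: adjoint_inner[OF bounded_linear_V, symmetric] V_A inner_Sa inner_diff_left
          inner_diff_right)
    from x[OF this] show ?thesis by (simp add: adjoint_inner[OF bounded_linear_V])
  qed
  then have "x \<bullet> x = 0" by (rule eq_0_if_V_orthogonal)
  then show "x = 0" by simp
qed

lemma Dstar_inner_eqI:
  assumes "\<And>\<phi>. \<phi> \<in> Dstar \<Longrightarrow> x \<bullet> \<phi> = y \<bullet> \<phi>"
  shows "x = y"
proof -
  have "closed {\<phi>. x \<bullet> \<phi> = y \<bullet> \<phi>}" by (intro closed_Collect_eq continuous_intros)
  moreover have "Dstar \<subseteq> {\<phi>. x \<bullet> \<phi> = y \<bullet> \<phi>}" using assms by auto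
  ultimately have "x - y \<in> {\<phi>. x \<bullet> \<phi> = y \<bullet> \<phi>}"
    using Dstar_dense closure_minimal by blast
  then have "(x - y) \<bullet> (x - y) = 0" by (simp add: inner_diff_left)
  then show ?thesis by simp
qed

text \<open>By density and continuity the bound extends to all test vectors, in particular to
  \<open>x\<close> itself.\<close>

lemma Dstar_norm_le:
  assumes "\<And>\<phi>. \<phi> \<in> Dstar \<Longrightarrow> \<bar>x \<bullet> \<phi>\<bar> \<le> M * norm \<phi>" "0 \<le> M"
  shows "norm x \<le> M"
proof -
  have "closed {\<phi>. \<bar>x \<bullet> \<phi>\<bar> \<le> M * norm \<phi>}" by (intro closed_Collect_le continuous_intros)
  moreover have "Dstar \<subseteq> {\<phi>. \<bar>x \<bullet> \<phi>\<bar> \<le> M * norm \<phi>}" using assms by auto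
  ultimately have "x \<in> {\<phi>. \<bar>x \<bullet> \<phi>\<bar> \<le> M * norm \<phi>}"
    using Dstar_dense closure_minimal by blast
  then show ?thesis using assms(2) by (intro norm_le_if_inner_le) auto
qed

text \<open>On \<open>Dstar\<close>, \<open>inner_Sa_diff\<close> gives convergence at rate
  \<open>t\<close>; density and the bound of \<open>Sa\<close> near 0, inherited from
  \<open>S\<close>, extend it to all vectors.\<close>

lemma Sa_tendsto: "((\<lambda>t. Sa t x) \<longlongrightarrow> x) (at_right 0)"
proof (rule tendstoI)
  fix e :: real assume e: "e > 0"
  obtain M where M: "M \<ge> 1" "\<And>s. 0 \<le> s \<Longrightarrow> s \<le> 1 \<Longrightarrow> norm (S s) \<le> M"
    by (rule bounded_on_interval) blast
  obtain \<phi> where \<phi>: "\<phi> \<in> Dstar" "norm (\<phi> - x) < e / (4 * M)"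
    using Dstar_dense e M(1) closure_approachableD[of x Dstar "e / (4 * M)"]
    by (auto simp: dist_norm norm_minus_commute)
  \<comment> \<open>Chosen so that \<open>M * t * norm (Astar \<phi>) < e / 4\<close> for
    \<open>t < d\<close>; the added 1 keeps the divisor positive. Together with the two terms from
    approximating \<open>x\<close> by \<open>\<phi>\<close>, the total stays below three quarters of
    \<open>e\<close>.\<close>
  define d where "d = min 1 (e / (4 * M * (norm (Astar \<phi>) + 1)))"
  have d: "d > 0" using e M(1) by (auto simp: d_def intro!: divide_pos_pos mult_pos_pos add_nonneg_pos)
  have "dist (Sa t x) x < e" if t: "0 < t" "t < d" for t
  proof -
    have t1: "t \<le> 1" using t by (simp add: d_def)
    have "norm (Sa t \<phi> - \<phi>) \<le> M * t * norm (Astar \<phi>)"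
    proof (rule norm_le_if_inner_le)
      let ?y = "Sa t \<phi> - \<phi>"
      have "\<bar>?y \<bullet> ?y\<bar> = \<bar>V t ?y \<bullet> Astar \<phi>\<bar>" using inner_Sa_diff[OF \<phi>(1)] t by simp
      also have "\<dots> \<le> norm (V t ?y) * norm (Astar \<phi>)" by (rule Cauchy_Schwarz_ineq2)
      also have "\<dots> \<le> (M * norm ?y * t) * norm (Astar \<phi>)"
        using t t1 M by (intro mult_right_mono norm_V_le) auto
      finally show "\<bar>?y \<bullet> ?y\<bar> \<le> M * t * norm (Astar \<phi>) * norm ?y" by (simp add: mult_ac)
    qed (use M t in auto)
    also have "\<dots> \<le> M * t * (norm (Astar \<phi>) + 1)" using M t by (intro mult_left_mono) auto
    also have "\<dots> < M * (e / (4 * M * (norm (Astar \<phi>) + 1))) * (norm (Astar \<phi>) + 1)"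
      using M(1) t by (intro mult_strict_right_mono mult_strict_left_mono) (auto simp: d_def add_nonneg_pos)
    also have "\<dots> = e / 4" using M(1) norm_ge_zero[of "Astar \<phi>"]
      by (simp add: field_simps add_nonneg_eq_0_iff)
    finally have 1: "norm (Sa t \<phi> - \<phi>) < e / 4" .
    have "norm (Sa t (x - \<phi>)) \<le> norm (Sa t) * norm (x - \<phi>)" by (rule norm_blinfun)
    also have "\<dots> \<le> M * (e / (4 * M))"
      using \<phi>(2) M(1) M(2)[of t] t t1 order.trans[OF norm_adj_blinfun_le[of "S t"]]
      by (intro mult_mono) (auto simp: Sa_def norm_minus_commute)
    finally have 2: "norm (Sa t (x - \<phi>)) \<le> e / 4" using M(1) by simp
    have "e / (4 * M) \<le> e / 4" using M(1) e by (simp add: field_simps)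
    then have 3: "norm (\<phi> - x) < e / 4" using \<phi>(2) by simp
    have "Sa t x - x = Sa t (x - \<phi>) + (Sa t \<phi> - \<phi>) + (\<phi> - x)" by (simp add: blinfun.diff_right)
    then have "norm (Sa t x - x) \<le> norm (Sa t (x - \<phi>)) + norm (Sa t \<phi> - \<phi>) + norm (\<phi> - x)"
      using norm_triangle_ineq[of "Sa t (x - \<phi>) + (Sa t \<phi> - \<phi>)" "\<phi> - x"]
        norm_triangle_ineq[of "Sa t (x - \<phi>)" "Sa t \<phi> - \<phi>"] by simp
    with 1 2 3 e show ?thesis by (simp add: dist_norm)
  qed
  with d show "\<forall>\<^sub>F t in at_right 0. dist (Sa t x) x < e"
    unfolding eventually_at_right_field by auto
qed

lemma C0_Sa: "C0_semigroup Sa"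
  unfolding C0_semigroup_def
proof (intro conjI allI impI Sa_tendsto)
  show "Sa 0 = id_blinfun"
    by (rule blinfun_eqI, rule inner_eq_imp_eq) (simp add: inner_Sa)
  fix s t :: real assume "0 \<le> s" "0 \<le> t"
  then show "Sa (s + t) = Sa s o\<^sub>L Sa t"
    by - (rule blinfun_eqI, rule inner_eq_imp_eq, simp add: inner_Sa S_add add.commute[of s t])
qed

sublocale Sa: strongly_continuous_semigroup Sa
  by unfold_locales (rule C0_Sa)

end

section \<open>Square integrable functions\<close>

text \<open>Composition acts on the approximating simple functions, and continuity of
  \<open>h\<close> carries the pointwise limit; the Borel structure of a product space does not
  enter.\<close>

lemma strongly_measurable_compose2:
  fixes h :: "'b::metric_space \<Rightarrow> 'c::metric_space \<Rightarrow> 'd::metric_space"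
  assumes "strongly_measurable M f" "strongly_measurable M g"
    and h: "continuous_on UNIV (\<lambda>(x, y). h x y)"
  shows "strongly_measurable M (\<lambda>x. h (f x) (g x))"
proof -
  obtain s where s: "\<And>n::nat. simple_function M (s n)" "AE x in M. (\<lambda>n. s n x) \<longlonglongrightarrow> f x"
    using assms(1) unfolding strongly_measurable_def by blast
  obtain r where r: "\<And>n::nat. simple_function M (r n)" "AE x in M. (\<lambda>n. r n x) \<longlonglongrightarrow> g x"
    using assms(2) unfolding strongly_measurable_def by blast
  have "AE x in M. (\<lambda>n. h (s n x) (r n x)) \<longlonglongrightarrow> h (f x) (g x)"
    using s(2) r(2)
  proof eventually_elim
    case (elim x)
    then have "(\<lambda>n. (s n x, r n x)) \<longlonglongrightarrow> (f x, g x)" by (rule tendsto_Pair)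
    moreover have "isCont (\<lambda>(x, y). h x y) (f x, g x)"
      using h by (simp add: continuous_on_eq_continuous_at)
    ultimately show ?case by (auto dest: isCont_tendsto_compose)
  qed
  moreover have "simple_function M (\<lambda>x. h (s n x) (r n x))" for n
    using s(1) r(1) by (rule simple_function_compose2)
  ultimately show ?thesis unfolding strongly_measurable_def
    by (intro exI[of _ "\<lambda>n x. h (s n x) (r n x)"]) auto
qed

lemma strongly_measurable_compose:
  fixes h :: "'b::metric_space \<Rightarrow> 'd::metric_space"
  assumes "strongly_measurable M f" and h: "continuous_on UNIV h"
  shows "strongly_measurable M (\<lambda>x. h (f x))"
proof -
  have "continuous_on UNIV (\<lambda>(x, y::'b). h x)"
    unfolding case_prod_unfold by (intro continuous_on_compose2[OF h] continuous_intros) auto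
  from strongly_measurable_compose2[OF assms(1,1) this] show ?thesis .
qed

lemma strongly_measurable_add:
  fixes f :: "'a \<Rightarrow> 'b::real_normed_vector"
  assumes "strongly_measurable M f" "strongly_measurable M g"
  shows "strongly_measurable M (\<lambda>x. f x + g x)"
  using assms by (rule strongly_measurable_compose2) (auto simp: case_prod_unfold intro!: continuous_intros)

lemma strongly_measurable_simple: "simple_function M f \<Longrightarrow> strongly_measurable M f"
  unfolding strongly_measurable_def by (intro exI[of _ "\<lambda>_. f"]) auto

lemma strongly_measurable_indicator:
  fixes f :: "'a \<Rightarrow> 'b::real_normed_vector"
  assumes "strongly_measurable M f" "I \<in> sets M"
  shows "strongly_measurable M (\<lambda>t. indicator I t *\<^sub>R f t)"
proof (rule strongly_measurable_compose2[of M "indicator I :: _ \<Rightarrow> real" f "(*\<^sub>R)"])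
  show "strongly_measurable M (indicator I :: _ \<Rightarrow> real)"
    using assms(2) by (intro strongly_measurable_simple simple_function_indicator)
qed (use assms(1) in \<open>auto simp: case_prod_unfold intro!: continuous_intros\<close>)

lemma strongly_measurable_cong_AE:
  assumes "strongly_measurable M f" "AE x in M. f x = g x"
  shows "strongly_measurable M g"
proof -
  obtain s where s: "\<And>n::nat. simple_function M (s n)" "AE x in M. (\<lambda>n. s n x) \<longlonglongrightarrow> f x"
    using assms(1) unfolding strongly_measurable_def by blast
  have "AE x in M. (\<lambda>n. s n x) \<longlonglongrightarrow> g x"
    using s(2) assms(2) by eventually_elim simp
  with s(1) show ?thesis unfolding strongly_measurable_def by blast
qed

text \<open>The passage to the real integrals. \<open>lim\<close> is measurable everywhere and
  agrees with \<open>f\<close> almost everywhere; completeness of Lebesgue measure does the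
  rest.\<close>

lemma strongly_measurable_imp_borel_measurable:
  fixes f :: "real \<Rightarrow> real"
  assumes "strongly_measurable lebesgue f"
  shows "f \<in> borel_measurable lebesgue"
proof -
  obtain s where s: "\<And>n::nat. simple_function lebesgue (s n)" "AE x in lebesgue. (\<lambda>n. s n x) \<longlonglongrightarrow> f x"
    using assms(1) unfolding strongly_measurable_def by blast
  have "(\<lambda>x. lim (\<lambda>n. s n x)) \<in> borel_measurable lebesgue"
    by (intro borel_measurable_lim_metric borel_measurable_simple_function s)
  moreover have "AE x in lebesgue. lim (\<lambda>n. s n x) = f x"
    using s(2) by eventually_elim (rule limI)
  ultimately show ?thesis by (rule borel_measurable_AE)
qed

text \<open>Extension by zero moves every question to the whole line, where intervals can be cut,
  glued and translated over one fixed measure.\<close>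

lemma strongly_measurable_lebesgue_on:
  fixes u :: "real \<Rightarrow> 'b::real_normed_vector"
  assumes I: "I \<in> sets lebesgue"
  shows "strongly_measurable (lebesgue_on I) u \<longleftrightarrow> strongly_measurable lebesgue (\<lambda>t. indicator I t *\<^sub>R u t)"
    (is "?l \<longleftrightarrow> ?r")
proof
  have I': "I \<inter> space lebesgue \<in> sets lebesgue" using I by simp
  note simple = simple_function_restrict_space[OF I'] and AE = AE_restrict_space_iff[OF I']
  {
    assume ?l
    then obtain s where s: "\<And>n::nat. simple_function (lebesgue_on I) (s n)"
      "AE x in lebesgue_on I. (\<lambda>n. s n x) \<longlonglongrightarrow> u x"
      unfolding strongly_measurable_def by blast
    have "AE x in lebesgue. (\<lambda>n. indicator I x *\<^sub>R s n x) \<longlonglongrightarrow> indicator I x *\<^sub>R u x"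
      using s(2)[unfolded AE] by eventually_elim (auto simp: indicator_def)
    with s(1) show ?r unfolding strongly_measurable_def
      by (intro exI[of _ "\<lambda>n x. indicator I x *\<^sub>R s n x"]) (auto simp: simple)
  next
    assume ?r
    then obtain s where s: "\<And>n::nat. simple_function lebesgue (s n)"
      "AE x in lebesgue. (\<lambda>n. s n x) \<longlonglongrightarrow> indicator I x *\<^sub>R u x"
      unfolding strongly_measurable_def by blast
    have "simple_function lebesgue (\<lambda>x. indicator I x *\<^sub>R s n x)" for n
      using s(1) I by (intro simple_function_compose2[where h="(*\<^sub>R)"] simple_function_indicator) auto
    then have "simple_function (lebesgue_on I) (s n)" for n by (simp add: simple)
    moreover have "AE x in lebesgue_on I. (\<lambda>n. s n x) \<longlonglongrightarrow> u x"
      unfolding AE using s(2) by eventually_elim (auto simp: indicator_def)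
    ultimately show ?l unfolding strongly_measurable_def by blast
  }
qed

lemma L2_iff:
  fixes u :: "real \<Rightarrow> 'b::real_normed_vector"
  assumes I: "I \<in> sets lebesgue"
  shows "u \<in> L2 I \<longleftrightarrow> strongly_measurable lebesgue (\<lambda>t. indicator I t *\<^sub>R u t)
    \<and> set_integrable lebesgue I (\<lambda>t. (norm (u t))\<^sup>2)"
  using I unfolding L2_def
  by (simp add: strongly_measurable_lebesgue_on integrable_restrict_space set_integrable_def)

lemma L2_iff_nn:
  fixes u :: "real \<Rightarrow> 'b::real_normed_vector"
  assumes I: "I \<in> sets lebesgue"
  shows "u \<in> L2 I \<longleftrightarrow> strongly_measurable lebesgue (\<lambda>t. indicator I t *\<^sub>R u t)
    \<and> (\<integral>\<^sup>+t\<in>I. ennreal ((norm (u t))\<^sup>2) \<partial>lebesgue) < \<infinity>"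
proof -
  have meas: "(\<lambda>t. indicator I t * (norm (u t))\<^sup>2) \<in> borel_measurable lebesgue"
    if "strongly_measurable lebesgue (\<lambda>t. indicator I t *\<^sub>R u t)"
  proof -
    have "strongly_measurable lebesgue (\<lambda>t. (norm (indicator I t *\<^sub>R u t))\<^sup>2)"
      by (intro strongly_measurable_compose[OF that, where h="\<lambda>x. (norm x)\<^sup>2"] continuous_intros)
    moreover have "(\<lambda>t. (norm (indicator I t *\<^sub>R u t))\<^sup>2) = (\<lambda>t. indicator I t * (norm (u t))\<^sup>2)"
      by (auto simp: indicator_def)
    ultimately show ?thesis using strongly_measurable_imp_borel_measurable by metis
  qed
  have eq: "(\<integral>\<^sup>+t\<in>I. ennreal ((norm (u t))\<^sup>2) \<partial>lebesgue)
      = (\<integral>\<^sup>+t. ennreal (norm (indicator I t * (norm (u t))\<^sup>2)) \<partial>lebesgue)"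
    by (intro nn_integral_cong) (auto simp: indicator_def)
  show ?thesis
    unfolding L2_iff[OF I] set_integrable_def real_scaleR_def eq integrable_iff_bounded
    using meas by blast
qed

lemma L2_add:
  assumes I: "I \<in> sets lebesgue" and u: "u \<in> L2 I" "v \<in> L2 I"
  shows "(\<lambda>t. u t + v t) \<in> L2 I"
proof -
  let ?i = "indicator I :: real \<Rightarrow> real"
  have "strongly_measurable lebesgue (\<lambda>t. ?i t *\<^sub>R u t + ?i t *\<^sub>R v t)"
    using u I by (intro strongly_measurable_add) (auto simp: L2_iff)
  then have m: "strongly_measurable lebesgue (\<lambda>t. ?i t *\<^sub>R (u t + v t))"
    by (simp add: scaleR_add_right)
  have "(\<integral>\<^sup>+t\<in>I. ennreal ((norm (u t + v t))\<^sup>2) \<partial>lebesgue)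
     \<le> (\<integral>\<^sup>+t. ennreal (2 * (?i t * (norm (u t))\<^sup>2 + ?i t * (norm (v t))\<^sup>2)) \<partial>lebesgue)"
  proof (intro nn_integral_mono)
    fix t
    have "(norm (u t + v t))\<^sup>2 \<le> (norm (u t) + norm (v t))\<^sup>2"
      by (intro power_mono norm_triangle_ineq) auto
    also have "\<dots> \<le> 2 * ((norm (u t))\<^sup>2 + (norm (v t))\<^sup>2)"
      using sum_squares_bound[of "norm (u t)" "norm (v t)"]
      by (simp add: power2_eq_square algebra_simps)
    finally show "ennreal ((norm (u t + v t))\<^sup>2) * indicator I t
      \<le> ennreal (2 * (?i t * (norm (u t))\<^sup>2 + ?i t * (norm (v t))\<^sup>2))"
      by (auto simp: indicator_def simp del: ennreal_plus intro!: ennreal_leI)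
  qed
  also have "\<dots> < \<infinity>"
  proof -
    have "integrable lebesgue (\<lambda>t. 2 * (?i t * (norm (u t))\<^sup>2 + ?i t * (norm (v t))\<^sup>2))"
      using u I by (auto simp: L2_iff set_integrable_def)
    then show ?thesis by (subst nn_integral_eq_integral) (auto simp: ennreal_less_top)
  qed
  finally show ?thesis using m by (simp add: L2_iff_nn[OF I])
qed

lemma L2_scaleR:
  assumes I: "I \<in> sets lebesgue" and u: "u \<in> L2 I"
  shows "(\<lambda>t. c *\<^sub>R u t) \<in> L2 I"
proof -
  have "strongly_measurable lebesgue (\<lambda>t. c *\<^sub>R (indicator I t *\<^sub>R u t))"
    using u I by (intro strongly_measurable_compose[where h="\<lambda>x. c *\<^sub>R x"] continuous_intros)
      (auto simp: L2_iff)
  then have m: "strongly_measurable lebesgue (\<lambda>t. indicator I t *\<^sub>R (c *\<^sub>R u t))"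
    by (simp add: mult.commute)
  have "set_integrable lebesgue I (\<lambda>t. c\<^sup>2 * (norm (u t))\<^sup>2)"
    using u I by (intro set_integrable_mult_right) (auto simp: L2_iff)
  then have "set_integrable lebesgue I (\<lambda>t. (norm (c *\<^sub>R u t))\<^sup>2)"
    by (simp add: power_mult_distrib)
  with m show ?thesis by (simp add: L2_iff[OF I])
qed

lemma L2_diff:
  assumes I: "I \<in> sets lebesgue" and u: "u \<in> L2 I" "v \<in> L2 I"
  shows "(\<lambda>t. u t - v t) \<in> L2 I"
  using L2_add[OF I u(1) L2_scaleR[OF I u(2), of "-1"]] by simp

lemma L2_zero: "I \<in> sets lebesgue \<Longrightarrow> (\<lambda>t. 0) \<in> L2 I"
  by (simp add: L2_iff_nn strongly_measurable_simple)

lemma L2_subset: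
  assumes "u \<in> L2 I" "I \<in> sets lebesgue" "J \<in> sets lebesgue" "J \<subseteq> I"
  shows "u \<in> L2 J"
proof -
  have eq: "(\<lambda>t. indicator J t *\<^sub>R (indicator I t *\<^sub>R u t)) = (\<lambda>t. indicator J t *\<^sub>R u t)"
    using assms(4) by (auto simp: indicator_def fun_eq_iff)
  have "strongly_measurable lebesgue (\<lambda>t. indicator J t *\<^sub>R u t)"
    using strongly_measurable_indicator[of lebesgue "\<lambda>t. indicator I t *\<^sub>R u t" J] assms
    unfolding eq by (simp add: L2_iff)
  moreover have "set_integrable lebesgue J (\<lambda>t. (norm (u t))\<^sup>2)"
    using assms by (auto simp: L2_iff intro: set_integrable_subset)
  ultimately show ?thesis using assms by (simp add: L2_iff)
qed

lemma L2_cong_AE: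
  assumes "u \<in> L2 I" "I \<in> sets lebesgue" "J \<in> sets lebesgue"
    and eq: "AE t in lebesgue. indicator I t *\<^sub>R u t = indicator J t *\<^sub>R v t"
  shows "v \<in> L2 J"
proof -
  have "strongly_measurable lebesgue (\<lambda>t. indicator J t *\<^sub>R v t)"
    using assms by (intro strongly_measurable_cong_AE[OF _ eq]) (simp add: L2_iff)
  moreover have "(\<integral>\<^sup>+t\<in>I. ennreal ((norm (u t))\<^sup>2) \<partial>lebesgue) = (\<integral>\<^sup>+t\<in>J. ennreal ((norm (v t))\<^sup>2) \<partial>lebesgue)"
    using eq by (intro nn_integral_cong_AE, eventually_elim) (auto simp: indicator_def split: if_splits)
  ultimately show ?thesis using assms by (simp add: L2_iff_nn)
qed

lemma L2_cong:
  assumes "I \<in> sets lebesgue" "\<And>t. t \<in> I \<Longrightarrow> u t = v t"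
  shows "u \<in> L2 I \<longleftrightarrow> v \<in> L2 I"
proof -
  have eq: "indicator I t *\<^sub>R u t = indicator I t *\<^sub>R v t" for t
    using assms(2) by (auto simp: indicator_def)
  show ?thesis
    using L2_cong_AE[of u I I v, OF _ assms(1,1) AE_I2] L2_cong_AE[of v I I u, OF _ assms(1,1) AE_I2] eq
    by (metis (full_types))
qed

lemma AE_lebesgue_neq: "AE t in lebesgue. t \<noteq> (a::real)"
  using AE_not_in[of "{a}" lebesgue] by (simp add: negligible_iff_null_sets[symmetric])

text \<open>Two open intervals glued at a common endpoint miss that point; this supplies it.\<close>

lemma L2_insert:
  assumes "u \<in> L2 I" "I \<in> sets lebesgue"
  shows "u \<in> L2 (insert a I)"
proof (rule L2_cong_AE[OF assms])
  show "AE t in lebesgue. indicator I t *\<^sub>R u t = indicator (insert a I) t *\<^sub>R u t"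
    using AE_lebesgue_neq[of a] by eventually_elim (auto simp: indicator_def)
  show "insert a I \<in> sets lebesgue" using assms(2) by (rule sets.insert_in_sets[rotated]) simp
qed

lemma L2_zero_extension:
  assumes "u \<in> L2 I" "I \<in> sets lebesgue" "J \<in> sets lebesgue" "I \<subseteq> J"
  shows "(\<lambda>t. indicator I t *\<^sub>R u t) \<in> L2 J"
  by (rule L2_cong_AE[OF assms(1-3)], rule AE_I2) (use assms(4) in \<open>auto simp: indicator_def\<close>)

lemma L2_If:
  assumes "u \<in> L2 I" "v \<in> L2 J" "I \<in> sets lebesgue" "J \<in> sets lebesgue" "I \<inter> J = {}"
  shows "(\<lambda>t. if t \<in> I then u t else v t) \<in> L2 (I \<union> J)"
proof -
  have "(\<lambda>t. indicator I t *\<^sub>R u t + indicator J t *\<^sub>R v t) \<in> L2 (I \<union> J)"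
    using assms by (intro L2_add L2_zero_extension) auto
  then show ?thesis
    using assms by (subst L2_cong[where v="\<lambda>t. indicator I t *\<^sub>R u t + indicator J t *\<^sub>R v t"])
      (auto simp: indicator_def)
qed

lemma L2_Un:
  assumes "u \<in> L2 I" "u \<in> L2 J" "I \<in> sets lebesgue" "J \<in> sets lebesgue" "I \<inter> J = {}"
  shows "u \<in> L2 (I \<union> J)"
  using L2_If[OF assms] by simp

lemma lebesgue_translation_measurable: "(\<lambda>t. a + t :: real) \<in> lebesgue \<rightarrow>\<^sub>M lebesgue"
  using lebesgue_affine_measurable[where c="\<lambda>x::real. 1" and t=a] by simp

lemma AE_lebesgue_translate:
  assumes "AE t in lebesgue. P (t::real)"
  shows "AE t in lebesgue. P (a + t)"
proof -
  have "negligible {t. \<not> P t}"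
    using assms by (simp add: completion.AE_iff_null_sets negligible_iff_null_sets)
  from negligible_translation[OF this, of "-a"]
  have "negligible {t. \<not> P (a + t)}"
    by (rule negligible_subset) (force simp: image_iff)
  then show ?thesis by (simp add: completion.AE_iff_null_sets negligible_iff_null_sets)
qed

lemma strongly_measurable_translate:
  assumes "strongly_measurable lebesgue u"
  shows "strongly_measurable lebesgue (\<lambda>t::real. u (a + t))"
proof -
  obtain s where s: "\<And>n::nat. simple_function lebesgue (s n)" "AE t in lebesgue. (\<lambda>n. s n t) \<longlonglongrightarrow> u t"
    using assms(1) unfolding strongly_measurable_def by blast
  have "simple_function lebesgue (\<lambda>t. s n (a + t))" for n
  proof -
    have "(\<lambda>t. s n (a + t)) -` {s n (a + t)} = (\<lambda>t. a + t) -` (s n -` {s n (a + t)}) \<inter> space lebesgue" for t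
      by auto
    then have "(\<lambda>t. s n (a + t)) -` {s n (a + t)} \<in> sets lebesgue" for t
      using s(1)[of n] measurable_sets[OF lebesgue_translation_measurable[of a], of "s n -` {s n (a + t)}"]
      by (simp add: simple_function_def)
    moreover have "finite (range (\<lambda>t. s n (a + t)))"
      using s(1)[of n] by (auto simp: simple_function_def intro: finite_subset[of _ "range (s n)"])
    ultimately show ?thesis by (auto simp: simple_function_def)
  qed
  moreover have "AE t in lebesgue. (\<lambda>n. s n (a + t)) \<longlonglongrightarrow> u (a + t)"
    using s(2) by (rule AE_lebesgue_translate)
  ultimately show ?thesis unfolding strongly_measurable_def
    by (intro exI[of _ "\<lambda>n t. s n (a + t)"]) auto
qed

lemma LINT_translate:
  fixes f :: "real \<Rightarrow> 'b::euclidean_space"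
  assumes "\<And>t. t \<in> I \<longleftrightarrow> a + t \<in> J"
  shows "(LINT t:J|lebesgue. f t) = (LINT t:I|lebesgue. f (a + t))"
  using lebesgue_integral_real_affine[of 1 "\<lambda>t. indicator J t *\<^sub>R f t" a] assms
  by (simp add: set_lebesgue_integral_def indicator_def)

lemma L2_translate:
  assumes u: "u \<in> L2 J" and J: "J \<in> sets lebesgue" and I: "\<And>t. t \<in> I \<longleftrightarrow> a + t \<in> J"
  shows "(\<lambda>t. u (a + t)) \<in> L2 I"
proof -
  have eq: "indicator J (a + t) = indicator I t" for t using I by (simp add: indicator_def)
  have "I = (\<lambda>t. a + t) -` J \<inter> space lebesgue" using I by auto
  then have Im: "I \<in> sets lebesgue"
    using measurable_sets[OF lebesgue_translation_measurable J, of a] by simp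
  have "strongly_measurable lebesgue (\<lambda>t. indicator I t *\<^sub>R u (a + t))"
    using strongly_measurable_translate[of "\<lambda>t. indicator J t *\<^sub>R u t" a] u J
    by (simp add: L2_iff eq)
  moreover have "set_integrable lebesgue I (\<lambda>t. (norm (u (a + t)))\<^sup>2)"
    using lebesgue_integrable_real_affine[of "\<lambda>t. indicator J t *\<^sub>R (norm (u t))\<^sup>2" 1 a] u J
    by (simp add: L2_iff set_integrable_def eq)
  ultimately show ?thesis using Im by (simp add: L2_iff)
qed

section \<open>The L2 pairing\<close>

lemma L2_inner_integrable:
  fixes u v :: "real \<Rightarrow> 'b::real_inner"
  assumes I: "I \<in> sets lebesgue" and u: "u \<in> L2 I" "v \<in> L2 I"
  shows "set_integrable lebesgue I (\<lambda>t. u t \<bullet> v t)"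
proof -
  let ?i = "indicator I :: real \<Rightarrow> real"
  have "strongly_measurable lebesgue (\<lambda>t. (?i t *\<^sub>R u t) \<bullet> (?i t *\<^sub>R v t))"
    using u I by (intro strongly_measurable_compose2[where h="(\<bullet>)"])
      (auto simp: L2_iff case_prod_unfold intro!: continuous_intros)
  moreover have "(\<lambda>t. (?i t *\<^sub>R u t) \<bullet> (?i t *\<^sub>R v t)) = (\<lambda>t. ?i t *\<^sub>R (u t \<bullet> v t))"
    by (auto simp: indicator_def)
  ultimately have m: "(\<lambda>t. ?i t *\<^sub>R (u t \<bullet> v t)) \<in> borel_measurable lebesgue"
    using strongly_measurable_imp_borel_measurable by metis
  have "integrable lebesgue (\<lambda>t. ?i t * (norm (u t))\<^sup>2 + ?i t * (norm (v t))\<^sup>2)"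
    using u I by (auto simp: L2_iff set_integrable_def)
  then show ?thesis unfolding set_integrable_def
  proof (rule Bochner_Integration.integrable_bound[OF _ m], intro AE_I2)
    fix t
    have "\<bar>u t \<bullet> v t\<bar> \<le> norm (u t) * norm (v t)" by (rule Cauchy_Schwarz_ineq2)
    also have "\<dots> \<le> (norm (u t))\<^sup>2 + (norm (v t))\<^sup>2"
      using sum_squares_bound[of "norm (u t)" "norm (v t)"] by (simp add: algebra_simps)
         (metis add_increasing le_add_same_cancel1 mult_2 mult_nonneg_nonneg norm_ge_zero order.trans mult.assoc)
    finally show "norm (?i t *\<^sub>R (u t \<bullet> v t)) \<le> norm (?i t * (norm (u t))\<^sup>2 + ?i t * (norm (v t))\<^sup>2)"
      by (auto simp: indicator_def)
  qed
qed

definition ip :: "real set \<Rightarrow> (real \<Rightarrow> 'b::real_inner) \<Rightarrow> (real \<Rightarrow> 'b) \<Rightarrow> real" where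
  "ip I u v = (LINT t:I|lebesgue. u t \<bullet> v t)"

lemma ip_commute: "ip I u v = ip I v u"
  by (simp add: ip_def inner_commute)

lemma ip_cong: "(\<And>t. t \<in> I \<Longrightarrow> u t = u' t) \<Longrightarrow> (\<And>t. t \<in> I \<Longrightarrow> v t = v' t) \<Longrightarrow> ip I u v = ip I u' v'"
  unfolding ip_def set_lebesgue_integral_def
  by (intro Bochner_Integration.integral_cong) (auto simp: indicator_def)

lemma ip_add_left:
  assumes "I \<in> sets lebesgue" "u \<in> L2 I" "v \<in> L2 I" "w \<in> L2 I"
  shows "ip I (\<lambda>t. u t + v t) w = ip I u w + ip I v w"
  using assms by (simp add: ip_def inner_add_left set_integral_add L2_inner_integrable)

lemma ip_diff_left:
  assumes "I \<in> sets lebesgue" "u \<in> L2 I" "v \<in> L2 I" "w \<in> L2 I"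
  shows "ip I (\<lambda>t. u t - v t) w = ip I u w - ip I v w"
  using assms by (simp add: ip_def inner_diff_left set_integral_diff L2_inner_integrable)

lemma ip_scaleR_left: "ip I (\<lambda>t. c *\<^sub>R u t) w = c * ip I u w"
  by (simp add: ip_def)

lemma ip_scaleR_right: "ip I w (\<lambda>t. c *\<^sub>R u t) = c * ip I w u"
  by (simp add: ip_def)

lemma ip_self_add:
  assumes "I \<in> sets lebesgue" "u \<in> L2 I" "v \<in> L2 I"
  shows "ip I (\<lambda>t. u t + v t) (\<lambda>t. u t + v t) = ip I u u + 2 * ip I u v + ip I v v"
proof -
  have "ip I (\<lambda>t. u t + v t) (\<lambda>t. u t + v t) = ip I u (\<lambda>t. u t + v t) + ip I v (\<lambda>t. u t + v t)"
    by (rule ip_add_left[OF assms L2_add[OF assms]])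
  also have "ip I u (\<lambda>t. u t + v t) = ip I u u + ip I v u"
    using ip_add_left[OF assms assms(2)] ip_commute[of I u "\<lambda>t. u t + v t"] by simp
  also have "ip I v (\<lambda>t. u t + v t) = ip I u v + ip I v v"
    using ip_add_left[OF assms assms(3)] ip_commute[of I v "\<lambda>t. u t + v t"] by simp
  finally show ?thesis by (simp add: ip_commute[of I v u])
qed

lemma ip_self_nonneg: "0 \<le> ip I u u"
  unfolding ip_def set_lebesgue_integral_def
  by (intro Bochner_Integration.integral_nonneg) (auto simp: indicator_def)

lemma ip_Un:
  assumes "I \<in> sets lebesgue" "J \<in> sets lebesgue" "I \<inter> J = {}" "u \<in> L2 (I \<union> J)" "v \<in> L2 (I \<union> J)"
  shows "ip (I \<union> J) u v = ip I u v + ip J u v"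
proof -
  have "u \<in> L2 I" "v \<in> L2 I" "u \<in> L2 J" "v \<in> L2 J"
    using L2_subset[of u "I \<union> J"] L2_subset[of v "I \<union> J"] assms by auto
  then show ?thesis unfolding ip_def using assms by (intro set_integral_Un L2_inner_integrable)
qed

lemma ip_subset_le:
  assumes "u \<in> L2 I" "I \<in> sets lebesgue" "J \<in> sets lebesgue" "J \<subseteq> I"
  shows "ip J u u \<le> ip I u u"
proof -
  have "ip (J \<union> (I - J)) u u = ip J u u + ip (I - J) u u"
    using assms by (intro ip_Un) (auto simp: Un_absorb1)
  moreover have "J \<union> (I - J) = I" using assms(4) by auto
  ultimately show ?thesis using ip_self_nonneg[of "I - J" u] by simp
qed

lemma ip_translate:
  assumes "\<And>t. t \<in> I \<longleftrightarrow> a + t \<in> J"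
  shows "ip J u v = ip I (\<lambda>t. u (a + t)) (\<lambda>t. v (a + t))"
  unfolding ip_def using assms by (intro LINT_translate) auto

lemma set_lebesgue_integral_insert:
  fixes f :: "real \<Rightarrow> real"
  shows "(LINT t:insert a I|lebesgue. f t) = (LINT t:I|lebesgue. f t)"
proof -
  have AE: "AE t in lebesgue. indicator (insert a I) t *\<^sub>R f t = indicator I t *\<^sub>R f t"
    using AE_lebesgue_neq[of a] by eventually_elim (auto simp: indicator_def)
  have AE': "AE t in lebesgue. indicator I t *\<^sub>R f t = indicator (insert a I) t *\<^sub>R f t"
    using AE by eventually_elim (rule sym)
  show ?thesis
  proof (cases "(\<lambda>t. indicator I t *\<^sub>R f t) \<in> borel_measurable lebesgue")
    case True
    then show ?thesis unfolding set_lebesgue_integral_def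
      by (intro integral_cong_AE AE) (use borel_measurable_AE[OF True AE'] in auto)
  next
    \<comment> \<open>Almost everywhere equality transfers non-measurability, so both integrals take
      their default value.\<close>
    case False
    then have "(\<lambda>t. indicator (insert a I) t *\<^sub>R f t) \<notin> borel_measurable lebesgue"
      using borel_measurable_AE[OF _ AE] by blast
    with False show ?thesis unfolding set_lebesgue_integral_def
      by (metis not_integrable_integral_eq borel_measurable_integrable)
  qed
qed

lemma ip_insert: "ip (insert a I) u v = ip I u v"
  unfolding ip_def by (rule set_lebesgue_integral_insert)

text \<open>The bridge from costs, which live in \<open>ennreal\<close> and may be infinite, to the
  bilinear calculus of \<open>ip\<close>.\<close>

lemma nn_integral_L2_eq_ip:
  assumes "I \<in> sets lebesgue" "u \<in> L2 I"
  shows "(\<integral>\<^sup>+t\<in>I. ennreal ((norm (u t))\<^sup>2) \<partial>lebesgue) = ennreal (ip I u u)"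
proof -
  have "(\<integral>\<^sup>+t\<in>I. ennreal ((norm (u t))\<^sup>2) \<partial>lebesgue)
      = (\<integral>\<^sup>+t. ennreal (indicator I t *\<^sub>R (u t \<bullet> u t)) \<partial>lebesgue)"
    by (intro nn_integral_cong) (auto simp: indicator_def power2_norm_eq_inner)
  also have "\<dots> = ennreal (ip I u u)"
    unfolding ip_def set_lebesgue_integral_def
    using L2_inner_integrable[OF assms(1) assms(2,2)] unfolding set_integrable_def
    by (intro nn_integral_eq_integral) (auto simp: indicator_def)
  finally show ?thesis .
qed

lemma ip_self_eq_0_imp_AE:
  assumes "I \<in> sets lebesgue" "u \<in> L2 I" "ip I u u = 0"
  shows "AE t in lebesgue. t \<in> I \<longrightarrow> u t = 0"
proof -
  have "AE t in lebesgue. indicator I t *\<^sub>R (u t \<bullet> u t) = 0"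
    using L2_inner_integrable[OF assms(1) assms(2,2)] assms(3)
    unfolding set_integrable_def ip_def set_lebesgue_integral_def
    by (subst (asm) integral_nonneg_eq_0_iff_AE) (auto simp: indicator_def)
  then show ?thesis by eventually_elim (auto simp: indicator_def split: if_splits)
qed

lemma ip_first_order:
  assumes "I \<in> sets lebesgue" "w \<in> L2 I" "d \<in> L2 I"
    and le: "\<And>l. ip I w w \<le> ip I (\<lambda>t. w t + l *\<^sub>R d t) (\<lambda>t. w t + l *\<^sub>R d t)"
  shows "ip I w d = 0"
proof (rule quadratic_nonneg_imp_linear_coeff_0)
  fix l :: real
  show "0 \<le> ip I d d * l\<^sup>2 + 2 * ip I w d * l"
    using le[of l] ip_self_add[OF assms(1,2) L2_scaleR[OF assms(1,3)], of l]
    by (simp add: ip_scaleR_left ip_scaleR_right power2_eq_square algebra_simps)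
qed

text \<open>Evaluating \<open>f\<close> at times rounded down to a grid gives simple functions
  whatever the size of the target space; refining the grid converges by continuity.\<close>

lemma strongly_measurable_continuous:
  fixes f :: "real \<Rightarrow> 'b::real_normed_vector"
  assumes f: "continuous_on {0..} f" and I: "I \<in> sets lebesgue" "I \<subseteq> {0..}"
  shows "strongly_measurable lebesgue (\<lambda>t. indicator I t *\<^sub>R f t)"
proof -
  \<comment> \<open>Mesh \<open>1 / Suc n\<close>, cut off at time \<open>n\<close> so that the
    range is finite. Rounding down keeps nonnegative times nonnegative, and 0 is the value off the
    cut-off, so \<open>f\<close> is evaluated only where it is continuous.\<close>
  define p :: "nat \<Rightarrow> real \<Rightarrow> real" where
    "p n t = indicator (I \<inter> {..real n}) t * of_int \<lfloor>real (Suc n) * t\<rfloor> / real (Suc n)" for n t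
  have p_simple: "simple_function lebesgue (p n)" for n
  proof (rule simple_function_borel_measurable)
    have "(\<lambda>t. of_int \<lfloor>real (Suc n) * t\<rfloor> :: real) \<in> borel_measurable borel" by measurable
    then have "(\<lambda>t. of_int \<lfloor>real (Suc n) * t\<rfloor> :: real) \<in> borel_measurable lebesgue"
      by (simp add: measurable_completion)
    then show "p n \<in> borel_measurable lebesgue"
      unfolding p_def using I by (intro borel_measurable_divide borel_measurable_times
          borel_measurable_indicator borel_measurable_const) auto
    have "p n t \<in> (\<lambda>k. of_int k / real (Suc n)) ` {0..int (Suc n) * int n}" for t
    proof (cases "t \<in> I \<inter> {..real n}")
      case True
      then have t: "0 \<le> t" "t \<le> real n" using I by auto
      have "real (Suc n) * t \<le> real (Suc n) * real n" using t by (intro mult_left_mono) auto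
      then have "\<lfloor>real (Suc n) * t\<rfloor> \<le> \<lfloor>real (Suc n) * real n\<rfloor>" by (rule floor_mono)
      also have "\<dots> = int (Suc n) * int n" by (metis floor_of_nat of_nat_mult)
      finally have "\<lfloor>real (Suc n) * t\<rfloor> \<in> {0..int (Suc n) * int n}" using t by auto
      moreover have "p n t = of_int \<lfloor>real (Suc n) * t\<rfloor> / real (Suc n)" using True by (simp add: p_def)
      ultimately show ?thesis by blast
    qed (auto simp: p_def intro!: image_eqI[of _ _ 0])
    then have "p n ` space lebesgue \<subseteq> (\<lambda>k. of_int k / real (Suc n)) ` {0..int (Suc n) * int n}"
      by blast
    then show "finite (p n ` space lebesgue)"
      by (rule finite_subset) (intro finite_imageI finite_atLeastAtMost_int)
  qed
  have p_lim: "(\<lambda>n. p n t) \<longlonglongrightarrow> t" and p_nonneg: "0 \<le> p n t" if t: "t \<in> I" for t n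
  proof -
    have t0: "0 \<le> t" using t I by auto
    then show "0 \<le> p n t" by (auto simp: p_def indicator_def intro!: divide_nonneg_nonneg)
    obtain N where N: "t \<le> real N" using real_arch_simple by blast
    have "\<bar>p n t - t\<bar> \<le> 1 / real (Suc n)" if "n \<ge> N" for n
    proof -
      have "p n t - t = (of_int \<lfloor>real (Suc n) * t\<rfloor> - real (Suc n) * t) / real (Suc n)"
        using t N that by (simp add: p_def diff_divide_distrib)
      moreover have "\<bar>of_int \<lfloor>real (Suc n) * t\<rfloor> - real (Suc n) * t\<bar> \<le> 1" by linarith
      ultimately show ?thesis by (simp add: abs_divide divide_right_mono)
    qed
    then have "\<forall>\<^sub>F n in sequentially. norm (p n t - t) \<le> 1 / real (Suc n)"
      unfolding eventually_sequentially by auto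
    then have "(\<lambda>n. p n t - t) \<longlonglongrightarrow> 0"
      by (rule Lim_null_comparison) (rule LIMSEQ_Suc[OF lim_1_over_n])
    then show "(\<lambda>n. p n t) \<longlonglongrightarrow> t" by (rule LIM_zero_cancel)
  qed
  have "simple_function lebesgue (\<lambda>t. indicator I t *\<^sub>R f (p n t))" for n
    using p_simple I by (intro simple_function_compose2[where h="(*\<^sub>R)"] simple_function_indicator
        simple_function_compose1[where g=f]) auto
  moreover have "(\<lambda>n. indicator I t *\<^sub>R f (p n t)) \<longlonglongrightarrow> indicator I t *\<^sub>R f t" for t
  proof (cases "t \<in> I")
    case True
    then have "(\<lambda>n. f (p n t)) \<longlonglongrightarrow> f t"
      using I p_lim p_nonneg f unfolding continuous_on_sequentially by (auto simp: o_def)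
    then show ?thesis by (intro tendsto_intros)
  qed simp
  ultimately show ?thesis unfolding strongly_measurable_def
    by (intro exI[of _ "\<lambda>n t. indicator I t *\<^sub>R f (p n t)"]) auto
qed

lemma L2_continuous:
  fixes f :: "real \<Rightarrow> 'b::real_normed_vector"
  assumes f: "continuous_on {0..T} f"
  shows "f \<in> L2 {0<..<T}"
proof (cases "0 \<le> T")
  case True
  \<comment> \<open>Constant continuation beyond \<open>T\<close>, since the approximation by simple
    functions asks for continuity on the whole half-line.\<close>
  define F where "F t = f (min t T)" for t
  have "continuous_on {0..} F" unfolding F_def
    using True by (intro continuous_on_compose2[OF f]) (auto intro!: continuous_intros)
  then have "strongly_measurable lebesgue (\<lambda>t. indicator {0<..<T} t *\<^sub>R F t)"
    by (intro strongly_measurable_continuous) auto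
  moreover have "(\<lambda>t. indicator {0<..<T} t *\<^sub>R F t) = (\<lambda>t. indicator {0<..<T} t *\<^sub>R f t)"
    by (auto simp: F_def indicator_def fun_eq_iff)
  ultimately have m: "strongly_measurable lebesgue (\<lambda>t. indicator {0<..<T} t *\<^sub>R f t)" by simp
  have "set_integrable lebesgue {0..T} (\<lambda>t. (norm (f t))\<^sup>2)"
    by (intro absolutely_integrable_continuous_real continuous_intros f)
  then have "set_integrable lebesgue {0<..<T} (\<lambda>t. (norm (f t))\<^sup>2)"
    by (rule set_integrable_subset) auto
  with m show ?thesis by (simp add: L2_iff)
next
  case False
  then have "{0<..<T} = {}" by auto
  then show ?thesis by (simp add: L2_iff_nn strongly_measurable_simple)
qed

lemma strongly_measurable_Pair:
  fixes u :: "real \<Rightarrow> 'b::real_normed_vector" and v :: "real \<Rightarrow> 'c::real_normed_vector"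
  assumes "strongly_measurable lebesgue (\<lambda>t. indicator I t *\<^sub>R u t)"
    "strongly_measurable lebesgue (\<lambda>t. indicator I t *\<^sub>R v t)"
  shows "strongly_measurable lebesgue (\<lambda>t. indicator I t *\<^sub>R (u t, v t))"
  using strongly_measurable_compose2[OF assms, of Pair] by simp

lemma L2_Pair:
  fixes u :: "real \<Rightarrow> 'b::real_normed_vector" and v :: "real \<Rightarrow> 'c::real_normed_vector"
  assumes I: "I \<in> sets lebesgue" and "u \<in> L2 I" "v \<in> L2 I"
  shows "(\<lambda>t. (u t, v t)) \<in> L2 I"
proof -
  have "set_integrable lebesgue I (\<lambda>t. (norm (u t))\<^sup>2 + (norm (v t))\<^sup>2)"
    using assms by (intro set_integral_add(1)) (auto simp: L2_iff)
  then have "set_integrable lebesgue I (\<lambda>t. (norm (u t, v t))\<^sup>2)" by (simp add: norm_prod_def)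
  moreover have "strongly_measurable lebesgue (\<lambda>t. indicator I t *\<^sub>R (u t, v t))"
    using assms by (intro strongly_measurable_Pair) (auto simp: L2_iff)
  ultimately show ?thesis using I by (simp add: L2_iff)
qed

section \<open>Trajectories of control systems\<close>

lemma LINT_continuous:
  fixes f :: "real \<Rightarrow> real"
  assumes "continuous_on {0..t} f"
  shows "(LINT s:{0<..<t}|lebesgue. f s) = integral {0..t} f"
proof -
  have "set_integrable lebesgue {0..t} f" by (intro absolutely_integrable_continuous_real assms)
  then have "set_integrable lebesgue {0<..<t} f" by (rule set_integrable_subset) auto
  then have "(LINT s:{0<..<t}|lebesgue. f s) = integral {0<..<t} f"
    by (rule set_lebesgue_integral_eq_integral)
  then show ?thesis by (simp add: integral_open_interval_real)
qed

text \<open>Turns the kernel of the input integral, which runs backwards from \<open>t\<close>, into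
  the output of the adjoint semigroup on the same interval.\<close>

lemma LINT_reflect:
  fixes f :: "real \<Rightarrow> real"
  shows "(LINT s:{0<..<t}|lebesgue. f (t - s)) = (LINT s:{0<..<t}|lebesgue. f s)"
proof -
  have "(\<lambda>s. indicator {0<..<t} (t - s) :: real) = indicator {0<..<t}"
    by (auto simp: indicator_def)
  then show ?thesis
    using lebesgue_integral_real_affine[of "-1" "\<lambda>s. indicator {0<..<t} s *\<^sub>R f s" t]
    by (simp add: set_lebesgue_integral_def fun_eq_iff)
qed

lemma interval_split: "0 \<le> a \<Longrightarrow> 0 \<le> b \<Longrightarrow> insert a {0<..<a + b} = insert a ({0<..<a} \<union> {a<..<a + (b::real)})"
  by auto

text \<open>The two open pieces miss the cut point \<open>a\<close>. Inserting it on both sides also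
  covers \<open>a = 0\<close> and \<open>b = 0\<close>, where it is not an interior point.\<close>

lemma LINT_split:
  fixes f :: "real \<Rightarrow> real"
  assumes "set_integrable lebesgue {0<..<a + b} f" "0 \<le> a" "0 \<le> b"
  shows "(LINT s:{0<..<a + b}|lebesgue. f s)
    = (LINT s:{0<..<a}|lebesgue. f s) + (LINT s:{0<..<b}|lebesgue. f (a + s))"
proof -
  have "set_integrable lebesgue {0<..<a} f" "set_integrable lebesgue {a<..<a + b} f"
    using assms by (auto intro: set_integrable_subset[OF assms(1)])
  moreover have "{0<..<a} \<inter> {a<..<a + b} = {}" by auto
  ultimately have "(LINT s:{0<..<a} \<union> {a<..<a + b}|lebesgue. f s)
      = (LINT s:{0<..<a}|lebesgue. f s) + (LINT s:{a<..<a + b}|lebesgue. f s)"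
    by (intro set_integral_Un)
  moreover have "(LINT s:{0<..<a} \<union> {a<..<a + b}|lebesgue. f s) = (LINT s:{0<..<a + b}|lebesgue. f s)"
    using set_lebesgue_integral_insert[of a "{0<..<a} \<union> {a<..<a + b}" f]
      set_lebesgue_integral_insert[of a "{0<..<a + b}" f] interval_split[OF assms(2,3)] by simp
  moreover have "(LINT s:{a<..<a + b}|lebesgue. f s) = (LINT s:{0<..<b}|lebesgue. f (a + s))"
    by (intro LINT_translate) auto
  ultimately show ?thesis by simp
qed

text \<open>Replaces "zero derivative implies constant" for functions that need not be
  differentiable: over a fine uniform partition the increments of \<open>F\<close> and
  \<open>m\<close> telescope. The function \<open>m\<close> leaves room for a control that is only
  square integrable, whose increments need not be controlled by the length of the interval.\<close>

lemma eq_if_increments_small: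
  fixes F m :: "real \<Rightarrow> real"
  assumes "\<And>e. e > 0 \<Longrightarrow> \<exists>d>0. \<forall>a b. 0 \<le> a \<and> a \<le> b \<and> b \<le> t \<and> b - a < d
      \<longrightarrow> \<bar>F b - F a\<bar> \<le> e * (m b - m a)"
    and t: "0 \<le> t"
  shows "F t = F 0"
proof -
  have bound: "\<bar>F t - F 0\<bar> \<le> e * (m t - m 0)" if e: "e > 0" for e
  proof -
    obtain d where d: "d > 0"
      "\<And>a b. 0 \<le> a \<Longrightarrow> a \<le> b \<Longrightarrow> b \<le> t \<Longrightarrow> b - a < d \<Longrightarrow> \<bar>F b - F a\<bar> \<le> e * (m b - m a)"
      using assms(1)[OF e] by blast
    \<comment> \<open>Enough pieces to make the mesh \<open>r = t / N\<close> smaller than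
      \<open>d\<close>.\<close>
    obtain N where N: "t / d < real N" using reals_Archimedean2 by blast
    have N0: "0 < real N" using N t d by (meson divide_nonneg_pos le_less_trans)
    define r where "r = t / real N"
    have r: "0 \<le> r" "r < d" using N N0 d t by (auto simp: r_def field_simps)
    have "\<bar>F (real i * r) - F 0\<bar> \<le> e * (m (real i * r) - m 0)" if "i \<le> N" for i
      using that
    proof (induction i)
      case (Suc i)
      have "real (Suc i) * r \<le> real N * r" using Suc.prems r by (intro mult_right_mono) auto
      then have "real (Suc i) * r \<le> t" using N0 by (simp add: r_def)
      then have "\<bar>F (real (Suc i) * r) - F (real i * r)\<bar> \<le> e * (m (real (Suc i) * r) - m (real i * r))"
        using r by (intro d(2)) (auto simp: algebra_simps)
      with Suc show ?case by (simp add: algebra_simps)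
    qed simp
    from this[of N] show ?thesis using N0 by (simp add: r_def)
  qed
  have "\<bar>F t - F 0\<bar> \<le> 0"
  proof (rule field_le_epsilon)
    fix e :: real assume e: "e > 0"
    have "\<bar>F t - F 0\<bar> \<le> e / (\<bar>m t - m 0\<bar> + 1) * (m t - m 0)"
      using e by (intro bound) (simp add: add_nonneg_pos)
    also have "\<dots> \<le> e / (\<bar>m t - m 0\<bar> + 1) * (\<bar>m t - m 0\<bar> + 1)"
      using e by (intro mult_left_mono) auto
    also have "\<dots> = e" by simp
    finally show "\<bar>F t - F 0\<bar> \<le> 0 + e" by simp
  qed
  then show ?thesis by simp
qed

section \<open>Input integrals and trajectories, tested against \<open>Dstar\<close>\<close>

locale control_system = generator D A S
  for D :: "'h::{real_inner,banach} set" and A :: "'h \<Rightarrow> 'h" and S :: "real \<Rightarrow> 'h \<Rightarrow>\<^sub>L 'h" +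
  fixes B :: "'u::{real_inner,banach} \<Rightarrow> 'h \<Rightarrow> real"
  assumes control: "control_operator D A B" and adm: "admissible D A S B"
begin

abbreviation "Bs \<equiv> control_adj B"
abbreviation "X \<equiv> trajectory D A S B"
abbreviation "input \<equiv> input_integral S B"

lemma graph_norm_le: "adj_graph_norm D A \<phi> \<le> norm \<phi> + norm (Astar \<phi>)"
  unfolding adj_graph_norm_def power2_norm_eq_inner[symmetric]
  by (rule sqrt_sum_squares_le_sum) auto

lemma control_adj_inner:
  assumes "\<phi> \<in> Dstar"
  shows "B v \<phi> = v \<bullet> Bs \<phi>"
proof -
  obtain K where K: "\<And>v. \<bar>B v \<phi>\<bar> \<le> K * norm v * adj_graph_norm D A \<phi>"
    using control assms unfolding control_operator_def by blast
  interpret B: linear "\<lambda>v. B v \<phi>" using control assms by (simp add: control_operator_def)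
  have "bounded_linear (\<lambda>v. B v \<phi>)"
    using K by (intro bounded_linear_intro[where K="K * adj_graph_norm D A \<phi>"])
      (auto simp: B.add B.scale mult_ac)
  then obtain w where w: "\<And>v. B v \<phi> = v \<bullet> w" by (rule Riesz_representation) blast
  have "Bs \<phi> = w" unfolding control_adj_def
  proof (rule the_equality)
    fix w' assume "\<forall>v. v \<bullet> w' = B v \<phi>"
    then show "w' = w" by (intro inner_eq_imp_eq[of w' w]) (simp add: w)
  qed (simp add: w)
  then show ?thesis using w by simp
qed

lemma control_adj_diff:
  assumes "\<phi> \<in> Dstar" "\<psi> \<in> Dstar"
  shows "Bs (\<phi> - \<psi>) = Bs \<phi> - Bs \<psi>"
proof (rule inner_eq_imp_eq)
  fix v
  have "B v (\<phi> + (-1) *\<^sub>R \<psi>) = B v \<phi> + (-1) * B v \<psi>"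
    using control assms adj_op_scaleR[of \<psi> "-1"] unfolding control_operator_def by metis
  then show "v \<bullet> Bs (\<phi> - \<psi>) = v \<bullet> (Bs \<phi> - Bs \<psi>)"
    using assms by (simp add: control_adj_inner adj_op_diff inner_diff_right)
qed

lemma control_adj_scaleR:
  assumes "\<phi> \<in> Dstar"
  shows "Bs (c *\<^sub>R \<phi>) = c *\<^sub>R Bs \<phi>"
proof (rule inner_eq_imp_eq)
  fix v
  have "B v (c *\<^sub>R \<phi>) = c * B v \<phi>"
    using control assms unfolding control_operator_def by metis
  then show "v \<bullet> Bs (c *\<^sub>R \<phi>) = v \<bullet> (c *\<^sub>R Bs \<phi>)"
    using assms by (simp add: control_adj_inner adj_op_scaleR)
qed

lemma control_adj_0: "Bs 0 = 0"
  using control_adj_scaleR[OF adj_op_0(1), of 0] by simp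

text \<open>The bound on \<open>B\<close> is tested with \<open>v = Bs \<phi>\<close>; the absolute
  value is taken because the given \<open>K\<close> may be negative.\<close>

lemma control_adj_bound:
  obtains K where "0 \<le> K" "\<And>\<phi>. \<phi> \<in> Dstar \<Longrightarrow> norm (Bs \<phi>) \<le> K * (norm \<phi> + norm (Astar \<phi>))"
proof -
  obtain K where K: "\<And>v \<phi>. \<phi> \<in> Dstar \<Longrightarrow> \<bar>B v \<phi>\<bar> \<le> K * norm v * adj_graph_norm D A \<phi>"
    using control unfolding control_operator_def by blast
  have "norm (Bs \<phi>) \<le> \<bar>K\<bar> * (norm \<phi> + norm (Astar \<phi>))" if "\<phi> \<in> Dstar" for \<phi>
  proof (rule norm_le_if_inner_le)
    have "\<bar>Bs \<phi> \<bullet> Bs \<phi>\<bar> \<le> K * norm (Bs \<phi>) * adj_graph_norm D A \<phi>"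
      using K[OF that, of "Bs \<phi>"] control_adj_inner[OF that] by simp
    also have "\<dots> \<le> \<bar>K\<bar> * norm (Bs \<phi>) * (norm \<phi> + norm (Astar \<phi>))"
      using graph_norm_le[of \<phi>] by (intro mult_mono) (auto simp: adj_graph_norm_def)
    finally show "\<bar>Bs \<phi> \<bullet> Bs \<phi>\<bar> \<le> \<bar>K\<bar> * (norm \<phi> + norm (Astar \<phi>)) * norm (Bs \<phi>)"
      by (simp add: mult_ac)
  qed simp
  then show ?thesis by (intro that[of "\<bar>K\<bar>"]) auto
qed

text \<open>\<open>Bs\<close> is continuous for the graph norm only. \<open>Astar\<close> commutes
  with \<open>Sa t\<close> on \<open>Dstar\<close>, so the orbits of \<open>\<phi>\<close> and of
  \<open>Astar \<phi>\<close> together control the graph norm.\<close>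

lemma control_adj_continuous:
  assumes "\<phi> \<in> Dstar"
  shows "continuous_on {0..} (\<lambda>t. Bs (Sa t \<phi>))"
proof (unfold continuous_on_def, intro ballI)
  fix t :: real assume t: "t \<in> {0..}"
  obtain K where K: "0 \<le> K" "\<And>\<phi>. \<phi> \<in> Dstar \<Longrightarrow> norm (Bs \<phi>) \<le> K * (norm \<phi> + norm (Astar \<phi>))"
    by (rule control_adj_bound) blast
  have S: "((\<lambda>s. Sa s x) \<longlongrightarrow> Sa t x) (at t within {0..})" for x
    using Sa.continuous_on_orbit[of x] t by (auto simp: continuous_on_def)
  have "((\<lambda>s. K * (norm (Sa s \<phi> - Sa t \<phi>) + norm (Sa s (Astar \<phi>) - Sa t (Astar \<phi>))))
      \<longlongrightarrow> K * (norm (Sa t \<phi> - Sa t \<phi>) + norm (Sa t (Astar \<phi>) - Sa t (Astar \<phi>)))) (at t within {0..})"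
    by (intro tendsto_intros S)
  moreover have "\<forall>\<^sub>F s in at t within {0..}. norm (Bs (Sa s \<phi>) - Bs (Sa t \<phi>))
      \<le> K * (norm (Sa s \<phi> - Sa t \<phi>) + norm (Sa s (Astar \<phi>) - Sa t (Astar \<phi>)))"
    unfolding eventually_at_filter
  proof (intro always_eventually allI impI)
    fix s :: real assume "s \<in> {0..}"
    then show "norm (Bs (Sa s \<phi>) - Bs (Sa t \<phi>))
      \<le> K * (norm (Sa s \<phi> - Sa t \<phi>) + norm (Sa s (Astar \<phi>) - Sa t (Astar \<phi>)))"
      using K(2)[of "Sa s \<phi> - Sa t \<phi>"] t assms
      by (simp add: control_adj_diff Sa_adj_op adj_op_diff)
  qed
  ultimately have "((\<lambda>s. Bs (Sa s \<phi>) - Bs (Sa t \<phi>)) \<longlongrightarrow> 0) (at t within {0..})"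
    using Lim_null_comparison[where f="\<lambda>s. Bs (Sa s \<phi>) - Bs (Sa t \<phi>)"] by simp
  then show "((\<lambda>s. Bs (Sa s \<phi>)) \<longlongrightarrow> Bs (Sa t \<phi>)) (at t within {0..})" by (rule LIM_zero_cancel)
qed

lemma input_kernel_L2:
  assumes "\<phi> \<in> Dstar"
  shows "(\<lambda>s. Bs (Sa (t - s) \<phi>)) \<in> L2 {0<..<t}" and "(\<lambda>s. Bs (Sa s \<phi>)) \<in> L2 {0<..<t}"
  by (intro L2_continuous continuous_on_compose2[OF control_adj_continuous[OF assms]];
      auto intro!: continuous_intros)+

lemma input_eq_ip:
  assumes "\<phi> \<in> Dstar"
  shows "input u t \<phi> = ip {0<..<t} u (\<lambda>s. Bs (Sa (t - s) \<phi>))"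
  unfolding input_integral_def ip_def semigroup_ext_def set_lebesgue_integral_def
  using assms by (intro Bochner_Integration.integral_cong refl)
    (auto simp: adjoint_S control_adj_inner Sa_adj_op indicator_def)

lemma input_add:
  assumes "\<phi> \<in> Dstar" "u \<in> L2 {0<..<t}" "v \<in> L2 {0<..<t}"
  shows "input (\<lambda>s. u s + v s) t \<phi> = input u t \<phi> + input v t \<phi>"
  using assms by (simp add: input_eq_ip ip_add_left input_kernel_L2)

lemma input_scaleR:
  assumes "\<phi> \<in> Dstar"
  shows "input (\<lambda>s. c *\<^sub>R u s) t \<phi> = c * input u t \<phi>"
  using assms by (simp add: input_eq_ip ip_scaleR_left)

lemma input_cong:
  assumes "\<phi> \<in> Dstar" "\<And>s. s \<in> {0<..<t} \<Longrightarrow> u s = v s"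
  shows "input u t \<phi> = input v t \<phi>"
  unfolding input_eq_ip[OF assms(1)] by (rule ip_cong) (use assms(2) in auto)

text \<open>By the semigroup law in the kernel, the input before time \<open>a\<close> is seen
  through the test vector \<open>Sa b \<phi>\<close>; this is the flow property in dual
  form.\<close>

lemma input_split:
  assumes "\<phi> \<in> Dstar" "u \<in> L2 {0<..<a + b}" "0 \<le> a" "0 \<le> b"
  shows "input u (a + b) \<phi> = input u a (Sa b \<phi>) + input (\<lambda>s. u (a + s)) b \<phi>"
proof -
  have "set_integrable lebesgue {0<..<a + b} (\<lambda>s. u s \<bullet> Bs (Sa (a + b - s) \<phi>))"
    using assms by (intro L2_inner_integrable input_kernel_L2) auto
  from LINT_split[OF this assms(3,4)]
  have "input u (a + b) \<phi> = ip {0<..<a} u (\<lambda>s. Bs (Sa (a + b - s) \<phi>))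
      + ip {0<..<b} (\<lambda>s. u (a + s)) (\<lambda>s. Bs (Sa (a + b - (a + s)) \<phi>))"
    unfolding input_eq_ip[OF assms(1)] unfolding ip_def .
  moreover have "Sa (a + b - s) \<phi> = Sa (a - s) (Sa b \<phi>)" if "s \<in> {0<..<a}" for s
    using that assms(4) Sa.S_add[of "a - s" b \<phi>] by (simp add: algebra_simps)
  then have "ip {0<..<a} u (\<lambda>s. Bs (Sa (a + b - s) \<phi>)) = ip {0<..<a} u (\<lambda>s. Bs (Sa (a - s) (Sa b \<phi>)))"
    by (intro ip_cong) auto
  ultimately show ?thesis
    using assms by (simp add: input_eq_ip Sa_adj_op)
qed

text \<open>Density of \<open>Dstar\<close> makes the represented vector unique. Identities between
  trajectories thereby reduce to scalar identities for \<open>input\<close>.\<close>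

lemma trajectory_eqI:
  assumes "\<And>\<phi>. \<phi> \<in> Dstar \<Longrightarrow> x \<bullet> \<phi> = S t x0 \<bullet> \<phi> + input u t \<phi>"
  shows "X x0 u t = x"
  unfolding trajectory_def
proof (rule the_equality)
  fix y assume "\<forall>\<phi>\<in>Dstar. y \<bullet> \<phi> = S t x0 \<bullet> \<phi> + input u t \<phi>"
  with assms show "y = x" by (intro Dstar_inner_eqI) simp
qed (use assms in blast)

lemma
  assumes "u \<in> L2 {0<..<T}"
  shows trajectory_inner: "0 \<le> t \<Longrightarrow> t \<le> T \<Longrightarrow> \<phi> \<in> Dstar \<Longrightarrow>
      X x0 u t \<bullet> \<phi> = S t x0 \<bullet> \<phi> + input u t \<phi>"
    and trajectory_continuous: "continuous_on {0..T} (X x0 u)"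
proof -
  have "\<exists>y. continuous_on {0..T} y \<and> (\<forall>t\<in>{0..T}. \<forall>\<phi>\<in>Dstar. y t \<bullet> \<phi> = input u t \<phi>)"
  proof (cases "T > 0")
    case True
    then show ?thesis using adm assms unfolding admissible_def by blast
  next
    \<comment> \<open>Admissibility speaks of positive horizons; here at most the time 0 is left,
      with an empty integral.\<close>
    case False
    have "\<forall>t\<in>{0..T}. \<forall>\<phi>\<in>Dstar. 0 \<bullet> \<phi> = input u t \<phi>"
      using False by (auto simp: input_eq_ip ip_def set_lebesgue_integral_def)
    then show ?thesis by (intro exI[of _ "\<lambda>_. 0"]) simp
  qed
  then obtain y where y: "continuous_on {0..T} y"
    "\<And>t \<phi>. t \<in> {0..T} \<Longrightarrow> \<phi> \<in> Dstar \<Longrightarrow> y t \<bullet> \<phi> = input u t \<phi>" by blast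
  have eq: "X x0 u t = S t x0 + y t" if "t \<in> {0..T}" for t
    using y(2)[OF that] by (intro trajectory_eqI) (simp add: inner_add_left)
  show "X x0 u t \<bullet> \<phi> = S t x0 \<bullet> \<phi> + input u t \<phi>" if "0 \<le> t" "t \<le> T" "\<phi> \<in> Dstar"
    using that y(2) by (simp add: eq inner_add_left)
  have "continuous_on {0..T} (\<lambda>t. S t x0 + y t)"
    by (intro continuous_on_add continuous_on_orbit_subset y) auto
  then show "continuous_on {0..T} (X x0 u)"
    by (rule continuous_on_cong[THEN iffD1, rotated 2]) (auto simp: eq)
qed

lemma trajectory_cong:
  assumes "\<And>s. s \<in> {0<..<t} \<Longrightarrow> u s = v s"
  shows "X x0 u t = X x0 v t"
  unfolding trajectory_def using input_cong[of _ t u v] assms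
  by (intro arg_cong[where f=The] ext ball_cong) auto

lemma trajectory_0: "X x0 u 0 = x0"
  by (rule trajectory_eqI) (simp add: input_eq_ip ip_def set_lebesgue_integral_def)

lemma trajectory_add:
  assumes "u \<in> L2 {0<..<t}" "v \<in> L2 {0<..<t}" "0 \<le> t"
  shows "X (x + y) (\<lambda>s. u s + v s) t = X x u t + X y v t"
  using assms
  by (intro trajectory_eqI) (simp add: inner_add_left trajectory_inner input_add blinfun.add_right)

lemma trajectory_scaleR:
  assumes "u \<in> L2 {0<..<t}" "0 \<le> t"
  shows "X (c *\<^sub>R x) (\<lambda>s. c *\<^sub>R u s) t = c *\<^sub>R X x u t"
  using assms
  by (intro trajectory_eqI) (simp add: trajectory_inner input_scaleR blinfun.scaleR_right algebra_simps)

lemma trajectory_diff: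
  assumes "u \<in> L2 {0<..<t}" "v \<in> L2 {0<..<t}" "0 \<le> t"
  shows "X (x - y) (\<lambda>s. u s - v s) t = X x u t - X y v t"
  using trajectory_add[OF assms(1) L2_scaleR[OF _ assms(2)] assms(3), of x "(-1) *\<^sub>R y" "-1"]
    trajectory_scaleR[OF assms(2,3), of "-1" y] by simp

lemma trajectory_zero_control: "X x (\<lambda>s. 0) t = S t x"
  by (rule trajectory_eqI) (simp add: input_eq_ip ip_def set_lebesgue_integral_def)

lemma trajectory_shift:
  assumes "u \<in> L2 {0<..<a + b}" "0 \<le> a" "0 \<le> b"
  shows "X x u (a + b) = X (X x u a) (\<lambda>s. u (a + s)) b"
proof (rule sym, rule trajectory_eqI)
  fix \<phi> assume \<phi>: "\<phi> \<in> Dstar"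
  have "X x u (a + b) \<bullet> \<phi> = S (b + a) x \<bullet> \<phi> + (input u a (Sa b \<phi>) + input (\<lambda>s. u (a + s)) b \<phi>)"
    using assms \<phi> by (simp add: trajectory_inner[OF assms(1)] input_split add.commute)
  also have "\<dots> = (S a x \<bullet> Sa b \<phi> + input u a (Sa b \<phi>)) + input (\<lambda>s. u (a + s)) b \<phi>"
    using assms by (simp add: S_add inner_Sa)
  also have "\<dots> = X x u a \<bullet> Sa b \<phi> + input (\<lambda>s. u (a + s)) b \<phi>"
    using assms \<phi> by (subst trajectory_inner[OF assms(1)]) (auto simp: Sa_adj_op)
  finally show "X x u (a + b) \<bullet> \<phi> = S b (X x u a) \<bullet> \<phi> + input (\<lambda>s. u (a + s)) b \<phi>"
    by (simp add: inner_Sa)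
qed

text \<open>The stationary equation holds only weakly, and \<open>x\<close> need not lie in
  \<open>D\<close>. Tested with \<open>Sa r \<phi>\<close> it turns the control term into
  \<open>- (S r x \<bullet> Astar \<phi>)\<close>, whose integral is
  \<open>x \<bullet> \<phi> - S t x \<bullet> \<phi>\<close> by
  \<open>inner_Sa_diff\<close>.\<close>

lemma trajectory_stationary:
  assumes "stationary_pair D A B x u" "0 \<le> t"
  shows "X x (\<lambda>_. u) t = x"
proof (rule trajectory_eqI)
  fix \<phi> assume \<phi>: "\<phi> \<in> Dstar"
  have *: "u \<bullet> Bs (Sa r \<phi>) = - (S r x \<bullet> Astar \<phi>)" if "0 \<le> r" for r
  proof -
    have "x \<bullet> Astar (Sa r \<phi>) + u \<bullet> Bs (Sa r \<phi>) = 0"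
      using assms(1) Sa_adj_op(1)[OF \<phi> that] unfolding stationary_pair_def by blast
    then show ?thesis using Sa_adj_op(2)[OF \<phi> that] by (simp add: inner_Sa)
  qed
  have "input (\<lambda>_. u) t \<phi> = (LINT s:{0<..<t}|lebesgue. u \<bullet> Bs (Sa (t - s) \<phi>))"
    using \<phi> by (simp add: input_eq_ip ip_def)
  also have "\<dots> = (LINT s:{0<..<t}|lebesgue. u \<bullet> Bs (Sa s \<phi>))"
    by (rule LINT_reflect[of t "\<lambda>s. u \<bullet> Bs (Sa s \<phi>)"])
  also have "\<dots> = integral {0..t} (\<lambda>s. u \<bullet> Bs (Sa s \<phi>))"
    by (intro LINT_continuous continuous_on_inner continuous_on_const
        continuous_on_subset[OF control_adj_continuous[OF \<phi>]]) auto
  also have "\<dots> = integral {0..t} (\<lambda>s. - (S s x \<bullet> Astar \<phi>))"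
    by (intro integral_cong *) auto
  also have "\<dots> = - (V t x \<bullet> Astar \<phi>)" by (simp add: V_inner)
  also have "\<dots> = - (x \<bullet> (Sa t \<phi> - \<phi>))" using \<phi> assms(2) by (simp add: inner_Sa_diff)
  also have "\<dots> = x \<bullet> \<phi> - S t x \<bullet> \<phi>" by (simp add: inner_diff_right inner_Sa)
  finally show "x \<bullet> \<phi> = S t x \<bullet> \<phi> + input (\<lambda>_. u) t \<phi>" by simp
qed

text \<open>
  The mild solution is a weak solution. The identity is additive over subintervals, and on a short
  interval it fails by at most \<open>e\<close> times the integral of \<open>1 + \<parallel>u\<parallel>\<^sup>2\<close>.
\<close>

lemma trajectory_weak_solution:
  assumes u: "u \<in> L2 {0<..<T}" and \<phi>: "\<phi> \<in> Dstar" and T: "0 \<le> T"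
  shows "X x u T \<bullet> \<phi> = x \<bullet> \<phi> + ip {0<..<T} (X x u) (\<lambda>_. Astar \<phi>) + ip {0<..<T} u (\<lambda>_. Bs \<phi>)"
proof -
  define a where "a = Astar \<phi>"
  \<comment> \<open>The summand 1 pays for the terms in which the control does not occur, and it
    makes the integrand dominate \<open>norm (u s)\<close>.\<close>
  define m where "m t = (LINT s:{0<..<t}|lebesgue. 1 + (norm (u s))\<^sup>2)" for t
  define f where "f s = X x u s \<bullet> a + u s \<bullet> Bs \<phi>" for s
  define F where "F t = X x u t \<bullet> \<phi> - (LINT s:{0<..<t}|lebesgue. f s)" for t
  have const: "(\<lambda>_. c) \<in> L2 {0<..<t}" for c :: "'b::real_normed_vector" and t
    by (intro L2_continuous continuous_on_const)
  have XL2: "X x u \<in> L2 {0<..<T}" by (intro L2_continuous trajectory_continuous u)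
  have f_int: "set_integrable lebesgue {0<..<T} f" unfolding f_def
    by (intro set_integral_add L2_inner_integrable XL2 u const) auto
  have m_int: "set_integrable lebesgue {0<..<T} (\<lambda>s. 1 + (norm (u s))\<^sup>2)"
    using L2_inner_integrable[OF _ const[of "1::real" T] const[of "1::real" T]] u
    by (intro set_integral_add) (auto simp: L2_iff)
  have "bounded (X x u ` {0..T})"
    by (intro compact_imp_bounded compact_continuous_image trajectory_continuous u) auto
  then obtain M where M: "M > 0" "\<And>t. t \<in> {0..T} \<Longrightarrow> norm (X x u t) \<le> M"
    by (auto simp: bounded_pos)
  have uc: "uniformly_continuous_on {0..T} (X x u)"
    by (intro compact_uniformly_continuous trajectory_continuous u) auto
  have "F T = F 0"
  proof (rule eq_if_increments_small[OF _ T])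
    fix e :: real assume e: "e > 0"
    have at_0: "\<exists>d>0. \<forall>r. 0 \<le> r \<and> r < d \<longrightarrow> norm (g r - g 0) < e'"
      if g: "continuous_on {0..} g" and e': "e' > 0" for g :: "real \<Rightarrow> 'b::real_normed_vector" and e'
    proof -
      obtain d where "d > 0" "\<forall>r\<in>{0..}. dist r 0 < d \<longrightarrow> dist (g r) (g 0) < e'"
        using bspec[OF g[unfolded continuous_on_iff], of 0] e' by auto
      then show ?thesis by (intro exI[of _ d]) (auto simp: dist_norm)
    qed
    have "e / (4 * M) > 0" using e M by simp
    from at_0[OF Sa.continuous_on_orbit this, of a] obtain d1 where d1: "d1 > 0"
      "\<And>r. 0 \<le> r \<Longrightarrow> r < d1 \<Longrightarrow> norm (Sa r a - a) < e / (4 * M)" by auto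
    from at_0[OF control_adj_continuous[OF \<phi>], of "e / 2"] e obtain d2 where d2: "d2 > 0"
      "\<And>r. 0 \<le> r \<Longrightarrow> r < d2 \<Longrightarrow> norm (Bs (Sa r \<phi>) - Bs \<phi>) < e / 2" by auto
    have "e / (4 * (norm a + 1)) > 0" using e by (simp add: add_nonneg_pos)
    with uc obtain d3 where d3: "d3 > 0" "\<And>s t. s \<in> {0..T} \<Longrightarrow> t \<in> {0..T} \<Longrightarrow> dist s t < d3
        \<Longrightarrow> dist (X x u s) (X x u t) < e / (4 * (norm a + 1))"
      unfolding uniformly_continuous_on_def by metis
    define d where "d = min d1 (min d2 d3)"
    have incr: "\<bar>F (b + h) - F b\<bar> \<le> e * (m (b + h) - m b)"
      if b: "0 \<le> b" and h: "0 \<le> h" "b + h \<le> T" "h < d" for b h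
    proof -
      have sub: "{0<..<b + h} \<subseteq> {0<..<T}" using that by auto
      have ubh: "u \<in> L2 {0<..<b + h}" using sub by (intro L2_subset[OF u]) auto
      have ush: "(\<lambda>r. u (b + r)) \<in> L2 {0<..<h}"
        using b by (intro L2_translate[of u "{b<..<b + h}"] L2_subset[OF ubh]) auto
      have Xsh: "(\<lambda>r. X x u (b + r)) \<in> L2 {0<..<h}"
        using b h by (intro L2_continuous continuous_on_compose2[OF trajectory_continuous[OF u]])
          (auto intro!: continuous_intros)
      have m_split: "m (b + h) - m b = (LINT r:{0<..<h}|lebesgue. 1 + (norm (u (b + r)))\<^sup>2)"
        using LINT_split[OF set_integrable_subset[OF m_int _ sub] b h(1)] by (simp add: m_def)
      have F_split: "F (b + h) - F b
          = X x u (b + h) \<bullet> \<phi> - X x u b \<bullet> \<phi> - (LINT r:{0<..<h}|lebesgue. f (b + r))"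
        using LINT_split[OF set_integrable_subset[OF f_int _ sub] b h(1)] by (simp add: F_def)
      have SaL2: "(\<lambda>r. Sa r a) \<in> L2 {0<..<h}"
        by (intro L2_continuous Sa.continuous_on_orbit_subset) auto
      have "X x u (b + h) \<bullet> \<phi> = S h (X x u b) \<bullet> \<phi> + input (\<lambda>r. u (b + r)) h \<phi>"
        using trajectory_shift[OF ubh b h(1)] trajectory_inner[OF ush h(1) order_refl \<phi>] by simp
      moreover have "S h (X x u b) \<bullet> \<phi> - X x u b \<bullet> \<phi> = X x u b \<bullet> (Sa h \<phi> - \<phi>)"
        by (simp add: inner_diff_right inner_Sa)
      moreover have "X x u b \<bullet> (Sa h \<phi> - \<phi>) = (LINT r:{0<..<h}|lebesgue. X x u b \<bullet> Sa r a)"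
      proof -
        have "X x u b \<bullet> (Sa h \<phi> - \<phi>) = integral {0..h} (\<lambda>r. S r (X x u b) \<bullet> a)"
          using inner_Sa_diff[OF \<phi> h(1)] by (simp add: V_inner a_def)
        also have "\<dots> = (LINT r:{0<..<h}|lebesgue. S r (X x u b) \<bullet> a)"
          by (intro LINT_continuous[symmetric] continuous_on_inner continuous_on_const
              continuous_on_orbit_subset) auto
        finally show ?thesis by (simp add: inner_Sa)
      qed
      moreover have "input (\<lambda>r. u (b + r)) h \<phi>
          = (LINT r:{0<..<h}|lebesgue. u (b + r) \<bullet> Bs (Sa (h - r) \<phi>))"
        using \<phi> by (simp add: input_eq_ip ip_def)
      moreover have i1: "set_integrable lebesgue {0<..<h} (\<lambda>r. X x u b \<bullet> Sa r a)"
        by (intro L2_inner_integrable SaL2 const) auto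
      moreover have i2: "set_integrable lebesgue {0<..<h} (\<lambda>r. u (b + r) \<bullet> Bs (Sa (h - r) \<phi>))"
        by (intro L2_inner_integrable ush input_kernel_L2 \<phi>) auto
      moreover have i3: "set_integrable lebesgue {0<..<h} (\<lambda>r. f (b + r))" unfolding f_def
        by (intro set_integral_add L2_inner_integrable Xsh ush const) auto
      ultimately have F_eq: "F (b + h) - F b = (LINT r:{0<..<h}|lebesgue.
          X x u b \<bullet> Sa r a + u (b + r) \<bullet> Bs (Sa (h - r) \<phi>) - f (b + r))"
        unfolding F_split by (simp add: set_integral_add set_integral_diff)
      have int: "set_integrable lebesgue {0<..<h}
          (\<lambda>r. X x u b \<bullet> Sa r a + u (b + r) \<bullet> Bs (Sa (h - r) \<phi>) - f (b + r))"
        by (intro set_integral_add set_integral_diff i1 i2 i3)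
      have int': "set_integrable lebesgue {0<..<h} (\<lambda>r. e * (1 + (norm (u (b + r)))\<^sup>2))"
        using L2_inner_integrable[OF _ const[of "1::real" h] const[of "1::real" h]] ush
        by (intro set_integrable_mult_right set_integral_add) (auto simp: L2_iff)
      have "\<bar>F (b + h) - F b\<bar> \<le> (LINT r:{0<..<h}|lebesgue. e * (1 + (norm (u (b + r)))\<^sup>2))"
        unfolding F_eq real_norm_def[symmetric]
      proof (rule order.trans[OF set_integral_norm_bound[OF int]], rule set_integral_mono)
        fix r assume r: "r \<in> {0<..<h}"
        let ?n = "norm (u (b + r))"
        \<comment> \<open>Restarting at \<open>b\<close> is exact, so the defect comes from freezing
          three quantities: the orbit of \<open>a\<close>, the state, and the kernel. They
          contribute at most \<open>e / 4\<close>, \<open>e / 4\<close> and \<open>e / 2\<close>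
          times 1 + |u|^2.\<close>
        have eq: "X x u b \<bullet> Sa r a + u (b + r) \<bullet> Bs (Sa (h - r) \<phi>) - f (b + r)
            = X x u b \<bullet> (Sa r a - a) + (X x u b - X x u (b + r)) \<bullet> a
              + u (b + r) \<bullet> (Bs (Sa (h - r) \<phi>) - Bs \<phi>)"
          by (simp add: f_def algebra_simps)
        have "\<bar>X x u b \<bullet> (Sa r a - a)\<bar> \<le> norm (X x u b) * norm (Sa r a - a)"
          by (rule Cauchy_Schwarz_ineq2)
        also have "\<dots> \<le> M * (e / (4 * M))"
          using M b h r d1(2)[of r] by (intro mult_mono) (auto simp: d_def intro: less_imp_le)
        finally have 1: "\<bar>X x u b \<bullet> (Sa r a - a)\<bar> \<le> e / 4" using M by simp
        have "\<bar>(X x u b - X x u (b + r)) \<bullet> a\<bar> \<le> norm (X x u b - X x u (b + r)) * norm a"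
          by (rule Cauchy_Schwarz_ineq2)
        also have "\<dots> \<le> e / (4 * (norm a + 1)) * (norm a + 1)"
          using e b h r d3(2)[of b "b + r"]
          by (intro mult_mono) (auto simp: d_def dist_norm intro: less_imp_le)
        also have "\<dots> = e / 4"
        proof -
          have "e / (4 * k) * k = e / 4" if "k > 0" for k :: real using that by simp
          from this[of "norm a + 1"] show ?thesis by (simp only: add_nonneg_pos norm_ge_zero zero_less_one)
        qed
        finally have 2: "\<bar>(X x u b - X x u (b + r)) \<bullet> a\<bar> \<le> e / 4" .
        have "\<bar>u (b + r) \<bullet> (Bs (Sa (h - r) \<phi>) - Bs \<phi>)\<bar> \<le> ?n * norm (Bs (Sa (h - r) \<phi>) - Bs \<phi>)"
          by (rule Cauchy_Schwarz_ineq2)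
        also have "\<dots> \<le> ?n * (e / 2)"
          using h r d2(2)[of "h - r"] by (intro mult_left_mono) (auto simp: d_def intro: less_imp_le)
        also have "\<dots> \<le> (1 + ?n\<^sup>2) * (e / 2)"
        proof -
          have "?n \<le> 1 + ?n\<^sup>2" using sum_squares_bound[of ?n 1] norm_ge_zero[of "u (b + r)"]
            unfolding power_one mult_1_right by linarith
          then show ?thesis using e by (intro mult_right_mono) auto
        qed
        finally have 3: "\<bar>u (b + r) \<bullet> (Bs (Sa (h - r) \<phi>) - Bs \<phi>)\<bar> \<le> (1 + ?n\<^sup>2) * (e / 2)" .
        have abs3: "\<bar>p + q + w\<bar> \<le> \<bar>p\<bar> + \<bar>q\<bar> + \<bar>w\<bar>" for p q w :: real by linarith
        have "e / 2 \<le> (1 + ?n\<^sup>2) * (e / 2)" using e by (simp add: algebra_simps)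
        moreover have "(1 + ?n\<^sup>2) * (e / 2) + (1 + ?n\<^sup>2) * (e / 2) = e * (1 + ?n\<^sup>2)" by simp
        ultimately show "norm (X x u b \<bullet> Sa r a + u (b + r) \<bullet> Bs (Sa (h - r) \<phi>) - f (b + r))
            \<le> e * (1 + ?n\<^sup>2)"
          unfolding eq real_norm_def using 1 2 3 by (intro order.trans[OF abs3]) linarith
      qed (use set_integrable_norm[OF int] int' in simp_all)
      also have "\<dots> = e * (m (b + h) - m b)" by (simp add: m_split)
      finally show ?thesis .
    qed
    have "d > 0" using d1 d2 d3 by (simp add: d_def)
    moreover have "\<bar>F c - F b\<bar> \<le> e * (m c - m b)" if "0 \<le> b" "b \<le> c" "c \<le> T" "c - b < d" for b c
      using incr[of b "c - b"] that by simp
    ultimately show "\<exists>d>0. \<forall>a b. 0 \<le> a \<and> a \<le> b \<and> b \<le> T \<and> b - a < d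
        \<longrightarrow> \<bar>F b - F a\<bar> \<le> e * (m b - m a)" by blast
  qed
  moreover have "F 0 = x \<bullet> \<phi>"
    by (simp add: F_def trajectory_0 set_lebesgue_integral_def)
  moreover have "(LINT s:{0<..<T}|lebesgue. f s) = ip {0<..<T} (X x u) (\<lambda>_. a) + ip {0<..<T} u (\<lambda>_. Bs \<phi>)"
    unfolding f_def ip_def by (intro set_integral_add L2_inner_integrable XL2 u const) auto
  ultimately show ?thesis by (simp add: F_def a_def)
qed

section \<open>Boundedness of the input map\<close>

text \<open>The extension property is evaluated at 0. There the limit \<open>w\<close> vanishes
  almost everywhere, because 0 lies in \<open>Dstar\<close> and has zero output. So the output
  energy tends to 0 with \<open>\<phi>\<close>, and its quadratic homogeneity turns this into a
  bound on the unit ball.\<close>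

lemma output_map_bound:
  assumes obs: "adj_observable D A S B T0"
  obtains K where "\<And>\<phi>. \<phi> \<in> Dstar \<Longrightarrow> norm \<phi> \<le> 1 \<Longrightarrow>
    ip {0<..<T0} (\<lambda>s. Bs (Sa s \<phi>)) (\<lambda>s. Bs (Sa s \<phi>)) \<le> K"
proof -
  define b where "b \<phi> s = Bs (Sa s \<phi>)" for \<phi> s
  define f where "f w \<phi> = (\<integral>\<^sup>+t\<in>{0<..<T0}. ennreal ((norm (control_adj B (adjoint (S t) \<phi>) - w t))\<^sup>2) \<partial>lebesgue)"
    for w \<phi>
  obtain w where w: "w \<in> L2 {0<..<T0}" "(f w \<longlongrightarrow> 0) (inf (nhds 0) (principal Dstar))"
    using obs unfolding adj_observable_def adj_output_def f_def by blast
  have ev: "\<exists>d>0. \<forall>\<phi>\<in>Dstar. norm \<phi> < d \<longrightarrow> f w \<phi> < c" if "c > 0" for c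
  proof -
    have "\<forall>\<^sub>F \<phi> in inf (nhds 0) (principal Dstar). f w \<phi> < c"
      using w(2) that by (auto simp: order_tendsto_iff)
    then show ?thesis
      unfolding eventually_inf_principal eventually_nhds_metric by (auto simp: dist_norm)
  qed
  \<comment> \<open>The filter is not punctured at 0, so the limit also controls the value
    there.\<close>
  have "f w 0 < c" if "c > 0" for c
    using ev[OF that] adj_op_0(1) by force
  then have "f w 0 = 0" by (metis not_gr_zero less_irrefl)
  moreover have "f w 0 = ennreal (ip {0<..<T0} w w)"
    using nn_integral_L2_eq_ip[OF _ w(1)]
    by (simp add: f_def adjoint_S blinfun.zero_right control_adj_0)
  ultimately have "ip {0<..<T0} w w = 0"
    using ip_self_nonneg[of "{0<..<T0}" w] by (simp add: ennreal_eq_0_iff)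
  then have w0: "AE t in lebesgue. t \<in> {0<..<T0} \<longrightarrow> w t = 0"
    using w(1) by (intro ip_self_eq_0_imp_AE) auto
  have f_eq: "f w \<phi> = ennreal (ip {0<..<T0} (b \<phi>) (b \<phi>))" if "\<phi> \<in> Dstar" for \<phi>
  proof -
    have "f w \<phi> = (\<integral>\<^sup>+t\<in>{0<..<T0}. ennreal ((norm (b \<phi> t))\<^sup>2) \<partial>lebesgue)"
      unfolding f_def adjoint_S b_def using w0
      by (intro nn_integral_cong_AE, eventually_elim) (auto simp: indicator_def)
    also have "\<dots> = ennreal (ip {0<..<T0} (b \<phi>) (b \<phi>))"
      unfolding b_def by (intro nn_integral_L2_eq_ip input_kernel_L2 that) auto
    finally show ?thesis .
  qed
  obtain d where d: "d > 0" "\<And>\<phi>. \<phi> \<in> Dstar \<Longrightarrow> norm \<phi> < d \<Longrightarrow> f w \<phi> < 1"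
    using ev[of 1] by auto
  have "ip {0<..<T0} (b \<phi>) (b \<phi>) \<le> (2 / d)\<^sup>2" if \<phi>: "\<phi> \<in> Dstar" "norm \<phi> \<le> 1" for \<phi>
  proof -
    \<comment> \<open>Half the radius brings the closed unit ball inside the open ball of radius
      \<open>d\<close>; homogeneity of degree two then gives the constant
      \<open>(2 / d)\<^sup>2\<close>.\<close>
    define \<psi> where "\<psi> = (d / 2) *\<^sub>R \<phi>"
    have \<psi>: "\<psi> \<in> Dstar" using \<phi> by (simp add: \<psi>_def adj_op_scaleR)
    have "norm \<psi> = d / 2 * norm \<phi>" using d by (simp add: \<psi>_def)
    also have "\<dots> \<le> d / 2 * 1" using d \<phi> by (intro mult_left_mono) auto
    finally have "norm \<psi> < d" using d(1) by simp
    then have "ip {0<..<T0} (b \<psi>) (b \<psi>) < 1"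
      using d(2)[OF \<psi>] f_eq[OF \<psi>] by (simp add: ennreal_less_one_iff)
    moreover have "ip {0<..<T0} (b \<psi>) (b \<psi>) = (d / 2)\<^sup>2 * ip {0<..<T0} (b \<phi>) (b \<phi>)"
    proof -
      have "ip {0<..<T0} (b \<psi>) (b \<psi>)
          = ip {0<..<T0} (\<lambda>s. (d / 2) *\<^sub>R b \<phi> s) (\<lambda>s. (d / 2) *\<^sub>R b \<phi> s)"
        using \<phi> by (intro ip_cong)
          (auto simp: b_def \<psi>_def blinfun.scaleR_right control_adj_scaleR Sa_adj_op)
      then show ?thesis by (simp add: ip_scaleR_left ip_scaleR_right power2_eq_square)
    qed
    ultimately show ?thesis using d(1) by (simp add: field_simps)
  qed
  then show ?thesis by (intro that[of "(2 / d)\<^sup>2"]) (simp add: b_def[abs_def])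
qed

text \<open>Up to time \<open>T0\<close> this is duality: \<open>X 0 u t \<bullet> \<phi>\<close> is
  the pairing of \<open>u\<close> with the reversed output of \<open>\<phi>\<close>. Longer times
  are cut into equal steps of length at most \<open>T0\<close>, joined by the flow property.\<close>

lemma input_map_bounded:
  assumes obs: "adj_observable D A S B T0" and T0: "T0 > 0" and t: "0 \<le> t"
  shows "\<exists>M. \<forall>u\<in>L2 {0<..<t}. ip {0<..<t} u u \<le> R \<longrightarrow> norm (X 0 u t) \<le> M"
proof -
  define Q where "Q t \<longleftrightarrow> (\<exists>M. \<forall>u\<in>L2 {0<..<t}. ip {0<..<t} u u \<le> R \<longrightarrow> norm (X 0 u t) \<le> M)" for t
  obtain K where K: "\<And>\<phi>. \<phi> \<in> Dstar \<Longrightarrow> norm \<phi> \<le> 1 \<Longrightarrow>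
      ip {0<..<T0} (\<lambda>s. Bs (Sa s \<phi>)) (\<lambda>s. Bs (Sa s \<phi>)) \<le> K"
    using output_map_bound[OF obs] by blast
  have short: "Q t" if t: "0 \<le> t" "t \<le> T0" for t
    unfolding Q_def
  proof (intro exI ballI impI)
    fix u :: "real \<Rightarrow> 'u" assume u: "u \<in> L2 {0<..<t}" "ip {0<..<t} u u \<le> R"
    have unit: "\<bar>X 0 u t \<bullet> \<phi>\<bar> \<le> R + K" if \<phi>: "\<phi> \<in> Dstar" "norm \<phi> \<le> 1" for \<phi>
    proof -
      define k where "k s = Bs (Sa (t - s) \<phi>)" for s
      have k: "k \<in> L2 {0<..<t}" unfolding k_def by (rule input_kernel_L2[OF \<phi>(1)])
      have "ip {0<..<t} k k = ip {0<..<t} (\<lambda>s. Bs (Sa s \<phi>)) (\<lambda>s. Bs (Sa s \<phi>))"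
        unfolding ip_def k_def by (rule LINT_reflect)
      also have "\<dots> \<le> ip {0<..<T0} (\<lambda>s. Bs (Sa s \<phi>)) (\<lambda>s. Bs (Sa s \<phi>))"
        using t by (intro ip_subset_le input_kernel_L2 \<phi>) auto
      also have "\<dots> \<le> K" using \<phi> by (rule K)
      finally have kk: "ip {0<..<t} k k \<le> K" .
      \<comment> \<open>Nonnegativity of the energies of \<open>u + k\<close> and
        \<open>u - k\<close> takes the place of the Cauchy-Schwarz inequality in L2.\<close>
      have "ip {0<..<t} u u + 2 * c * ip {0<..<t} u k + c\<^sup>2 * ip {0<..<t} k k
          = ip {0<..<t} (\<lambda>s. u s + c *\<^sub>R k s) (\<lambda>s. u s + c *\<^sub>R k s)" for c
        using ip_self_add[of "{0<..<t}" u "\<lambda>s. c *\<^sub>R k s"] u(1) L2_scaleR[OF _ k]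
        by (simp add: ip_scaleR_left ip_scaleR_right power2_eq_square)
      then have "0 \<le> ip {0<..<t} u u + 2 * c * ip {0<..<t} u k + c\<^sup>2 * ip {0<..<t} k k" for c
        by (simp only: ip_self_nonneg)
      from this[of 1] this[of "-1"] have "\<bar>ip {0<..<t} u k\<bar> \<le> ip {0<..<t} u u + ip {0<..<t} k k"
        using ip_self_nonneg[of "{0<..<t}" u] ip_self_nonneg[of "{0<..<t}" k] by auto
      also have "\<dots> \<le> R + K" using u(2) kk by simp
      also have "ip {0<..<t} u k = X 0 u t \<bullet> \<phi>"
        using trajectory_inner[OF u(1) t(1) order_refl \<phi>(1), of 0] \<phi>(1)
        by (simp add: input_eq_ip k_def[abs_def] blinfun.zero_right)
      finally show ?thesis .
    qed
    show "norm (X 0 u t) \<le> R + K"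
    proof (rule Dstar_norm_le)
      show "0 \<le> R + K" using unit[OF adj_op_0(1)] by simp
      fix \<phi> assume \<phi>: "\<phi> \<in> Dstar"
      show "\<bar>X 0 u t \<bullet> \<phi>\<bar> \<le> (R + K) * norm \<phi>"
      proof (cases "\<phi> = 0")
        case False
        then show ?thesis using unit[of "(1 / norm \<phi>) *\<^sub>R \<phi>"] \<phi>
          by (simp add: adj_op_scaleR abs_mult field_simps)
      qed simp
    qed
  qed
  have add: "Q (a + b)" if ab: "0 \<le> a" "0 \<le> b" and Q: "Q a" "Q b" for a b
  proof -
    obtain M1 where M1: "\<And>u. u \<in> L2 {0<..<a} \<Longrightarrow> ip {0<..<a} u u \<le> R \<Longrightarrow> norm (X 0 u a) \<le> M1"
      using Q(1) unfolding Q_def by blast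
    obtain M2 where M2: "\<And>u. u \<in> L2 {0<..<b} \<Longrightarrow> ip {0<..<b} u u \<le> R \<Longrightarrow> norm (X 0 u b) \<le> M2"
      using Q(2) unfolding Q_def by blast
    show ?thesis unfolding Q_def
    proof (intro exI ballI impI)
      fix u :: "real \<Rightarrow> 'u" assume u: "u \<in> L2 {0<..<a + b}" "ip {0<..<a + b} u u \<le> R"
      have ua: "u \<in> L2 {0<..<a}" and ub: "u \<in> L2 {a<..<a + b}"
        using ab by (auto intro!: L2_subset[OF u(1)])
      have us: "(\<lambda>s. u (a + s)) \<in> L2 {0<..<b}" using ub by (rule L2_translate) auto
      have "ip {0<..<a} u u \<le> ip {0<..<a + b} u u" using ab by (intro ip_subset_le[OF u(1)]) auto
      then have 1: "norm (X 0 u a) \<le> M1" using u(2) by (intro M1 ua) simp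
      have "ip {0<..<b} (\<lambda>s. u (a + s)) (\<lambda>s. u (a + s)) = ip {a<..<a + b} u u"
        by (rule ip_translate[symmetric]) auto
      also have "\<dots> \<le> ip {0<..<a + b} u u" using ab by (intro ip_subset_le[OF u(1)]) auto
      finally have 2: "norm (X 0 (\<lambda>s. u (a + s)) b) \<le> M2" using u(2) by (intro M2 us) simp
      have "X 0 u (a + b) = X (X 0 u a + 0) (\<lambda>s. 0 + u (a + s)) b"
        using trajectory_shift[OF u(1) ab] by simp
      also have "\<dots> = S b (X 0 u a) + X 0 (\<lambda>s. u (a + s)) b"
        using trajectory_add[OF L2_zero us ab(2), of "X 0 u a" 0] by (simp add: trajectory_zero_control)
      finally have "norm (X 0 u (a + b)) \<le> norm (S b (X 0 u a)) + norm (X 0 (\<lambda>s. u (a + s)) b)"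
        using norm_triangle_ineq by simp
      also have "\<dots> \<le> norm (S b) * M1 + M2"
        using 1 2 by (intro add_mono order.trans[OF norm_blinfun mult_left_mono]) auto
      finally show "norm (X 0 u (a + b)) \<le> norm (S b) * M1 + M2" .
    qed
  qed
  obtain n where n: "t / T0 \<le> real n" using real_arch_simple by blast
  \<comment> \<open>\<open>Suc n\<close> keeps the divisor positive when
    \<open>t = 0\<close>.\<close>
  define r where "r = t / real (Suc n)"
  have r: "0 \<le> r" "r \<le> T0" using t n T0 by (auto simp: r_def field_simps)
  have "Q (real k * r)" for k
  proof (induction k)
    case 0
    then show ?case using short[of 0] T0 by simp
  next
    case (Suc k)
    have "Q (real k * r + r)" using r Suc by (intro add short[of r]) auto
    then show ?case by (simp add: algebra_simps)
  qed
  from this[of "Suc n"] show ?thesis by (simp add: r_def Q_def)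
qed

section \<open>Signals and finite cost\<close>

definition signal :: "('h \<Rightarrow>\<^sub>L 'h) \<Rightarrow> 'h \<Rightarrow> 'h \<Rightarrow> (real \<Rightarrow> 'u) \<Rightarrow> real \<Rightarrow> 'h \<times> 'u" where
  "signal C z x u t = (C (X x u t) - z, u t)"

lemma cost_eq_nn_integral:
  "cost D A S B C z I x u = (\<integral>\<^sup>+t\<in>I. ennreal ((norm (signal C z x u t))\<^sup>2) \<partial>lebesgue)"
  by (simp add: cost_def signal_def norm_prod_def)

lemma cost_eq_ip:
  assumes "I \<in> sets lebesgue" "signal C z x u \<in> L2 I"
  shows "cost D A S B C z I x u = ennreal (ip I (signal C z x u) (signal C z x u))"
  unfolding cost_eq_nn_integral by (rule nn_integral_L2_eq_ip[OF assms])

lemma signal_L2_finite: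
  assumes "u \<in> L2 {0<..<T}"
  shows "signal C z x u \<in> L2 {0<..<T}"
proof -
  have "(\<lambda>t. (C (X x u t) - z, u t)) \<in> L2 {0<..<T}"
    by (intro L2_Pair L2_continuous continuous_on_diff continuous_on_const assms
        bounded_linear.continuous_on[OF blinfun.bounded_linear_right] trajectory_continuous[OF assms]) simp
  then show ?thesis by (simp add: signal_def[abs_def])
qed

lemma L2_truncate: "u \<in> L2 {0<..} \<Longrightarrow> u \<in> L2 {0<..<t}"
  by (erule L2_subset) auto

lemma trajectory_continuous_infinite:
  assumes "u \<in> L2 {0<..}"
  shows "continuous_on {0..} (X x u)"
proof (unfold continuous_on_def, intro ballI)
  fix t :: real assume t: "t \<in> {0..}"
  have "at t within {0..} = at t within {0..t + 1}"
    using t by (intro at_within_nhd[of _ "{..<t + 1}"]) auto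
  then show "(X x u \<longlongrightarrow> X x u t) (at t within {0..})"
    using trajectory_continuous[OF L2_truncate[OF assms], of "t + 1" x] t
    by (simp add: continuous_on_def)
qed

text \<open>A finite nonnegative integral says nothing about measurability; this comes from
  continuity of the trajectory and from \<open>u\<close> being in L2.\<close>

lemma signal_L2_if_cost_finite:
  assumes u: "u \<in> L2 {0<..}" and cost: "cost D A S B C 0 {0<..} x u < \<infinity>"
  shows "signal C 0 x u \<in> L2 {0<..}"
proof -
  have "strongly_measurable lebesgue (\<lambda>t. indicator {0<..} t *\<^sub>R (C (X x u t), u t))"
  proof (rule strongly_measurable_Pair)
    show "strongly_measurable lebesgue (\<lambda>t. indicator {0<..} t *\<^sub>R C (X x u t))"
      using u by (intro strongly_measurable_continuous trajectory_continuous_infinite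
        bounded_linear.continuous_on[OF blinfun.bounded_linear_right]) auto
  qed (use u in \<open>simp add: L2_iff\<close>)
  then show ?thesis using cost unfolding cost_eq_nn_integral
    by (simp add: L2_iff_nn signal_def)
qed

text \<open>The target \<open>z\<close> stays with the first summand: a perturbation of a tracking
  problem has the signal with target 0.\<close>

lemma signal_add:
  assumes "u \<in> L2 {0<..<T}" "v \<in> L2 {0<..<T}" "0 \<le> t" "t \<le> T"
  shows "signal C z (x + y) (\<lambda>s. u s + v s) t = signal C z x u t + signal C 0 y v t"
proof -
  have "u \<in> L2 {0<..<t}" "v \<in> L2 {0<..<t}" using assms by (auto intro!: L2_subset[of _ "{0<..<T}"])
  then show ?thesis using assms by (simp add: signal_def trajectory_add blinfun.add_right)
qed

lemma signal_scaleR: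
  assumes "u \<in> L2 {0<..<T}" "0 \<le> t" "t \<le> T"
  shows "signal C 0 (c *\<^sub>R x) (\<lambda>s. c *\<^sub>R u s) t = c *\<^sub>R signal C 0 x u t"
proof -
  have "u \<in> L2 {0<..<t}" using assms by (auto intro!: L2_subset[of _ "{0<..<T}"])
  then show ?thesis using assms by (simp add: signal_def trajectory_scaleR blinfun.scaleR_right)
qed

lemma signal_shift:
  assumes "u \<in> L2 {0<..<a + b}" "0 \<le> a" "0 \<le> b"
  shows "signal C z x u (a + b) = signal C z (X x u a) (\<lambda>s. u (a + s)) b"
  using trajectory_shift[OF assms] by (simp add: signal_def)

lemma signal_cong:
  assumes "\<And>s. 0 < s \<Longrightarrow> s \<le> t \<Longrightarrow> u s = v s" "0 < t"
  shows "signal C z x u t = signal C z x v t"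
  using trajectory_cong[of t u v x] assms by (simp add: signal_def)

text \<open>Phrased by membership in L2, so that \<open>ip\<close> applies directly; for a square
  integrable control a finite cost implies it by \<open>signal_L2_if_cost_finite\<close>.\<close>

definition admits_finite_cost :: "('h \<Rightarrow>\<^sub>L 'h) \<Rightarrow> 'h \<Rightarrow> (real \<Rightarrow> 'u) \<Rightarrow> bool" where
  "admits_finite_cost C x u \<longleftrightarrow> u \<in> L2 {0<..} \<and> signal C 0 x u \<in> L2 {0<..}"

lemma admits_finite_cost_add:
  assumes "admits_finite_cost C x u" "admits_finite_cost C y v"
  shows "admits_finite_cost C (x + y) (\<lambda>s. u s + v s)"
    and "t \<in> {0<..} \<Longrightarrow> signal C 0 (x + y) (\<lambda>s. u s + v s) t = signal C 0 x u t + signal C 0 y v t"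
proof -
  have uv: "u \<in> L2 {0<..}" "v \<in> L2 {0<..}" using assms by (auto simp: admits_finite_cost_def)
  have eq: "signal C 0 (x + y) (\<lambda>s. u s + v s) t = signal C 0 x u t + signal C 0 y v t"
    if "t \<in> {0<..}" for t
    using that by (intro signal_add[of _ t] L2_truncate uv) auto
  show "t \<in> {0<..} \<Longrightarrow> signal C 0 (x + y) (\<lambda>s. u s + v s) t = signal C 0 x u t + signal C 0 y v t"
    by (rule eq)
  have "(\<lambda>t. signal C 0 x u t + signal C 0 y v t) \<in> L2 {0<..}"
    using assms by (intro L2_add) (auto simp: admits_finite_cost_def)
  then have "signal C 0 (x + y) (\<lambda>s. u s + v s) \<in> L2 {0<..}"
    using eq by (subst L2_cong) auto
  then show "admits_finite_cost C (x + y) (\<lambda>s. u s + v s)"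
    using L2_add[OF _ uv] by (simp add: admits_finite_cost_def)
qed

lemma admits_finite_cost_scaleR:
  assumes "admits_finite_cost C x u"
  shows "admits_finite_cost C (c *\<^sub>R x) (\<lambda>s. c *\<^sub>R u s)"
    and "t \<in> {0<..} \<Longrightarrow> signal C 0 (c *\<^sub>R x) (\<lambda>s. c *\<^sub>R u s) t = c *\<^sub>R signal C 0 x u t"
proof -
  have u: "u \<in> L2 {0<..}" using assms by (auto simp: admits_finite_cost_def)
  have eq: "signal C 0 (c *\<^sub>R x) (\<lambda>s. c *\<^sub>R u s) t = c *\<^sub>R signal C 0 x u t"
    if "t \<in> {0<..}" for t
    using that by (intro signal_scaleR[of _ t] L2_truncate u) auto
  show "t \<in> {0<..} \<Longrightarrow> signal C 0 (c *\<^sub>R x) (\<lambda>s. c *\<^sub>R u s) t = c *\<^sub>R signal C 0 x u t"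
    by (rule eq)
  have "(\<lambda>t. c *\<^sub>R signal C 0 x u t) \<in> L2 {0<..}"
    using assms by (intro L2_scaleR) (auto simp: admits_finite_cost_def)
  then have "signal C 0 (c *\<^sub>R x) (\<lambda>s. c *\<^sub>R u s) \<in> L2 {0<..}"
    using eq by (subst L2_cong) auto
  then show "admits_finite_cost C (c *\<^sub>R x) (\<lambda>s. c *\<^sub>R u s)"
    using L2_scaleR[OF _ u] by (simp add: admits_finite_cost_def)
qed

end

section \<open>The infinite-horizon problem\<close>

locale linear_quadratic_regulator = control_system D A S B
  for D :: "'h::{real_inner,banach} set" and A :: "'h \<Rightarrow> 'h" and S :: "real \<Rightarrow> 'h \<Rightarrow>\<^sub>L 'h"
    and B :: "'u::{real_inner,banach} \<Rightarrow> 'h \<Rightarrow> real" +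
  fixes C P :: "'h \<Rightarrow>\<^sub>L 'h" and Sopt :: "real \<Rightarrow> 'h \<Rightarrow> 'h" and T0 :: real
  assumes riccati: "riccati_operator D A S B C P"
    and opt_semigroup: "optimal_semigroup D A S B C Sopt"
    and observability: "adj_observable D A S B T0" and T0: "T0 > 0"
begin

abbreviation "optimal \<equiv> optimal_control D A S B C 0 {0<..}"
abbreviation "sig \<equiv> signal C 0"

lemma P_symmetric: "P x \<bullet> y = x \<bullet> P y"
  using riccati unfolding riccati_operator_def by blast

text \<open>An optimal control attains the infimum, so its cost is the real number
  \<open>P x \<bullet> x\<close>; the \<open>ereal\<close> equation excludes the value
  infinity.\<close>

lemma optimal_finite_cost:
  assumes "optimal x u"
  shows "admits_finite_cost C x u" and "ip {0<..} (sig x u) (sig x u) = P x \<bullet> x"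
proof -
  have u: "u \<in> L2 {0<..}" "\<And>v. v \<in> L2 {0<..} \<Longrightarrow> cost D A S B C 0 {0<..} x u \<le> cost D A S B C 0 {0<..} x v"
    using assms by (auto simp: optimal_control_def)
  have "(INF v\<in>L2 {0<..}. cost D A S B C 0 {0<..} x v) = cost D A S B C 0 {0<..} x u"
    by (intro antisym INF_lower INF_greatest u)
  then have c: "ereal (P x \<bullet> x) = enn2ereal (cost D A S B C 0 {0<..} x u)"
    using riccati unfolding riccati_operator_def by metis
  then have "cost D A S B C 0 {0<..} x u \<noteq> \<infinity>" by auto
  then have L2: "signal C 0 x u \<in> L2 {0<..}"
    using u(1) by (intro signal_L2_if_cost_finite) (auto simp: top.not_eq_extremum)
  with u show "admits_finite_cost C x u" by (simp add: admits_finite_cost_def)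
  show "ip {0<..} (sig x u) (sig x u) = P x \<bullet> x"
    using c cost_eq_ip[OF _ L2] ip_self_nonneg[of "{0<..}" "sig x u"]
    by (simp add: enn2ereal_ennreal)
qed

lemma P_le_cost:
  assumes "admits_finite_cost C x u"
  shows "P x \<bullet> x \<le> ip {0<..} (sig x u) (sig x u)"
proof -
  have u: "u \<in> L2 {0<..}" "sig x u \<in> L2 {0<..}" using assms by (auto simp: admits_finite_cost_def)
  have "ereal (P x \<bullet> x) = enn2ereal (INF v\<in>L2 {0<..}. cost D A S B C 0 {0<..} x v)"
    using riccati unfolding riccati_operator_def by metis
  also have "\<dots> \<le> enn2ereal (cost D A S B C 0 {0<..} x u)"
    using u by (simp add: less_eq_ennreal.rep_eq[symmetric] INF_lower)
  also have "\<dots> = ereal (ip {0<..} (sig x u) (sig x u))"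
    using cost_eq_ip[OF _ u(2)] ip_self_nonneg[of "{0<..}" "sig x u"] by (simp add: enn2ereal_ennreal)
  finally show ?thesis by simp
qed

text \<open>
  Polarization: for \<open>v\<close> optimal from \<open>y\<close>, the control \<open>l u + v\<close> from \<open>l x + y\<close> costs at least
  \<open>\<langle>P (l x + y), l x + y\<rangle>\<close> for every real \<open>l\<close>, with equality for \<open>l = 0\<close>.
\<close>

lemma P_inner_eq_ip:
  assumes u: "admits_finite_cost C x u" and v: "optimal y v"
  shows "P x \<bullet> y = ip {0<..} (sig x u) (sig y v)"
proof -
  note v' = optimal_finite_cost[OF v]
  have L2: "sig x u \<in> L2 {0<..}" "sig y v \<in> L2 {0<..}"
    using u v' by (auto simp: admits_finite_cost_def)
  have "0 \<le> (ip {0<..} (sig x u) (sig x u) - P x \<bullet> x) * l\<^sup>2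
      + 2 * (ip {0<..} (sig x u) (sig y v) - P x \<bullet> y) * l" for l
  proof -
    note lu = admits_finite_cost_scaleR[OF u, where c=l]
    note w = admits_finite_cost_add[OF lu(1) v'(1)]
    have "P (l *\<^sub>R x + y) \<bullet> (l *\<^sub>R x + y)
        \<le> ip {0<..} (\<lambda>t. l *\<^sub>R sig x u t + sig y v t) (\<lambda>t. l *\<^sub>R sig x u t + sig y v t)"
      by (rule order.trans[OF P_le_cost[OF w(1)]], rule eq_refl, rule ip_cong) (simp_all add: w(2) lu(2))
    also have "\<dots> = l\<^sup>2 * ip {0<..} (sig x u) (sig x u) + 2 * l * ip {0<..} (sig x u) (sig y v) + P y \<bullet> y"
      using ip_self_add[OF _ L2_scaleR[OF _ L2(1)] L2(2), of l] v'(2)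
      by (simp add: ip_scaleR_left ip_scaleR_right power2_eq_square)
    also have "P (l *\<^sub>R x + y) \<bullet> (l *\<^sub>R x + y) = l\<^sup>2 * (P x \<bullet> x) + 2 * l * (P x \<bullet> y) + P y \<bullet> y"
      using P_symmetric[of y x]
      by (simp add: blinfun.add_right blinfun.scaleR_right inner_add_left inner_add_right
          inner_commute power2_eq_square algebra_simps)
    finally show ?thesis by (simp add: algebra_simps)
  qed
  from quadratic_nonneg_imp_linear_coeff_0[OF this] show ?thesis by simp
qed

text \<open>\<open>optimal_semigroup\<close> asserts existence separately for each state, so one
  control per state is chosen. Nothing relates the choices for different states; linearity has to
  come from optimality.\<close>

definition U :: "'h \<Rightarrow> real \<Rightarrow> 'u" where
  "U x = (SOME u. optimal x u \<and> (\<forall>t\<ge>0. Sopt t x = X x u t))"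

lemma U: "optimal x (U x)" "0 \<le> t \<Longrightarrow> Sopt t x = X x (U x) t"
proof -
  have "\<exists>u. optimal x u \<and> (\<forall>t\<ge>0. Sopt t x = X x u t)"
    using opt_semigroup by (simp add: optimal_semigroup_def)
  from someI_ex[OF this] show "optimal x (U x)" "0 \<le> t \<Longrightarrow> Sopt t x = X x (U x) t"
    unfolding U_def by auto
qed

lemma U_L2: "U x \<in> L2 {0<..}"
  using U(1) by (simp add: optimal_control_def)

text \<open>
  The defect of linearity is a control from the origin whose signal is orthogonal to all optimal
  signals, hence to itself.
\<close>

lemma Sopt_linear:
  assumes t: "0 \<le> t"
  shows "Sopt t (c *\<^sub>R x + y) = c *\<^sub>R Sopt t x + Sopt t y"
proof -
  define w where "w s = c *\<^sub>R U x s + U y s" for s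
  define v where "v s = w s + (-1) *\<^sub>R U (c *\<^sub>R x + y) s" for s
  note fc = optimal_finite_cost(1)[OF U(1)]
  note cx = admits_finite_cost_scaleR[OF fc[of x], where c=c]
  note w' = admits_finite_cost_add[OF cx(1) fc[of y], folded w_def]
  note m = admits_finite_cost_scaleR[OF fc[of "c *\<^sub>R x + y"], where c="-1"]
  note v' = admits_finite_cost_add[OF w'(1) m(1), folded v_def]
  have v0: "admits_finite_cost C 0 v" using v'(1) by simp
  have sig_v: "sig 0 v s = (c *\<^sub>R sig x (U x) s + sig y (U y) s) - sig (c *\<^sub>R x + y) (U (c *\<^sub>R x + y)) s"
    if "s \<in> {0<..}" for s
    using v'(2)[OF that] w'(2)[OF that] cx(2)[OF that] m(2)[OF that] by simp
  have L2: "sig z (U z) \<in> L2 {0<..}" for z using fc[of z] by (simp add: admits_finite_cost_def)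
  have L2v: "sig 0 v \<in> L2 {0<..}" "v \<in> L2 {0<..}" using v0 by (auto simp: admits_finite_cost_def)
  have orth: "ip {0<..} (sig z (U z)) (sig 0 v) = 0" for z
    using P_inner_eq_ip[OF v0 U(1), of z] by (simp add: ip_commute blinfun.zero_right)
  have "ip {0<..} (sig 0 v) (sig 0 v) = ip {0<..} (\<lambda>s. (c *\<^sub>R sig x (U x) s + sig y (U y) s)
      - sig (c *\<^sub>R x + y) (U (c *\<^sub>R x + y)) s) (sig 0 v)"
    by (intro ip_cong sig_v refl)
  also have "\<dots> = 0"
    by (simp add: ip_diff_left ip_add_left L2 L2v L2_add L2_scaleR ip_scaleR_left orth)
  finally have "AE s in lebesgue. s \<in> {0<..} \<longrightarrow> sig 0 v s = 0"
    using L2v by (intro ip_self_eq_0_imp_AE) auto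
  \<comment> \<open>The control is a component of its signal, so it vanishes almost everywhere, and
    the input integral does not see null sets.\<close>
  then have ae: "AE s in lebesgue. s \<in> {0<..} \<longrightarrow> v s = 0"
    by eventually_elim (simp add: signal_def zero_prod_def)
  have "X 0 v t = 0"
  proof (rule trajectory_eqI)
    fix \<phi> assume \<phi>: "\<phi> \<in> Dstar"
    have "ip {0<..<t} v (\<lambda>s. Bs (Sa (t - s) \<phi>)) = 0"
      unfolding ip_def set_lebesgue_integral_def
      by (rule integral_eq_zero_AE) (use ae in \<open>eventually_elim, auto simp: indicator_def\<close>)
    then show "0 \<bullet> \<phi> = S t 0 \<bullet> \<phi> + input v t \<phi>"
      using \<phi> by (simp add: input_eq_ip blinfun.zero_right)
  qed
  moreover have "X 0 v t = X (c *\<^sub>R x + y) w t - X (c *\<^sub>R x + y) (U (c *\<^sub>R x + y)) t"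
    using trajectory_diff[of w t "U (c *\<^sub>R x + y)" "c *\<^sub>R x + y" "c *\<^sub>R x + y"] w'(1) U_L2 t
    by (simp add: v_def[abs_def] L2_truncate admits_finite_cost_def)
  moreover have "X (c *\<^sub>R x + y) w t = c *\<^sub>R X x (U x) t + X y (U y) t"
    unfolding w_def using t
    by (simp add: trajectory_add trajectory_scaleR L2_truncate U_L2 L2_scaleR)
  ultimately show ?thesis using t by (simp add: U(2))
qed

text \<open>On the unit ball the optimal control has energy at most \<open>P x \<bullet> x\<close>,
  hence at most \<open>norm P\<close>; this is the energy level at which the bound of the input map
  is invoked.\<close>

lemma bounded_linear_Sopt:
  assumes t: "0 \<le> t"
  shows "bounded_linear (Sopt t)"
proof -
  have "Sopt t 0 = 0" using Sopt_linear[OF t, of 1 0 0] by simp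
  then have sc: "Sopt t (c *\<^sub>R x) = c *\<^sub>R Sopt t x" for c x using Sopt_linear[OF t, of c x 0] by simp
  have add: "Sopt t (x + y) = Sopt t x + Sopt t y" for x y using Sopt_linear[OF t, of 1 x y] by simp
  obtain M where M: "\<And>u. u \<in> L2 {0<..<t} \<Longrightarrow> ip {0<..<t} u u \<le> norm P \<Longrightarrow> norm (X 0 u t) \<le> M"
    using input_map_bounded[OF observability T0 t, of "norm P"] by blast
  have unit: "norm (Sopt t x) \<le> norm (S t) + M" if x: "norm x \<le> 1" for x
  proof -
    note fc = optimal_finite_cost[OF U(1), of x]
    have s: "sig x (U x) \<in> L2 {0<..}" using fc(1) by (simp add: admits_finite_cost_def)
    have "ip {0<..<t} (U x) (U x) \<le> ip {0<..} (U x) (U x)"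
      by (intro ip_subset_le U_L2) auto
    also have "\<dots> \<le> ip {0<..} (sig x (U x)) (sig x (U x))"
      unfolding ip_def
      by (intro set_integral_mono L2_inner_integrable U_L2 s) (auto simp: signal_def)
    also have "\<dots> = P x \<bullet> x" by (rule fc(2))
    also have "\<dots> \<le> norm (P x) * norm x" by (rule norm_cauchy_schwarz)
    also have "\<dots> \<le> (norm P * 1) * 1"
      using x by (intro mult_mono order.trans[OF norm_blinfun mult_left_mono]) auto
    finally have 1: "norm (X 0 (U x) t) \<le> M" by (intro M L2_truncate U_L2) simp
    have "Sopt t x = X (x + 0) (\<lambda>s. 0 + U x s) t" using U(2)[OF t] by simp
    also have "\<dots> = S t x + X 0 (U x) t"
      using trajectory_add[OF L2_zero L2_truncate[OF U_L2] t, of x 0] by (simp add: trajectory_zero_control)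
    finally have "norm (Sopt t x) \<le> norm (S t x) + norm (X 0 (U x) t)"
      using norm_triangle_ineq by simp
    also have "norm (S t x) \<le> norm (S t) * 1"
      using x by (intro order.trans[OF norm_blinfun mult_left_mono]) auto
    finally show ?thesis using 1 by simp
  qed
  show ?thesis
  proof (rule bounded_linear_intro[OF add sc])
    fix x
    show "norm (Sopt t x) \<le> norm x * (norm (S t) + M)"
    proof (cases "x = 0")
      case True
      then show ?thesis using \<open>Sopt t 0 = 0\<close> by simp
    next
      case False
      then show ?thesis using unit[of "(1 / norm x) *\<^sub>R x"] by (simp add: sc field_simps)
    qed
  qed
qed

text \<open>
  Cross term of the dynamic programming principle: run the control \<open>d\<close> up to time \<open>t\<close>, then an
  optimal one. The tail of the optimal trajectory from \<open>y\<close> enters with the roles exchanged, so that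
  it only has to have finite cost.
\<close>

lemma P_inner_diff:
  assumes d: "d \<in> L2 {0<..<t}" and t: "0 \<le> t"
  shows "P x \<bullet> y - P (X x d t) \<bullet> Sopt t y = ip {0<..<t} (sig x d) (sig y (U y))"
proof -
  define x' where "x' = X x d t"
  define w where "w s = (if s \<in> {0<..<t} then d s else U x' (-t + s))" for s
  have tail: "(\<lambda>s. U x' (-t + s)) \<in> L2 {t<..}" by (rule L2_translate[OF U_L2]) auto
  have "w \<in> L2 ({0<..<t} \<union> {t<..})"
    unfolding w_def using d tail by (intro L2_If) auto
  then have "w \<in> L2 (insert t ({0<..<t} \<union> {t<..}))" by (rule L2_insert) auto
  then have w: "w \<in> L2 {0<..}" by (rule L2_subset) (use t in auto)
  have X_w: "X x w t = x'"
    unfolding x'_def by (rule trajectory_cong) (auto simp: w_def)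
  have sig_head: "sig x w s = sig x d s" if "s \<in> {0<..<t}" for s
    using that by (intro signal_cong) (auto simp: w_def)
  have sig_tail: "sig x w (t + s) = sig x' (U x') s" if "s \<in> {0<..}" for s
  proof -
    have "sig x w (t + s) = sig x' (\<lambda>r. w (t + r)) s"
      using signal_shift[OF L2_truncate[OF w] t, of s] that by (simp add: X_w)
    also have "\<dots> = sig x' (U x') s"
      using that t by (intro signal_cong) (auto simp: w_def)
    finally show ?thesis .
  qed
  have "sig x w \<in> L2 {0<..<t}" by (intro signal_L2_finite L2_truncate w)
  moreover have "sig x w \<in> L2 {t<..}"
  proof -
    have "sig x' (U x') \<in> L2 {0<..}"
      using optimal_finite_cost(1)[OF U(1)] by (simp add: admits_finite_cost_def)
    then have "(\<lambda>s. sig x' (U x') (-t + s)) \<in> L2 {t<..}" by (rule L2_translate) auto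
    moreover have "sig x' (U x') (-t + s) = sig x w s" if "s \<in> {t<..}" for s
      using sig_tail[of "-t + s"] that by simp
    ultimately show ?thesis by (subst L2_cong[of _ _ "\<lambda>s. sig x' (U x') (-t + s)"]) auto
  qed
  ultimately have sw': "sig x w \<in> L2 ({0<..<t} \<union> {t<..})" by (intro L2_Un) auto
  have "sig x w \<in> L2 (insert t ({0<..<t} \<union> {t<..}))" using sw' by (rule L2_insert) auto
  then have sw: "sig x w \<in> L2 {0<..}" by (rule L2_subset) (use t in auto)
  have sy: "sig y (U y) \<in> L2 {0<..}"
    using optimal_finite_cost(1)[OF U(1)] by (simp add: admits_finite_cost_def)
  \<comment> \<open>Stated with \<open>t\<close> inserted on both sides because for
    \<open>t = 0\<close> the cut point does not belong to \<open>{0<..}\<close>.\<close>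
  have ins: "insert t {0<..} = insert t ({0<..<t} \<union> {t<..})" using t by auto
  have "P x \<bullet> y = ip {0<..} (sig x w) (sig y (U y))"
    using w sw by (intro P_inner_eq_ip U(1)) (simp add: admits_finite_cost_def)
  also have "\<dots> = ip ({0<..<t} \<union> {t<..}) (sig x w) (sig y (U y))"
    using ip_insert[of t "{0<..}"] ip_insert[of t "{0<..<t} \<union> {t<..}"] ins by metis
  also have "\<dots> = ip {0<..<t} (sig x w) (sig y (U y)) + ip {t<..} (sig x w) (sig y (U y))"
    by (intro ip_Un sw' L2_subset[OF sy]) (use t in auto)
  also have "ip {0<..<t} (sig x w) (sig y (U y)) = ip {0<..<t} (sig x d) (sig y (U y))"
    by (intro ip_cong sig_head refl)
  also have "ip {t<..} (sig x w) (sig y (U y)) = P x' \<bullet> Sopt t y"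
  proof -
    define v where "v s = U y (t + s)" for s
    have v: "v \<in> L2 {0<..}"
      unfolding v_def using t by (intro L2_translate[where J="{t<..}"] L2_subset[OF U_L2]) auto
    have sig_v: "sig y (U y) (t + s) = sig (Sopt t y) v s" if "s \<in> {0<..}" for s
      using signal_shift[OF L2_truncate[OF U_L2] t, of s] that by (simp add: U(2) t v_def[abs_def])
    have "(\<lambda>s. sig y (U y) (t + s)) \<in> L2 {0<..}"
      using t by (intro L2_translate[where J="{t<..}"] L2_subset[OF sy]) auto
    then have "sig (Sopt t y) v \<in> L2 {0<..}"
      using sig_v by (subst L2_cong[of _ _ "\<lambda>s. sig y (U y) (t + s)"]) auto
    with v have fc: "admits_finite_cost C (Sopt t y) v" by (simp add: admits_finite_cost_def)
    have "ip {t<..} (sig x w) (sig y (U y))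
        = ip {0<..} (\<lambda>s. sig x w (t + s)) (\<lambda>s. sig y (U y) (t + s))"
      by (rule ip_translate) auto
    also have "\<dots> = ip {0<..} (sig x' (U x')) (sig (Sopt t y) v)"
      by (intro ip_cong sig_tail sig_v)
    also have "\<dots> = P (Sopt t y) \<bullet> x'"
      using P_inner_eq_ip[OF fc U(1)] by (simp add: ip_commute)
    also have "\<dots> = P x' \<bullet> Sopt t y" by (simp add: P_symmetric inner_commute)
    finally show ?thesis .
  qed
  finally show ?thesis by (simp add: x'_def)
qed

end

section \<open>First-order conditions of the finite-horizon and the stationary problem\<close>

context control_system
begin

text \<open>First-order optimality of \<open>u\<close> in the direction of the control \<open>v\<close>, switched on at time \<open>a\<close>.\<close>

lemma optimal_control_orthogonal:
  assumes opt: "optimal_control D A S B C z {0<..<a + b} x u"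
    and v: "v \<in> L2 {0<..<b}" and ab: "0 \<le> a" "0 \<le> b"
  shows "ip {0<..<b} (\<lambda>s. signal C z x u (a + s)) (signal C 0 0 v) = 0"
proof -
  define w where "w s = (if s \<in> {a<..<a + b} then v (-a + s) else 0)" for s
  have u: "u \<in> L2 {0<..<a + b}" using opt by (simp add: optimal_control_def)
  have "(\<lambda>s. v (-a + s)) \<in> L2 {a<..<a + b}" by (rule L2_translate[OF v]) auto
  then have "w \<in> L2 ({a<..<a + b} \<union> {0<..a})"
    unfolding w_def by (intro L2_If L2_zero) auto
  then have w: "w \<in> L2 {0<..<a + b}" by (rule L2_subset) (use ab in auto)
  have sig_head: "signal C 0 0 w s = 0" if "s \<in> {0<..<a}" for s
  proof -
    have "signal C 0 0 w s = signal C 0 0 (\<lambda>_. 0) s"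
      using that by (intro signal_cong) (auto simp: w_def)
    then show ?thesis by (simp add: signal_def trajectory_zero_control blinfun.zero_right zero_prod_def)
  qed
  \<comment> \<open>Nothing has acted before time \<open>a\<close>, so the state is still 0 there
    and \<open>w\<close> acts from \<open>a\<close> on as \<open>v\<close> does from time 0.\<close>
  have X_a: "X 0 w a = 0"
    using trajectory_cong[of a w "\<lambda>_. 0" 0] by (simp add: w_def trajectory_zero_control blinfun.zero_right)
  have sig_tail: "signal C 0 0 w (a + s) = signal C 0 0 v s" if "s \<in> {0<..<b}" for s
  proof -
    have "w \<in> L2 {0<..<a + s}" using that ab by (intro L2_subset[OF w]) auto
    then have "signal C 0 0 w (a + s) = signal C 0 0 (\<lambda>r. w (a + r)) s"
      using signal_shift[of w a s] ab that by (simp add: X_a)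
    also have "\<dots> = signal C 0 0 v s"
      using that by (intro signal_cong) (auto simp: w_def)
    finally show ?thesis .
  qed
  have L2: "signal C z x u \<in> L2 {0<..<a + b}" "signal C 0 0 w \<in> L2 {0<..<a + b}"
    by (intro signal_L2_finite u w)+
  have "ip {0<..<a + b} (signal C z x u) (signal C 0 0 w) = 0"
  proof (rule ip_first_order[OF _ L2])
    fix l
    let ?ul = "\<lambda>s. u s + l *\<^sub>R w s"
    have lw: "(\<lambda>s. l *\<^sub>R w s) \<in> L2 {0<..<a + b}" by (intro L2_scaleR w) auto
    have ul: "?ul \<in> L2 {0<..<a + b}" by (intro L2_add u lw) auto
    have sig_ul: "signal C z x ?ul s = signal C z x u s + l *\<^sub>R signal C 0 0 w s"
      if "s \<in> {0<..<a + b}" for s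
      using signal_add[OF u lw, of s C z x "l *\<^sub>R 0"] signal_scaleR[OF w, of s C l 0] that by simp
    have "cost D A S B C z {0<..<a + b} x u \<le> cost D A S B C z {0<..<a + b} x ?ul"
      using opt ul by (simp add: optimal_control_def)
    then have "ip {0<..<a + b} (signal C z x u) (signal C z x u)
        \<le> ip {0<..<a + b} (signal C z x ?ul) (signal C z x ?ul)"
      by (simp add: cost_eq_ip L2 signal_L2_finite ul ip_self_nonneg ennreal_le_iff)
    also have "\<dots> = ip {0<..<a + b} (\<lambda>s. signal C z x u s + l *\<^sub>R signal C 0 0 w s)
        (\<lambda>s. signal C z x u s + l *\<^sub>R signal C 0 0 w s)"
      by (intro ip_cong sig_ul)
    finally show "ip {0<..<a + b} (signal C z x u) (signal C z x u) \<le> \<dots>" .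
  qed auto
  also have "ip {0<..<a + b} (signal C z x u) (signal C 0 0 w)
      = ip {0<..<a} (signal C z x u) (signal C 0 0 w)
        + ip {0<..<b} (\<lambda>s. signal C z x u (a + s)) (\<lambda>s. signal C 0 0 w (a + s))"
    unfolding ip_def by (intro LINT_split L2_inner_integrable L2 ab) auto
  also have "ip {0<..<a} (signal C z x u) (signal C 0 0 w) = ip {0<..<a} (signal C z x u) (\<lambda>_. 0)"
    by (intro ip_cong sig_head refl)
  also have "ip {0<..<b} (\<lambda>s. signal C z x u (a + s)) (\<lambda>s. signal C 0 0 w (a + s))
      = ip {0<..<b} (\<lambda>s. signal C z x u (a + s)) (signal C 0 0 v)"
    by (intro ip_cong sig_tail refl)
  finally show ?thesis by (simp add: ip_def)
qed

text \<open>Tested with \<open>\<zeta>\<close>, the mild formula pairs the optimal signal with the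
  free signal from \<open>\<zeta>\<close>, whose control is 0. Optimality allows the signal of any
  control \<open>v\<close> from the origin to be added, which completes it to the signal of
  \<open>v\<close> from \<open>\<zeta>\<close>.\<close>

lemma adjoint_state_inner:
  assumes opt: "optimal_control D A S B C z {0<..<T} x u"
    and y: "adjoint_state S C z T xT y" and xT: "\<And>s. s \<in> {0..T} \<Longrightarrow> xT s = X x u s"
    and v: "v \<in> L2 {0<..<b}" and ab: "0 \<le> a" "0 \<le> b" "a + b = T"
  shows "y a \<bullet> \<zeta> = ip {0<..<b} (\<lambda>s. signal C z x u (a + s)) (signal C 0 \<zeta> v)"
proof -
  have u: "u \<in> L2 {0<..<T}" using opt by (simp add: optimal_control_def)
  define W where "W s = signal C z x u (a + s)" for s
  define Z where "Z s = (C (S s \<zeta>), 0::'u)" for s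
  have adjC: "adjoint C p \<bullet> q = p \<bullet> C q" for p q
    using adjoint_inner[OF blinfun.bounded_linear_right, of C q p] by (simp add: inner_commute)
  have f: "(\<lambda>s. (C (X x u (a + s)) - z) \<bullet> C (S s \<zeta>)) = (\<lambda>s. W s \<bullet> Z s)"
    by (simp add: W_def Z_def signal_def)
  have "((\<lambda>s. adjoint (S (s - a)) (adjoint C (C (xT s) - z))) has_integral y a) {a..T}"
    using y ab by (auto simp: adjoint_state_def)
  from has_integral_linear[OF this bounded_linear_inner_left[of \<zeta>]]
  have "((\<lambda>s. adjoint (S (s - a)) (adjoint C (C (xT s) - z)) \<bullet> \<zeta>) has_integral y a \<bullet> \<zeta>) {a..T}"
    by (simp add: o_def)
  then have "y a \<bullet> \<zeta> = integral {a..T} (\<lambda>s. adjoint (S (s - a)) (adjoint C (C (xT s) - z)) \<bullet> \<zeta>)"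
    by (simp add: integral_unique)
  also have "\<dots> = integral {a..T} (\<lambda>s. (C (X x u s) - z) \<bullet> C (S (s - a) \<zeta>))"
  proof (rule integral_cong)
    fix s assume s: "s \<in> {a..T}"
    have "adjoint (S (s - a)) p \<bullet> \<zeta> = p \<bullet> S (s - a) \<zeta>" for p
      by (simp add: adjoint_S inner_commute[of _ \<zeta>] inner_Sa) (simp add: inner_commute)
    then show "adjoint (S (s - a)) (adjoint C (C (xT s) - z)) \<bullet> \<zeta> = (C (X x u s) - z) \<bullet> C (S (s - a) \<zeta>)"
      using s ab xT[of s] by (simp add: adjC)
  qed
  also have "\<dots> = integral {0..b} (\<lambda>s. (C (X x u (s + a)) - z) \<bullet> C (S s \<zeta>))"
  proof -
    have "T - a = b" using ab(3) by simp
    then show ?thesis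
      using integral_shift_real_ivl[of a a T "\<lambda>s. (C (X x u s) - z) \<bullet> C (S (s - a) \<zeta>)"] by simp
  qed
  also have "\<dots> = integral {0..b} (\<lambda>s. W s \<bullet> Z s)" by (simp only: add.commute[of _ a] f)
  also have "\<dots> = ip {0<..<b} W Z"
    unfolding ip_def f[symmetric] using ab
    by (intro LINT_continuous[symmetric] continuous_on_inner continuous_on_diff continuous_on_const
        bounded_linear.continuous_on[OF blinfun.bounded_linear_right] continuous_on_orbit_subset
        continuous_on_compose2[OF trajectory_continuous[OF u]] continuous_on_add continuous_on_id) auto
  \<comment> \<open>The added term is 0 by \<open>optimal_control_orthogonal\<close>.\<close>
  also have "\<dots> = ip {0<..<b} W Z + ip {0<..<b} W (signal C 0 0 v)"
    unfolding W_def using optimal_control_orthogonal[of C z a b x u v] opt v ab by simp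
  also have "\<dots> = ip {0<..<b} W (\<lambda>s. Z s + signal C 0 0 v s)"
  proof -
    have "signal C z x u \<in> L2 {a<..<a + b}"
      using ab by (intro L2_subset[OF signal_L2_finite[OF u]]) auto
    then have "W \<in> L2 {0<..<b}" unfolding W_def by (rule L2_translate) auto
    moreover have "Z \<in> L2 {0<..<b}" unfolding Z_def
      by (intro L2_Pair L2_continuous continuous_on_const continuous_on_orbit_subset
          bounded_linear.continuous_on[OF blinfun.bounded_linear_right]) auto
    ultimately show ?thesis
      using ip_add_left[of "{0<..<b}" Z "signal C 0 0 v" W] signal_L2_finite[OF v]
      by (simp add: ip_commute[of _ W])
  qed
  also have "\<dots> = ip {0<..<b} W (signal C 0 \<zeta> v)"
  proof (rule ip_cong[OF refl])
    fix s assume s: "s \<in> {0<..<b}"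
    have "signal C 0 (\<zeta> + 0) (\<lambda>s. 0 + v s) s = signal C 0 \<zeta> (\<lambda>_. 0) s + signal C 0 0 v s"
      using s by (intro signal_add[OF L2_zero v]) auto
    then show "Z s + signal C 0 0 v s = signal C 0 \<zeta> v s"
      by (simp add: signal_def[of C 0 \<zeta> "\<lambda>_. 0"] trajectory_zero_control Z_def)
  qed
  finally show ?thesis by (simp add: W_def[abs_def])
qed

text \<open>With \<open>Astar y\<close> and \<open>Bs y\<close> replaced by means of the optimality
  system, the integrand of the weak state equation tested with \<open>y\<close> is minus the pairing
  with the constant signal.\<close>

lemma stationary_state_inner:
  assumes "stationary_optimal D A B C z x u y" "v \<in> L2 {0<..<t}" "0 \<le> t"
  shows "y \<bullet> \<zeta> - y \<bullet> X \<zeta> v t = ip {0<..<t} (\<lambda>_. (C x - z, u)) (signal C 0 \<zeta> v)"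
proof -
  have neg: "p = - q" if "- p - q = 0" for p q :: 'h
    using that by (metis minus_minus right_minus_eq)
  have y: "y \<in> Dstar" "Astar y = - adjoint C (C x - z)" "Bs y = - u"
    using assms(1) neg unfolding stationary_optimal_def by (blast, blast, simp)
  have XL2: "X \<zeta> v \<in> L2 {0<..<t}" by (intro L2_continuous trajectory_continuous assms)
  have const: "(\<lambda>_. c) \<in> L2 {0<..<t}" for c :: "'b::real_normed_vector"
    by (intro L2_continuous continuous_on_const)
  have "ip {0<..<t} (\<lambda>_. (C x - z, u)) (signal C 0 \<zeta> v)
      = (LINT s:{0<..<t}|lebesgue. - (X \<zeta> v s \<bullet> Astar y + v s \<bullet> Bs y))"
    unfolding ip_def
    by (intro set_lebesgue_integral_cong)
      (auto simp: signal_def y inner_commute adjoint_inner[OF blinfun.bounded_linear_right, of C, symmetric])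
  also have "\<dots> = - (ip {0<..<t} (X \<zeta> v) (\<lambda>_. Astar y) + ip {0<..<t} v (\<lambda>_. Bs y))"
  proof -
    have "set_integrable lebesgue {0<..<t} (\<lambda>s. X \<zeta> v s \<bullet> Astar y)"
      "set_integrable lebesgue {0<..<t} (\<lambda>s. v s \<bullet> Bs y)"
      by (intro L2_inner_integrable XL2 assms(2) const; simp)+
    then show ?thesis
      unfolding ip_def by (simp only: set_integral_uminus set_integral_add)
  qed
  also have "\<dots> = y \<bullet> \<zeta> - y \<bullet> X \<zeta> v t"
    using trajectory_weak_solution[OF assms(2) y(1) assms(3), of \<zeta>] by (simp add: inner_commute[of y])
  finally show ?thesis by simp
qed

end

section \<open>Comparison of the two evaluations of the pairing\<close>

lemma (in linear_quadratic_regulator) turnpike_inner: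
  assumes opt: "optimal_control D A S B C z {0<..<T} x0 uT"
    and xT: "\<And>s. s \<in> {0..T} \<Longrightarrow> xT s = X x0 uT s"
    and yT: "adjoint_state S C z T xT yT"
    and stat: "stationary_optimal D A B C z xbar ubar ybar"
    and ab: "0 \<le> a" "0 \<le> b" "a + b = T"
  shows "(yT a - ybar - P (xT a - xbar)) \<bullet> \<zeta> = (yT T - ybar - P (xT T - xbar)) \<bullet> Sopt b \<zeta>"
proof -
  have u: "uT \<in> L2 {0<..<T}" using opt by (simp add: optimal_control_def)
  have const: "(\<lambda>_. c) \<in> L2 {0<..<b}" for c :: "'b::real_normed_vector"
    by (intro L2_continuous continuous_on_const)
  let ?u = "\<lambda>s. uT (a + s)"
  define d where "d s = uT (a + s) - ubar" for s
  have "uT \<in> L2 {a<..<a + b}" using ab by (intro L2_subset[OF u]) auto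
  then have us: "?u \<in> L2 {0<..<b}" by (rule L2_translate) auto
  have d: "d \<in> L2 {0<..<b}" unfolding d_def by (intro L2_diff us const) auto
  \<comment> \<open>The stationary pair is its own trajectory, so the deviation from it is again a
    trajectory of the same linear system.\<close>
  have X_d: "X (xT a - xbar) d s = xT (a + s) - xbar" if s: "0 \<le> s" "s \<le> b" for s
  proof -
    have u1: "uT \<in> L2 {0<..<a + s}" using ab s by (intro L2_subset[OF u]) auto
    have u2: "?u \<in> L2 {0<..<s}" using s by (intro L2_subset[OF us]) auto
    have "X (xT a - xbar) d s = X (xT a) ?u s - X xbar (\<lambda>_. ubar) s"
      unfolding d_def using s
      by (intro trajectory_diff u2 L2_continuous continuous_on_const) auto
    also have "X xbar (\<lambda>_. ubar) s = xbar"
      using stat s by (intro trajectory_stationary) (auto simp: stationary_optimal_def)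
    also have "X (xT a) ?u s = xT (a + s)"
      using trajectory_shift[OF u1 ab(1) s(1), of x0] ab s by (simp add: xT)
    finally show ?thesis .
  qed
  have U': "U \<zeta> \<in> L2 {0<..<b}" by (intro L2_truncate U_L2)
  have sU: "sig \<zeta> (U \<zeta>) \<in> L2 {0<..<b}" by (intro signal_L2_finite U')
  have W: "(\<lambda>s. signal C z x0 uT (a + s)) \<in> L2 {0<..<b}"
    using ab by (intro L2_translate[where J="{a<..<T}"] L2_subset[OF signal_L2_finite[OF u]]) auto
  have "P (xT a - xbar) \<bullet> \<zeta> - P (xT T - xbar) \<bullet> Sopt b \<zeta> = ip {0<..<b} (sig (xT a - xbar) d) (sig \<zeta> (U \<zeta>))"
    using P_inner_diff[OF d ab(2), of "xT a - xbar" \<zeta>] X_d[of b] ab by simp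
  \<comment> \<open>The target \<open>z\<close> cancels between the two signals on the right,
    leaving the deviation with target 0.\<close>
  also have "\<dots> = ip {0<..<b} (\<lambda>s. signal C z x0 uT (a + s) - (C xbar - z, ubar)) (sig \<zeta> (U \<zeta>))"
  proof (rule ip_cong[OF _ refl])
    fix s assume s: "s \<in> {0<..<b}"
    then have "xT (a + s) = X x0 uT (a + s)" using ab by (intro xT) auto
    with X_d[of s] s show "sig (xT a - xbar) d s = signal C z x0 uT (a + s) - (C xbar - z, ubar)"
      by (simp add: signal_def d_def blinfun.diff_right)
  qed
  also have "\<dots> = ip {0<..<b} (\<lambda>s. signal C z x0 uT (a + s)) (sig \<zeta> (U \<zeta>))
      - ip {0<..<b} (\<lambda>_. (C xbar - z, ubar)) (sig \<zeta> (U \<zeta>))"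
    by (intro ip_diff_left W const sU) auto
  also have "\<dots> = yT a \<bullet> \<zeta> - (ybar \<bullet> \<zeta> - ybar \<bullet> Sopt b \<zeta>)"
    using adjoint_state_inner[OF opt yT xT U' ab, of \<zeta>] stationary_state_inner[OF stat U' ab(2), of \<zeta>]
      U(2)[OF ab(2), of \<zeta>] by simp
  finally have main: "P (xT a - xbar) \<bullet> \<zeta> - P (xT T - xbar) \<bullet> Sopt b \<zeta>
      = yT a \<bullet> \<zeta> - (ybar \<bullet> \<zeta> - ybar \<bullet> Sopt b \<zeta>)" .
  \<comment> \<open>The terminal condition of the adjoint state is the integral over a single point.
    It accounts for the absence of \<open>yT T \<bullet> Sopt b \<zeta>\<close> from
    \<open>main\<close>.\<close>
  have "((\<lambda>s. adjoint (S (s - T)) (adjoint C (C (xT s) - z))) has_integral yT T) {T..T}"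
    using bspec[OF conjunct2[OF yT[unfolded adjoint_state_def]], of T] ab by simp
  then have "((\<lambda>s. adjoint (S (s - T)) (adjoint C (C (xT s) - z))) has_integral yT T) {T}" by simp
  then have "yT T = 0" by (rule has_integral_unique) (rule has_integral_refl(2))
  with main show ?thesis by (simp add: inner_diff_left)
qed

theorem proposition1p3:
  fixes D :: "'h::{real_inner,banach} set"
    and A :: "'h \<Rightarrow> 'h"
    and S :: "real \<Rightarrow> 'h \<Rightarrow>\<^sub>L 'h"
    and B :: "'u::{real_inner,banach} \<Rightarrow> 'h \<Rightarrow> real"
    and C P :: "'h \<Rightarrow>\<^sub>L 'h"
    and Sopt :: "real \<Rightarrow> 'h \<Rightarrow> 'h"
    and T0 T :: real
    and z x0 xbar ybar :: 'h
    and ubar :: 'u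
    and uT :: "real \<Rightarrow> 'u"
    and xT yT h g :: "real \<Rightarrow> 'h"
  assumes "generates D A S"
    and "control_operator D A B"
    and "admissible D A S B"
    and "T0 > 0"
    and "observable S C T0"
    and "adj_observable D A S B T0"
    and "{x \<in> D. A x = 0} \<inter> {x. C x = 0} = {0}"
    and "{\<phi> \<in> adj_dom D A. adj_op D A \<phi> = 0} \<inter> {\<phi> \<in> adj_dom D A. control_adj B \<phi> = 0} = {0}"
    and "T > T0"
    and "optimal_control D A S B C z {0<..<T} x0 uT"
    and "\<forall>t\<in>{0..T}. xT t = trajectory D A S B x0 uT t"
    and "adjoint_state S C z T xT yT"
    and "stationary_optimal D A B C z xbar ubar ybar"
    and "riccati_operator D A S B C P"
    and "optimal_semigroup D A S B C Sopt"
    and "\<forall>t\<in>{0..T}. h t = yT t - ybar - P (xT t - xbar)"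
    and "\<forall>t\<in>{0..T}. g t = h (T - t)"
  shows "\<forall>t\<in>{0..T}. g t = adjoint (Sopt t) (g 0)"
proof
  fix t assume t: "t \<in> {0..T}"
  interpret linear_quadratic_regulator D A S B C P Sopt T0
    by unfold_locales (use assms in auto)
  show "g t = adjoint (Sopt t) (g 0)"
  proof (rule inner_eq_imp_eq)
    fix \<zeta>
    \<comment> \<open>The instance \<open>a = T - t\<close>, \<open>b = t\<close>: time reversal
      makes the remaining time the argument of \<open>Sopt\<close>.\<close>
    have "(yT (T - t) - ybar - P (xT (T - t) - xbar)) \<bullet> \<zeta> = (yT T - ybar - P (xT T - xbar)) \<bullet> Sopt t \<zeta>"
      using t assms by (intro turnpike_inner[of z T x0 uT]) auto
    moreover have "g t = yT (T - t) - ybar - P (xT (T - t) - xbar)" "g 0 = yT T - ybar - P (xT T - xbar)"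
      using t assms(16,17) by auto
    ultimately have "g t \<bullet> \<zeta> = g 0 \<bullet> Sopt t \<zeta>" by simp
    then show "\<zeta> \<bullet> g t = \<zeta> \<bullet> adjoint (Sopt t) (g 0)"
      using t adjoint_inner[OF bounded_linear_Sopt, of t \<zeta> "g 0"] by (simp add: inner_commute)
  qed
qed

end
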